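(* Let $\{\mu_\delta\}_{\delta>0}\subseteq L^1(\mathbb{R}^d)$ and let $a\in\mathbb{R}^d$ be a fixed unit vector. Let $\omega\in C([0,\infty);[0,\infty))$ be nondecreasing with $\omega(0)=0$. Consider the following hypotheses: (i) ($L^1$-bounded moments) there exists $M<\infty$ such that $\int_{\mathbb{R}^d}|\mu_\delta(z)||z|\,dz<M$ for all $\delta>0$; (ii) (convergence of moments) $\left|\int_{\mathbb{R}^d}\mu_\delta(z)z\,dz-a\right|\le\omega(\delta)$ for all $\delta>0$; (iii') (concentration) $\int_{\mathbb{R}^d\setminus B_\delta(0)}|\mu_\delta(z)||z|\,dz\le\omega(\delta)$ for all $\delta>0$; (iii'') (compact support) $\operatorname{supp}(\mu_\delta)\subseteq\overline{B_\delta(0)}$ for all $\delta>0$. Let $1\le p<\infty$ and let $p'$ be its Hölder conjugate. Then the following hold. (a) If $u\in L^p(\mathbb{R}^d)$ and (i), (ii), (iii') all hold, then $\mathcal{D}_\delta u\in L^p(\mathbb{R}^d)$ (for every $\delta>0$), and for each $\varphi\in W^{1,p'}(\mathbb{R}^d)$ and each $\varepsilon>0$ there exists $\delta_\varepsilon>0$ such that $$\left|\int_{\mathbb{R}^d}\mathcal{D}_\delta u(x)\,\varphi(x)\,dx+\int_{\mathbb{R}^d}u(x)\,\bigl(a\cdot\nabla\varphi(x)\bigr)\,dx\right|\le\varepsilon\|u\|_{L^p(\mathbb{R}^d)}\quad\text{for all }0<\delta<\delta_\varepsilon.$$ (b) If $u\in W^{1,p}(\mathbb{R}^d)$ and (i),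 (ii), (iii') all hold, then for each $\varepsilon>0$ there exists $\delta_\varepsilon>0$ such that $\|\mathcal{D}_\delta u-a\cdot\nabla u\|_{L^p(\mathbb{R}^d)}<\varepsilon$ for all $0<\delta<\delta_\varepsilon$. (c) If $u:\mathbb{R}^d\to\mathbb{R}$ is differentiable and there exists $0<\alpha\le1$ such that $\omega\in C^{0,\alpha}([0,\infty))$ and $\nabla u\in C^{0,\alpha}(\mathbb{R}^d)$, and if (i), (ii), (iii'') hold, then for each $x\in\mathbb{R}^d$ there exists $C<\infty$ such that $$|\mathcal{D}_\delta u(x)-a\cdot\nabla u(x)|<C\delta^\alpha\quad\text{for all }\delta>0.$$
   Context: Functions and kernels are real-valued. $B_\delta(0)$ is the open ball of radius $\delta$ about $0$ in $\mathbb{R}^d$, and $\cdot$ is the Euclidean dot product. For $\mu_\delta\in L^1(\mathbb{R}^d)$ and a function $u:\mathbb{R}^d\to\mathbb{R}$, the nonlocal (directional) derivative is $$\mathcal{D}_\delta u(x)=\int_{\mathbb{R}^d}[u(x+z)-u(x)]\,\mu_\delta(z)\,dz.$$ $C^{0,\alpha}$ denotes the class of (globally) Hölder continuous functions with exponent $\alpha$. *)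

theory Defs
  imports "HOL-Analysis.Analysis" "HOL-Probability.Essential_Supremum"
begin

section \<open>Lebesgue spaces\<close>

text \<open>
  Functions are representatives of their almost-everywhere classes. The norm takes values in
  \<^typ>\<open>ennreal\<close>, so that it is \<open>\<infinity>\<close> (and not \<open>0\<close>) for functions outside the Lebesgue space.
\<close>

definition Lp_norm :: "ennreal \<Rightarrow> ('a::euclidean_space \<Rightarrow> 'b::euclidean_space) \<Rightarrow> ennreal" where
  "Lp_norm p f =
    (if p = \<infinity> then esssup lebesgue (\<lambda>x. ennreal (norm (f x)))
     else let I = (\<integral>\<^sup>+ x. ennreal (norm (f x) powr enn2real p) \<partial>lebesgue)
          in if I = \<infinity> then \<infinity> else ennreal (enn2real I powr (1 / enn2real p)))"

definition Lp :: "ennreal \<Rightarrow> ('a::euclidean_space \<Rightarrow> 'b::euclidean_space) set" where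
  "Lp p = {f \<in> borel_measurable lebesgue. Lp_norm p f < \<infinity>}"

text \<open>In \<^typ>\<open>ennreal\<close>, \<open>inverse \<infinity> = 0\<close>, so \<open>1\<close> and \<open>\<infinity>\<close> are conjugate.\<close>

definition hoelder_conjugate :: "ennreal \<Rightarrow> ennreal \<Rightarrow> bool" where
  "hoelder_conjugate p q \<longleftrightarrow> inverse p + inverse q = 1"

section \<open>Sobolev spaces\<close>

abbreviation partial_deriv :: "'a \<Rightarrow> ('a::euclidean_space \<Rightarrow> real) \<Rightarrow> 'a \<Rightarrow> real" where
  "partial_deriv i f \<equiv> (\<lambda>x. frechet_derivative f (at x) i)"

fun C_k :: "nat \<Rightarrow> ('a::euclidean_space \<Rightarrow> real) \<Rightarrow> bool" where
  "C_k 0 f \<longleftrightarrow> continuous_on UNIV f"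
| "C_k (Suc k) f \<longleftrightarrow> (\<forall>x. f differentiable (at x)) \<and> (\<forall>i\<in>Basis. C_k k (partial_deriv i f))"

definition test_function :: "('a::euclidean_space \<Rightarrow> real) \<Rightarrow> bool" where
  "test_function \<psi> \<longleftrightarrow> (\<forall>k. C_k k \<psi>) \<and> compact (closure {x. \<psi> x \<noteq> 0})"

definition locally_integrable :: "('a::euclidean_space \<Rightarrow> 'b::euclidean_space) \<Rightarrow> bool" where
  "locally_integrable f \<longleftrightarrow> (\<forall>K. compact K \<longrightarrow> set_integrable lebesgue K f)"

text \<open>A relation, because the weak gradient is determined only up to null sets.\<close>

definition weak_gradient :: "('a::euclidean_space \<Rightarrow> real) \<Rightarrow> ('a \<Rightarrow> 'a) \<Rightarrow> bool" where
  "weak_gradient u g \<longleftrightarrow>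
     locally_integrable u \<and> locally_integrable g \<and>
     (\<forall>\<psi>. test_function \<psi> \<longrightarrow>
        (\<forall>i\<in>Basis. (\<integral>x. u x * partial_deriv i \<psi> x \<partial>lebesgue) =
                   - (\<integral>x. (g x \<bullet> i) * \<psi> x \<partial>lebesgue)))"

definition W1p :: "ennreal \<Rightarrow> ('a::euclidean_space \<Rightarrow> real) set" where
  "W1p p = {u \<in> Lp p. \<exists>g\<in>Lp p. weak_gradient u g}"

section \<open>Hoelder continuity and supports\<close>

text \<open>Only the Hoelder seminorm is required to be finite; the function may be unbounded.\<close>

definition hoelder_on :: "real \<Rightarrow> 'a::metric_space set \<Rightarrow> ('a \<Rightarrow> 'b::metric_space) \<Rightarrow> bool" where
  "hoelder_on \<alpha> S f \<longleftrightarrow> (\<exists>C. \<forall>x\<in>S. \<forall>y\<in>S. dist (f x) (f y) \<le> C * dist x y powr \<alpha>)"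

text \<open>
  The support of an almost-everywhere class: the complement of the union of all open sets
  on which the function vanishes almost everywhere.
\<close>

definition ess_support :: "('a::euclidean_space \<Rightarrow> real) \<Rightarrow> 'a set" where
  "ess_support f = - \<Union>{U. open U \<and> (AE x in lebesgue. x \<in> U \<longrightarrow> f x = 0)}"

section \<open>The nonlocal derivative and the hypotheses on the kernels\<close>

text \<open>
  The Bochner integral is \<open>0\<close> for non-integrable integrands, so convergence of the defining
  integral is expressed separately.
\<close>

definition nonlocal_deriv_exists ::
    "('a::euclidean_space \<Rightarrow> real) \<Rightarrow> ('a \<Rightarrow> real) \<Rightarrow> 'a \<Rightarrow> bool" where
  "nonlocal_deriv_exists k u x \<longleftrightarrow> integrable lebesgue (\<lambda>z. (u (x + z) - u x) * k z)"

definition nonlocal_deriv ::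
    "('a::euclidean_space \<Rightarrow> real) \<Rightarrow> ('a \<Rightarrow> real) \<Rightarrow> 'a \<Rightarrow> real" where
  "nonlocal_deriv k u x = (\<integral>z. (u (x + z) - u x) * k z \<partial>lebesgue)"

definition bounded_moments :: "(real \<Rightarrow> 'a::euclidean_space \<Rightarrow> real) \<Rightarrow> bool" where
  "bounded_moments \<mu> \<longleftrightarrow>
     (\<exists>M::real. \<forall>\<delta>>0. (\<integral>\<^sup>+ z. ennreal (\<bar>\<mu> \<delta> z\<bar> * norm z) \<partial>lebesgue) < ennreal M)"

definition moments_converge ::
    "(real \<Rightarrow> 'a::euclidean_space \<Rightarrow> real) \<Rightarrow> 'a \<Rightarrow> (real \<Rightarrow> real) \<Rightarrow> bool" where
  "moments_converge \<mu> a \<omega> \<longleftrightarrow>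
     (\<forall>\<delta>>0. norm ((\<integral>z. \<mu> \<delta> z *\<^sub>R z \<partial>lebesgue) - a) \<le> \<omega> \<delta>)"

definition moments_concentrate ::
    "(real \<Rightarrow> 'a::euclidean_space \<Rightarrow> real) \<Rightarrow> (real \<Rightarrow> real) \<Rightarrow> bool" where
  "moments_concentrate \<mu> \<omega> \<longleftrightarrow>
     (\<forall>\<delta>>0. (\<integral>\<^sup>+ z \<in> - ball 0 \<delta>. ennreal (\<bar>\<mu> \<delta> z\<bar> * norm z) \<partial>lebesgue) \<le> ennreal (\<omega> \<delta>))"

definition supported_in_balls :: "(real \<Rightarrow> 'a::euclidean_space \<Rightarrow> real) \<Rightarrow> bool" where
  "supported_in_balls \<mu> \<longleftrightarrow> (\<forall>\<delta>>0. ess_support (\<mu> \<delta>) \<subseteq> closure (ball 0 \<delta>))"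

end

theory Submission
  imports Defs
begin

text \<open>
  The kernels concentrate at the origin and their first moments tend to \<open>a\<close>. So if \<open>u\<close> has a first
  order Taylor expansion \<open>u (x + z) - u x = g x \<bullet> z + h x z\<close>, then the nonlocal derivative is the
  first moment of the kernel applied to \<open>g x\<close>, which is close to \<open>a \<bullet> g x\<close>, plus the integral of
  the remainder \<open>h\<close> against the kernel. The three claims differ in how the remainder is controlled.

  For functions with a Hoelder continuous gradient the mean value theorem bounds it by a multiple of
  \<open>norm z powr \<alpha> * norm z\<close> (\<open>hoelder_gradient_remainder\<close>). The kernel is supported where
  \<open>norm z \<le> \<delta>\<close>, and its first absolute moment is bounded.

  For Sobolev functions the Taylor expansion comes from the increment formula
  \<open>weak_gradient_increment\<close>: for fixed \<open>z\<close> and almost every \<open>x\<close>, the increment of \<open>u\<close> is the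
  integral over \<open>t\<close> in \<open>{0..1}\<close> of \<open>g (x + t *\<^sub>R z) \<bullet> z\<close>. It holds because both sides have the same
  integrals against test functions, and the fundamental lemma of the calculus of variations applies.
  So \<open>h x z\<close> is at most \<open>norm z\<close> times an average of \<open>norm (g (x + t *\<^sub>R z) - g x)\<close>, which is small in
  \<open>L\<^sup>p\<close> for \<open>norm z < \<delta>\<close> because translations are continuous there for finite \<open>p\<close>
  (\<open>translation_continuous_Lp\<close>). For larger \<open>z\<close> it is just bounded, but outside the ball of radius
  \<open>\<delta>\<close> the first absolute moment of the kernel is at most \<open>\<omega> \<delta>\<close> (\<open>nn_integral_kernel_split\<close>).
  The integral over \<open>z\<close> is taken out of the norm by Jensen's inequality with respect to the measure
  with density \<open>\<bar>\<mu> \<delta> z\<bar> * norm z\<close> (\<open>lp_mass_integral_jensen_le\<close>).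

  For \<open>u\<close> in \<open>L\<^sup>p\<close> the increment formula is applied to \<open>\<phi>\<close>, and the translations of
  its gradient are then moved over to \<open>u\<close> (\<open>increment_pairing_error_le\<close>). Only the continuity of the
  translations of \<open>u\<close> in \<open>L\<^sup>p\<close> enters, so the argument also covers \<open>p = 1\<close>, where the gradient of
  \<open>\<phi>\<close> is just essentially bounded.

  The last two arguments are carried out for Borel functions, since \<open>u (x + z)\<close> is then jointly
  measurable in \<open>x\<close> and \<open>z\<close>. Passing from Lebesgue measurable functions to Borel representatives
  changes the nonlocal derivative only on a null set (\<open>nonlocal_deriv_borel\<close>).
\<close>

section \<open>Test functions and the fundamental lemma\<close>

lemma C_k_Suc_imp_C_k: "C_k (Suc k) f \<Longrightarrow> C_k k f"
proof (induction k arbitrary: f)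
  case 0
  then show ?case
    by (auto intro!: differentiable_imp_continuous_on simp: differentiable_on_def)
qed auto

lemma C_k_SucI:
  assumes "\<And>x. (f has_derivative D x) (at x)" "\<And>i. i \<in> Basis \<Longrightarrow> C_k k (\<lambda>x. D x i)"
  shows "C_k (Suc k) f"
proof -
  have "frechet_derivative f (at x) = D x" for x
    using frechet_derivative_at[OF assms(1)[of x]] by simp
  with assms show ?thesis
    by (auto simp: differentiable_def)
qed

lemma C_k_has_derivative:
  "C_k (Suc k) f \<Longrightarrow> (f has_derivative frechet_derivative f (at x)) (at x)"
  by (simp add: frechet_derivative_works)

lemma C_k_const: "C_k k (\<lambda>_. c)"
proof (induction k arbitrary: c)
  case (Suc k)
  then show ?case by (intro C_k_SucI[where D="\<lambda>_ _. 0"]) auto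
qed simp

lemma C_k_add: "C_k k f \<Longrightarrow> C_k k g \<Longrightarrow> C_k k (\<lambda>x. f x + g x)"
proof (induction k arbitrary: f g)
  case (Suc k)
  show ?case
    by (rule C_k_SucI[OF has_derivative_add[OF C_k_has_derivative[OF Suc.prems(1)]
          C_k_has_derivative[OF Suc.prems(2)]]])
       (use Suc in auto)
qed (auto intro: continuous_on_add)

lemma C_k_mult: "C_k k f \<Longrightarrow> C_k k g \<Longrightarrow> C_k k (\<lambda>x. f x * g x)"
proof (induction k arbitrary: f g)
  case (Suc k)
  have "C_k k f" "C_k k g"
    using Suc.prems by (auto intro!: C_k_Suc_imp_C_k simp del: C_k.simps)
  then show ?case
    by (intro C_k_SucI[OF has_derivative_mult[OF C_k_has_derivative[OF Suc.prems(1)]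
          C_k_has_derivative[OF Suc.prems(2)]]])
       (use Suc in \<open>auto intro!: C_k_add\<close>)
qed (auto intro: continuous_on_mult)

lemma C_k_prod: "(\<And>i. i \<in> I \<Longrightarrow> C_k k (f i)) \<Longrightarrow> C_k k (\<lambda>x. \<Prod>i\<in>I. f i x)"
  by (induction I rule: infinite_finite_induct) (auto intro: C_k_mult C_k_const)

lemma C_k_translate: "C_k k f \<Longrightarrow> C_k k (\<lambda>x. f (x - c))"
proof (induction k arbitrary: f)
  case 0
  then show ?case
    by (auto intro!: continuous_on_compose2[of UNIV f] continuous_intros)
next
  case (Suc k)
  have "((\<lambda>x. f (x - c)) has_derivative frechet_derivative f (at (x - c))) (at x)" for x
  proof (rule has_derivative_compose[where f="\<lambda>x. x - c" and f'="\<lambda>h. h" and g=f])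
    show "((\<lambda>x. x - c) has_derivative (\<lambda>h. h)) (at x)"
      by (auto intro!: derivative_eq_intros)
  qed (rule C_k_has_derivative[OF Suc.prems])
  then show ?case
    by (rule C_k_SucI) (use Suc in auto)
qed

text \<open>
  The induction runs along a tower of derivatives, since differentiating the ridge function
  of \<open>H m\<close> produces the one of \<open>H (Suc m)\<close>.
\<close>
lemma C_k_ridge:
  fixes i :: "'a::euclidean_space"
  assumes "\<And>m t. (H m has_real_derivative H (Suc m) t) (at t)"
  shows "C_k k (\<lambda>x. H m (c + s * (x \<bullet> i)))"
proof (induction k arbitrary: m)
  case 0
  have "continuous_on UNIV (H m)"
    by (rule DERIV_continuous_on[where D="H (Suc m)"]) (rule has_field_derivative_at_within[OF assms])
  then show ?case
    by (auto intro!: continuous_on_compose2[of UNIV "H m"] continuous_intros)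
next
  case (Suc k)
  have "((\<lambda>x. H m (c + s * (x \<bullet> i))) has_derivative
      (\<lambda>h. H (Suc m) (c + s * (x \<bullet> i)) * (s * (h \<bullet> i)))) (at x)" for x
  proof (rule has_derivative_compose[where g="H m" and g'="\<lambda>h. H (Suc m) (c + s * (x \<bullet> i)) * h"])
    show "((\<lambda>x. c + s * (x \<bullet> i)) has_derivative (\<lambda>h. s * (h \<bullet> i))) (at x)"
      by (auto intro!: derivative_eq_intros)
  qed (use assms in \<open>simp add: has_field_derivative_def\<close>)
  then show ?case
    by (rule C_k_SucI) (use Suc C_k_const C_k_mult in blast)
qed

text \<open>
  The factor \<open>poly P (1 / t)\<close> makes the family closed under differentiation; the bump functions
  only use the function \<open>exp (- 1 / t)\<close> itself, which is \<open>P = 1\<close>.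
\<close>
definition flat_exp :: "real poly \<Rightarrow> real \<Rightarrow> real" where
  "flat_exp P t = (if t > 0 then poly P (1 / t) * exp (- (1 / t)) else 0)"

lemma tendsto_poly_times_exp_minus:
  fixes P :: "real poly"
  shows "((\<lambda>y. poly P y * exp (- y)) \<longlongrightarrow> 0) at_top"
proof -
  have "((\<lambda>y. \<Sum>i\<le>degree P. coeff P i * (y ^ i / exp y)) \<longlongrightarrow> (\<Sum>i\<le>degree P. coeff P i * 0)) at_top"
    by (intro tendsto_sum tendsto_mult tendsto_const tendsto_power_div_exp_0)
  then show ?thesis
    by (simp add: poly_altdef exp_minus sum_distrib_right divide_inverse mult.assoc)
qed

text \<open>
  At \<open>t = 0\<close> the right difference quotient is \<open>y * poly P y * exp (- y)\<close> with \<open>y = 1 / t\<close>,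
  which tends to \<open>0\<close> because the exponential beats every polynomial.
\<close>
lemma flat_exp_deriv:
  "(flat_exp P has_real_derivative flat_exp ([:0, 0, 1:] * (P - pderiv P)) t) (at t)"
proof -
  consider "t > 0" | "t < 0" | "t = 0" by linarith
  then show ?thesis
  proof cases
    case 1
    have "((\<lambda>t. poly P (1 / t) * exp (- (1 / t))) has_real_derivative
        flat_exp ([:0, 0, 1:] * (P - pderiv P)) t) (at t)"
      using 1 unfolding flat_exp_def
      by (auto intro!: derivative_eq_intros DERIV_chain2[OF poly_DERIV]
          simp: field_simps power2_eq_square)
    then show ?thesis
      by (rule has_field_derivative_transform_within_open[where S="{0<..}"])
         (use 1 in \<open>auto simp: flat_exp_def\<close>)
  next
    case 2
    have "((\<lambda>_. 0) has_real_derivative 0) (at t)" by simp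
    then have "(flat_exp P has_real_derivative 0) (at t)"
      by (rule has_field_derivative_transform_within_open[where S="{..<0}"])
         (use 2 in \<open>auto simp: flat_exp_def\<close>)
    with 2 show ?thesis by (simp add: flat_exp_def)
  next
    case 3
    have "((\<lambda>h. poly ([:0, 1:] * P) (inverse h) * exp (- inverse h)) \<longlongrightarrow> 0) (at_right 0)"
      by (rule filterlim_compose[OF tendsto_poly_times_exp_minus filterlim_inverse_at_top_right])
    then have "((\<lambda>h. flat_exp P h / h) \<longlongrightarrow> 0) (at_right 0)"
      by (rule Lim_transform_eventually)
         (auto simp: eventually_at_right_field flat_exp_def field_simps intro!: exI[of _ 1])
    moreover have "((\<lambda>h. flat_exp P h / h) \<longlongrightarrow> 0) (at_left 0)"
      by (rule Lim_transform_eventually[OF tendsto_const])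
         (auto simp: eventually_at_left_field flat_exp_def intro!: exI[of _ "-1"])
    ultimately have "((\<lambda>h. flat_exp P h / h) \<longlongrightarrow> 0) (at 0)"
      by (simp add: filterlim_split_at)
    then show ?thesis
      using 3 by (simp add: has_field_derivative_iff flat_exp_def)
  qed
qed

lemma flat_exp_1: "flat_exp 1 t = (if t > 0 then exp (- (1 / t)) else 0)"
  by (simp add: flat_exp_def)

lemma C_k_flat_exp_ridge: "C_k k (\<lambda>x. flat_exp 1 (c + s * (x \<bullet> i)))"
  using C_k_ridge[of "\<lambda>m. flat_exp (((\<lambda>P. [:0, 0, 1:] * (P - pderiv P)) ^^ m) 1)" k 0 c s i] flat_exp_deriv
  by simp

text \<open>
  Each factor is \<open>exp (- 1 / (n * s))\<close>, where \<open>s\<close> is the distance to one face of the box, so as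
  \<open>n\<close> grows the bumps increase to the indicator of the open box. These are enough test functions
  for the fundamental lemma, without any mollification.
\<close>
definition box_bump :: "'a::euclidean_space \<Rightarrow> 'a \<Rightarrow> nat \<Rightarrow> 'a \<Rightarrow> real" where
  "box_bump a b n x = (\<Prod>i\<in>Basis. flat_exp 1 (real n * (x \<bullet> i - a \<bullet> i)) * flat_exp 1 (real n * (b \<bullet> i - x \<bullet> i)))"

lemma box_bump_bounds: "0 \<le> box_bump a b n x" "box_bump a b n x \<le> 1"
  unfolding box_bump_def by (auto intro!: prod_nonneg prod_le_1 mult_le_one simp: flat_exp_1)

lemma box_bump_outside: "x \<notin> box a b \<Longrightarrow> box_bump a b n x = 0"
  unfolding box_bump_def
  by (rule prod_zero) (force simp: mem_box flat_exp_1 zero_less_mult_iff not_less)+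

lemma test_function_box_bump: "test_function (box_bump a b n)"
  unfolding test_function_def
proof
  have 1: "flat_exp 1 (real n * (x \<bullet> i - a \<bullet> i)) = flat_exp 1 (- (real n * (a \<bullet> i)) + real n * (x \<bullet> i))"
    and 2: "flat_exp 1 (real n * (b \<bullet> i - x \<bullet> i)) = flat_exp 1 (real n * (b \<bullet> i) + (- real n) * (x \<bullet> i))" for x i
    by (simp_all add: algebra_simps)
  show "\<forall>k. C_k k (box_bump a b n)"
    unfolding box_bump_def[abs_def] 1 2 by (intro allI C_k_prod C_k_mult C_k_flat_exp_ridge)
  have "{x. box_bump a b n x \<noteq> 0} \<subseteq> cbox a b"
    using box_bump_outside[of _ a b n] box_subset_cbox[of a b] by blast
  then show "compact (closure {x. box_bump a b n x \<noteq> 0})"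
    by (meson bounded_cbox bounded_subset compact_closure)
qed

lemma box_bump_tendsto: "(\<lambda>n. box_bump a b n x) \<longlonglongrightarrow> indicat_real (box a b) x"
proof (cases "x \<in> box a b")
  case True
  have "(\<lambda>n. flat_exp 1 (real n * s)) \<longlonglongrightarrow> 1" if "s > 0" for s
  proof -
    have "(\<lambda>n. exp (- (inverse (real n) * inverse s))) \<longlonglongrightarrow> exp (- (0 * inverse s))"
      by (intro tendsto_intros lim_inverse_n)
    moreover have "\<forall>\<^sub>F n in sequentially. exp (- (inverse (real n) * inverse s)) = flat_exp 1 (real n * s)"
      using eventually_gt_at_top[of 0]
      by eventually_elim (use that in \<open>auto simp: flat_exp_1 field_simps\<close>)
    ultimately show ?thesis
      by (auto intro: Lim_transform_eventually)
  qed
  then have "(\<lambda>n. box_bump a b n x) \<longlonglongrightarrow> (\<Prod>i\<in>(Basis::'a set). 1 * 1)"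
    unfolding box_bump_def using True by (intro tendsto_prod tendsto_mult) (auto simp: mem_box)
  with True show ?thesis by simp
qed (simp add: box_bump_outside)

lemma enn2real_inj: "A \<noteq> \<infinity> \<Longrightarrow> B \<noteq> \<infinity> \<Longrightarrow> enn2real A = enn2real B \<Longrightarrow> A = B"
  by (cases A; cases B) auto

text \<open>
  The positive and the negative part of \<open>f\<close>, as densities, agree on boxes. Boxes are stable under
  intersection and generate the Borel sets, so the two measures and hence the densities agree.
\<close>
lemma AE_zero_if_integral_box_zero:
  fixes f :: "'a::euclidean_space \<Rightarrow> real"
  assumes [measurable]: "f \<in> borel_measurable borel"
    and int: "\<And>a b. set_integrable lborel (box a b) f"
    and zero: "\<And>a b. (\<integral>x\<in>box a b. f x \<partial>lborel) = 0"
  shows "AE x in lborel. f x = 0"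
proof -
  let ?P = "density lborel (\<lambda>x. ennreal (f x))" and ?N = "density lborel (\<lambda>x. ennreal (- f x))"
  have em: "emeasure ?P (box a b) = emeasure ?N (box a b) \<and> emeasure ?P (box a b) \<noteq> \<infinity>" for a b
  proof -
    let ?g = "\<lambda>x. indicat_real (box a b) x * f x"
    have g: "integrable lborel ?g" "(LBINT x. ?g x) = 0"
      using int zero by (auto simp: set_integrable_def set_lebesgue_integral_def)
    have *: "emeasure ?P (box a b) = (\<integral>\<^sup>+x. ennreal (?g x) \<partial>lborel)"
        "emeasure ?N (box a b) = (\<integral>\<^sup>+x. ennreal (- ?g x) \<partial>lborel)"
      by (auto simp: emeasure_density intro!: nn_integral_cong split: split_indicator)
    have fin: "(\<integral>\<^sup>+x. ennreal (?g x) \<partial>lborel) \<noteq> \<infinity>" "(\<integral>\<^sup>+x. ennreal (- ?g x) \<partial>lborel) \<noteq> \<infinity>"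
      using g(1) by (auto elim: integrableE simp: real_integrable_def)
    moreover have "enn2real (\<integral>\<^sup>+x. ennreal (?g x) \<partial>lborel) = enn2real (\<integral>\<^sup>+x. ennreal (- ?g x) \<partial>lborel)"
      using real_lebesgue_integral_def[OF g(1)] g(2) by simp
    ultimately have "(\<integral>\<^sup>+x. ennreal (?g x) \<partial>lborel) = (\<integral>\<^sup>+x. ennreal (- ?g x) \<partial>lborel)"
      by (rule enn2real_inj)
    with fin(1) show ?thesis
      unfolding * by (rule conjI[rotated])
  qed
  have "?P = ?N"
  proof (rule measure_eqI_generator_eq)
    let ?E = "range (\<lambda>(a, b). box a b::'a set)"
    show "Int_stable ?E"
      by (auto simp: Int_stable_def box_Int_box)
    show "?E \<subseteq> Pow UNIV" "sets ?P = sigma_sets UNIV ?E" "sets ?N = sigma_sets UNIV ?E"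
      by (simp_all add: borel_eq_box)
    let ?A = "\<lambda>n::nat. box (- (real n *\<^sub>R One)) (real n *\<^sub>R One) :: 'a set"
    show "range ?A \<subseteq> ?E" "(\<Union>i. ?A i) = UNIV"
      unfolding UN_box_eq_UNIV by auto
    show "emeasure ?P (?A i) \<noteq> \<infinity>" for i by (rule conjunct2[OF em])
    show "emeasure ?P X = emeasure ?N X" if "X \<in> ?E" for X
      using that em by auto
  qed
  then have "AE x in lborel. ennreal (f x) = ennreal (- f x)"
    by (subst (asm) sigma_finite_measure.density_unique_iff[OF sigma_finite_lborel]) auto
  then show ?thesis
  proof eventually_elim
    case (elim x)
    then show ?case
      by (cases "f x \<ge> 0") (auto simp: ennreal_neg ennreal_eq_0_iff eq_commute[of 0])
  qed
qed

text \<open>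
  Dominated convergence along the box bumps turns the hypothesis into vanishing of the integrals
  over all boxes.
\<close>
lemma fundamental_lemma_calculus_of_variations:
  fixes f :: "'a::euclidean_space \<Rightarrow> real"
  assumes [measurable]: "f \<in> borel_measurable borel"
    and int: "\<And>a b. set_integrable lborel (box a b) f"
    and zero: "\<And>\<psi>. test_function \<psi> \<Longrightarrow> (LBINT x. f x * \<psi> x) = 0"
  shows "AE x in lborel. f x = 0"
proof (rule AE_zero_if_integral_box_zero[OF assms(1,2)])
  fix a b :: 'a
  have cont: "continuous_on UNIV (box_bump a b n)" for n
    using test_function_box_bump[of a b n] unfolding test_function_def by (auto dest: spec[of _ 0])
  have [measurable]: "box_bump a b n \<in> borel_measurable borel" for n
    using borel_measurable_continuous_onI[OF cont] .
  have "(\<lambda>n. LBINT x. f x * box_bump a b n x) \<longlonglongrightarrow> (LBINT x. f x * indicat_real (box a b) x)"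
  proof (rule integral_dominated_convergence)
    show "integrable lborel (\<lambda>x. norm (indicat_real (box a b) x * f x))"
      using int[of a b] by (intro integrable_norm) (auto simp: set_integrable_def)
    show "AE x in lborel. (\<lambda>n. f x * box_bump a b n x) \<longlonglongrightarrow> f x * indicat_real (box a b) x"
      by (intro AE_I2 tendsto_intros box_bump_tendsto)
    show "AE x in lborel. norm (f x * box_bump a b n x) \<le> norm (indicat_real (box a b) x * f x)" for n
    proof (intro AE_I2)
      fix x
      show "norm (f x * box_bump a b n x) \<le> norm (indicat_real (box a b) x * f x)"
        using box_bump_bounds[of a b n x] box_bump_outside[of x a b n]
        by (auto simp: abs_mult mult_left_le split: split_indicator)
    qed
  qed auto
  moreover have "(LBINT x. f x * box_bump a b n x) = 0" for n
    by (rule zero[OF test_function_box_bump])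
  ultimately show "(\<integral>x\<in>box a b. f x \<partial>lborel) = 0"
    by (simp add: set_lebesgue_integral_def LIMSEQ_const_iff mult.commute)
qed

section \<open>Integrals of powers\<close>

lemma nn_integral_lborel_translate:
  fixes f :: "'a::euclidean_space \<Rightarrow> ennreal"
  assumes [measurable]: "f \<in> borel_measurable borel"
  shows "(\<integral>\<^sup>+x. f (x + z) \<partial>lborel) = (\<integral>\<^sup>+x. f x \<partial>lborel)"
proof -
  have "(\<integral>\<^sup>+x. f x \<partial>lborel) = (\<integral>\<^sup>+x. f x \<partial>distr lborel borel ((+) z))"
    by (simp add: lborel_distr_plus)
  also have "\<dots> = (\<integral>\<^sup>+x. f (x + z) \<partial>lborel)"
    by (subst nn_integral_distr) (auto simp: add.commute)
  finally show ?thesis by simp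
qed

lemma integral_lborel_translate:
  fixes f :: "'a::euclidean_space \<Rightarrow> real"
  assumes [measurable]: "f \<in> borel_measurable borel"
  shows "(LBINT x. f (x + z)) = (LBINT x. f x)"
proof -
  have "(LBINT x. f x) = (\<integral>x. f x \<partial>distr lborel borel ((+) z))"
    by (simp add: lborel_distr_plus)
  also have "\<dots> = (LBINT x. f (x + z))"
    by (subst integral_distr) (auto simp: add.commute)
  finally show ?thesis by simp
qed

lemma integrable_lborel_translate:
  fixes f :: "'a::euclidean_space \<Rightarrow> real"
  assumes f: "integrable lborel f"
  shows "integrable lborel (\<lambda>x. f (x + z))"
proof -
  have "integrable (distr lborel borel ((+) z)) f"
    using f by (simp add: lborel_distr_plus)
  then show ?thesis
    by (subst (asm) integrable_distr_eq) (use f in \<open>auto simp: add.commute\<close>)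
qed

text \<open>
  The \<open>r\<close>-th power of the norm of \<open>L\<^sup>r\<close>. Tonelli's theorem applies to it directly, and it is
  small exactly when the norm is.
\<close>
abbreviation lp_mass :: "real \<Rightarrow> ('a::euclidean_space \<Rightarrow> 'b::euclidean_space) \<Rightarrow> ennreal" where
  "lp_mass r f \<equiv> \<integral>\<^sup>+x. ennreal (norm (f x) powr r) \<partial>lborel"

lemma lp_mass_translate:
  fixes f :: "'a::euclidean_space \<Rightarrow> 'b::euclidean_space"
  assumes [measurable]: "f \<in> borel_measurable borel"
  shows "lp_mass r (\<lambda>x. f (x + z)) = lp_mass r f"
  by (rule nn_integral_lborel_translate[of "\<lambda>x. ennreal (norm (f x) powr r)"]) simp

lemma norm_add_powr_le:
  fixes a b :: "'b::real_normed_vector"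
  assumes "r \<ge> 0"
  shows "norm (a + b) powr r \<le> 2 powr r * (norm a powr r + norm b powr r)"
proof -
  have "norm (a + b) powr r \<le> (2 * max (norm a) (norm b)) powr r"
    using norm_triangle_ineq[of a b] assms by (intro powr_mono2) auto
  also have "\<dots> = 2 powr r * max (norm a) (norm b) powr r"
    by (simp add: powr_mult)
  also have "\<dots> \<le> 2 powr r * (norm a powr r + norm b powr r)"
    by (intro mult_left_mono) (auto simp: max_def)
  finally show ?thesis .
qed

lemma lp_mass_add_le:
  fixes f g :: "'a::euclidean_space \<Rightarrow> 'b::euclidean_space"
  assumes [measurable]: "f \<in> borel_measurable borel" "g \<in> borel_measurable borel" and "r \<ge> 0"
  shows "lp_mass r (\<lambda>x. f x + g x) \<le> ennreal (2 powr r) * (lp_mass r f + lp_mass r g)"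
proof -
  have "lp_mass r (\<lambda>x. f x + g x) \<le>
      (\<integral>\<^sup>+x. ennreal (2 powr r) * (ennreal (norm (f x) powr r) + ennreal (norm (g x) powr r)) \<partial>lborel)"
    using norm_add_powr_le[OF \<open>r \<ge> 0\<close>]
    by (intro nn_integral_mono) (simp flip: ennreal_plus ennreal_mult')
  also have "\<dots> = ennreal (2 powr r) * (lp_mass r f + lp_mass r g)"
    by (simp add: nn_integral_cmult nn_integral_add)
  finally show ?thesis .
qed

lemma lp_mass_diff_le:
  fixes f g :: "'a::euclidean_space \<Rightarrow> 'b::euclidean_space"
  assumes [measurable]: "f \<in> borel_measurable borel" "g \<in> borel_measurable borel" and "r \<ge> 0"
  shows "lp_mass r (\<lambda>x. f x - g x) \<le> ennreal (2 powr r) * (lp_mass r f + lp_mass r g)"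
  using lp_mass_add_le[of f "\<lambda>x. - g x" r] assms by simp

text \<open>
  The graph of \<open>k powr r\<close> lies above its tangent at \<open>s\<close>, by Young's inequality.
\<close>
lemma powr_tangent_le:
  fixes k s r :: real
  assumes "r \<ge> 1" "s > 0" "k \<ge> 0"
  shows "r * s powr (r - 1) * k \<le> k powr r + (r - 1) * s powr r"
proof (cases "r = 1")
  case False
  define q where "q = r / (r - 1)"
  have q: "q > 1" "1 / r + 1 / q = 1" "(r - 1) * q = r"
    using False assms by (auto simp: q_def field_simps)
  have "k * s powr (r - 1) \<le> k powr r / r + (s powr (r - 1)) powr q / q"
    using False assms q by (intro Youngs_inequality) auto
  also have "\<dots> = k powr r / r + s powr r / q"
    by (simp add: powr_powr q)
  finally have "r * (k * s powr (r - 1)) \<le> r * (k powr r / r + s powr r / q)"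
    using assms by (intro mult_left_mono) auto
  also have "\<dots> = k powr r + (r - 1) * s powr r"
    using assms False by (auto simp: q_def field_simps)
  finally show ?thesis
    by (simp add: mult_ac)
qed (use assms in simp)

text \<open>
  Jensen's inequality for the measure with density \<open>w\<close> of total mass at most \<open>M\<close>. Integrate the
  tangent inequality at \<open>s = I / M\<close>, where \<open>I\<close> is the absolute value of the integral of \<open>F\<close>:
  since \<open>s powr r * M = s powr (r - 1) * I\<close>, this number is bounded by the integral of
  \<open>w z * k z powr r\<close>.
\<close>
lemma jensen_powr_integral_le:
  fixes F w k :: "'c \<Rightarrow> real"
  assumes [measurable]: "w \<in> borel_measurable N" "k \<in> borel_measurable N"
    and r: "r \<ge> 1" and "M \<ge> 0"
    and w: "\<And>z. w z \<ge> 0" "(\<integral>\<^sup>+z. ennreal (w z) \<partial>N) \<le> ennreal M"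
    and k: "\<And>z. k z \<ge> 0" and F: "\<And>z. \<bar>F z\<bar> \<le> w z * k z"
  shows "ennreal (\<bar>\<integral>z. F z \<partial>N\<bar> powr r) \<le> ennreal (M powr (r - 1)) * (\<integral>\<^sup>+z. ennreal (w z * k z powr r) \<partial>N)"
    (is "?L \<le> _ * ?X")
proof (cases "integrable N F \<and> (\<integral>z. F z \<partial>N) \<noteq> 0")
  case False
  then show ?thesis by (auto simp: not_integrable_integral_eq)
next
  case True
  define I where "I = \<bar>\<integral>z. F z \<partial>N\<bar>"
  have I: "I > 0" using True by (simp add: I_def)
  have le: "ennreal I \<le> (\<integral>\<^sup>+z. ennreal (w z * k z) \<partial>N)"
  proof -
    have "ennreal I \<le> (\<integral>\<^sup>+z. ennreal (norm (F z)) \<partial>N)"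
      using integral_norm_bound_ennreal[of N F] True by (simp add: I_def)
    also have "\<dots> \<le> (\<integral>\<^sup>+z. ennreal (w z * k z) \<partial>N)"
      using F by (intro nn_integral_mono ennreal_leI) simp
    finally show ?thesis .
  qed
  have M: "M > 0"
  proof (rule ccontr)
    assume "\<not> M > 0"
    then have "(\<integral>\<^sup>+z. ennreal (w z) \<partial>N) = 0" using w(2) \<open>M \<ge> 0\<close> by simp
    then have "AE z in N. w z = 0"
      using w(1) by (subst (asm) nn_integral_0_iff_AE) (auto elim!: eventually_mono simp: antisym)
    then have "(\<integral>\<^sup>+z. ennreal (w z * k z) \<partial>N) = 0"
      by (subst nn_integral_0_iff_AE) (auto elim!: eventually_mono)
    with le I show False by simp
  qed
  define s where "s = I / M"
  have s: "s > 0" "s powr r * M = s powr (r - 1) * I"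
    using I M by (auto simp: s_def powr_diff)
  show ?thesis
  proof (cases ?X)
    case top
    with M show ?thesis by (simp add: ennreal_mult_top)
  next
    case (real y)
    have "ennreal (r * s powr (r - 1) * I) = ennreal (r * s powr (r - 1)) * ennreal I"
      using r I by (simp add: ennreal_mult)
    also have "\<dots> \<le> ennreal (r * s powr (r - 1)) * (\<integral>\<^sup>+z. ennreal (w z * k z) \<partial>N)"
      by (intro mult_left_mono le) simp
    also have "\<dots> = (\<integral>\<^sup>+z. ennreal (r * s powr (r - 1)) * ennreal (w z * k z) \<partial>N)"
      by (simp add: nn_integral_cmult)
    also have "\<dots> \<le> (\<integral>\<^sup>+z. ennreal (w z * k z powr r) + ennreal ((r - 1) * s powr r) * ennreal (w z) \<partial>N)"
    proof (intro nn_integral_mono)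
      fix z
      have "r * s powr (r - 1) * (w z * k z) = w z * (r * s powr (r - 1) * k z)"
        by simp
      also have "\<dots> \<le> w z * (k z powr r + (r - 1) * s powr r)"
        by (intro mult_left_mono powr_tangent_le r s k w)
      finally have "ennreal (r * s powr (r - 1) * (w z * k z)) \<le>
          ennreal (w z * k z powr r + (r - 1) * s powr r * w z)"
        by (intro ennreal_leI) (simp add: algebra_simps)
      then show "ennreal (r * s powr (r - 1)) * ennreal (w z * k z) \<le>
          ennreal (w z * k z powr r) + ennreal ((r - 1) * s powr r) * ennreal (w z)"
        using r w k by (simp add: ennreal_mult ennreal_plus)
    qed
    also have "\<dots> = ?X + ennreal ((r - 1) * s powr r) * (\<integral>\<^sup>+z. ennreal (w z) \<partial>N)"
      by (simp add: nn_integral_add nn_integral_cmult)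
    also have "\<dots> \<le> ennreal y + ennreal ((r - 1) * s powr r) * ennreal M"
      using w(2) real by (intro add_mono mult_left_mono) auto
    also have "\<dots> = ennreal (y + (r - 1) * s powr r * M)"
      using r M real by (simp add: ennreal_mult ennreal_plus)
    finally have "r * s powr (r - 1) * I \<le> y + (r - 1) * s powr r * M"
      using r M real by (subst (asm) ennreal_le_iff) auto
    also have "(r - 1) * s powr r * M = (r - 1) * (s powr (r - 1) * I)"
      by (simp only: mult.assoc s(2))
    finally have "s powr (r - 1) * I \<le> y"
      by (simp add: algebra_simps)
    then have "M powr (r - 1) * (s powr (r - 1) * I) \<le> M powr (r - 1) * y"
      by (intro mult_left_mono) auto
    moreover have "M powr (r - 1) * (s powr (r - 1) * I) = I powr r"
      using I M by (simp add: s_def powr_divide powr_diff)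
    ultimately show ?thesis
      using real unfolding I_def[symmetric] by (simp flip: ennreal_mult' ennreal_mult'')
  qed
qed

abbreviation abs_pairing :: "('a::euclidean_space \<Rightarrow> real) \<Rightarrow> ('a \<Rightarrow> 'b::euclidean_space) \<Rightarrow> ennreal" where
  "abs_pairing f g \<equiv> \<integral>\<^sup>+x. ennreal (\<bar>f x\<bar> * norm (g x)) \<partial>lborel"

text \<open>
  What membership of \<open>g\<close> in the dual of \<open>L\<^sup>r\<close> contributes to the weak convergence, in a form that
  covers the exponents \<open>1 < r\<close> and \<open>r = 1\<close> at once: pairing with \<open>g\<close> is small where the
  \<open>r\<close>-th power mass of \<open>f\<close> is small, and finite where that mass is finite. The additive \<open>e\<close>
  takes the place of the \<open>1 / r\<close>-th power in Hoelder's inequality.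
\<close>
definition pairing_bounded :: "real \<Rightarrow> ('a::euclidean_space \<Rightarrow> 'b::euclidean_space) \<Rightarrow> bool" where
  "pairing_bounded r g \<longleftrightarrow> (\<forall>e>0. \<exists>C\<ge>0. \<forall>f::'a \<Rightarrow> real. f \<in> borel_measurable borel \<longrightarrow>
     abs_pairing f g \<le> ennreal C * lp_mass r f + ennreal e)"

lemma pairing_boundedI_conjugate:
  fixes g :: "'a::euclidean_space \<Rightarrow> 'b::euclidean_space"
  assumes [measurable]: "g \<in> borel_measurable borel"
    and rq: "r > 1" "q > 1" "1 / r + 1 / q = 1" and fin: "lp_mass q g < \<infinity>"
  shows "pairing_bounded r g"
  unfolding pairing_bounded_def
proof (intro allI impI)
  fix e :: real assume "e > 0"
  obtain G where G: "lp_mass q g = ennreal G" "G \<ge> 0"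
    using fin by (cases "lp_mass q g") auto
  \<comment> \<open>Scaling \<open>g\<close> by \<open>l\<close> makes the \<open>q\<close>-th power mass of \<open>g\<close> contribute at most \<open>e\<close>.\<close>
  define l where "l = (e / (G + 1)) powr (1 / q)"
  have l: "l > 0" "l powr q = e / (G + 1)"
    using \<open>e > 0\<close> G rq by (auto simp: l_def powr_powr)
  define C where "C = (1 / l) powr r / r"
  have "abs_pairing f g \<le> ennreal C * lp_mass r f + ennreal e"
    if [measurable]: "f \<in> borel_measurable borel" for f :: "'a \<Rightarrow> real"
  proof -
    have "abs_pairing f g \<le>
        (\<integral>\<^sup>+x. ennreal C * ennreal (norm (f x) powr r) + ennreal (l powr q) * ennreal (norm (g x) powr q) \<partial>lborel)"
    proof (intro nn_integral_mono)
      fix x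
      have "\<bar>f x\<bar> * norm (g x) = (\<bar>f x\<bar> / l) * (l * norm (g x))"
        using l by simp
      also have "\<dots> \<le> (\<bar>f x\<bar> / l) powr r / r + (l * norm (g x)) powr q / q"
        using l rq by (intro Youngs_inequality) auto
      also have "\<dots> \<le> (\<bar>f x\<bar> / l) powr r / r + (l * norm (g x)) powr q / 1"
        using rq by (intro add_left_mono divide_left_mono) auto
      also have "\<dots> = C * norm (f x) powr r + l powr q * norm (g x) powr q"
        using l by (simp add: C_def powr_divide powr_mult)
      finally show "ennreal (\<bar>f x\<bar> * norm (g x)) \<le>
          ennreal C * ennreal (norm (f x) powr r) + ennreal (l powr q) * ennreal (norm (g x) powr q)"
        using rq by (simp add: C_def flip: ennreal_mult' ennreal_plus)
    qed
    also have "\<dots> = ennreal C * lp_mass r f + ennreal (l powr q) * lp_mass q g"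
      by (simp add: nn_integral_add nn_integral_cmult)
    also have "ennreal (l powr q) * lp_mass q g = ennreal (l powr q * G)"
      using G by (simp add: ennreal_mult)
    also have "\<dots> \<le> ennreal e"
      using G \<open>e > 0\<close> unfolding l(2) by (intro ennreal_leI) (simp add: field_simps)
    finally show ?thesis by (simp add: add_left_mono)
  qed
  then show "\<exists>C\<ge>0. \<forall>f::'a \<Rightarrow> real. f \<in> borel_measurable borel \<longrightarrow>
     abs_pairing f g \<le> ennreal C * lp_mass r f + ennreal e"
    using rq by (intro exI[of _ C]) (auto simp: C_def)
qed

lemma pairing_boundedI_bounded:
  fixes g :: "'a::euclidean_space \<Rightarrow> 'b::euclidean_space"
  assumes B: "AE x in lborel. norm (g x) \<le> B" "B \<ge> 0"
  shows "pairing_bounded 1 g"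
  unfolding pairing_bounded_def
proof (intro allI impI exI[of _ B] conjI)
  fix e :: real and f :: "'a \<Rightarrow> real" assume [measurable]: "f \<in> borel_measurable borel"
  have "abs_pairing f g \<le> (\<integral>\<^sup>+x. ennreal B * ennreal (norm (f x) powr 1) \<partial>lborel)"
  proof (rule nn_integral_mono_AE)
    show "AE x in lborel. ennreal (\<bar>f x\<bar> * norm (g x)) \<le> ennreal B * ennreal (norm (f x) powr 1)"
      using B(1)
    proof eventually_elim
      case (elim x)
      then have "\<bar>f x\<bar> * norm (g x) \<le> B * norm (f x) powr 1"
        by (subst mult.commute[of B]) (simp add: mult_left_mono)
      then show ?case
        using B(2) by (simp flip: ennreal_mult' add: ennreal_leI)
    qed
  qed
  also have "\<dots> = ennreal B * lp_mass 1 f"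
    by (simp add: nn_integral_cmult)
  finally show "abs_pairing f g \<le> ennreal B * lp_mass 1 f + ennreal e"
    by (simp add: add_increasing2)
qed (use B in auto)

section \<open>Continuity of translations\<close>

abbreviation l1_mass :: "('a::euclidean_space \<Rightarrow> 'b::euclidean_space) \<Rightarrow> ennreal" where
  "l1_mass f \<equiv> \<integral>\<^sup>+x. ennreal (norm (f x)) \<partial>lborel"

text \<open>
  Inner and outer regularity, after a bounded piece has been cut out of \<open>A\<close>: a closed subset of
  that piece is compact, and what lies outside a large ball has small measure.
\<close>
lemma borel_sandwich_compact_open:
  fixes A :: "'a::euclidean_space set"
  assumes A: "A \<in> sets borel" "emeasure lborel A < \<infinity>" and "e > 0"
  obtains K U where "compact K" "open U" "K \<subseteq> A" "A \<subseteq> U" "emeasure lborel (U - K) \<le> ennreal e"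
proof -
  have "(\<lambda>n. emeasure lborel (A - cball 0 (real n))) \<longlonglongrightarrow> emeasure lborel (\<Inter>n. A - cball 0 (real n))"
  proof (rule Lim_emeasure_decseq)
    show "decseq (\<lambda>n. A - cball 0 (real n))"
      by (intro decseq_SucI) auto
    have "emeasure lborel (A - cball 0 (real n)) \<le> emeasure lborel A" for n
      using A(1) by (intro emeasure_mono) auto
    then show "emeasure lborel (A - cball 0 (real n)) \<noteq> \<infinity>" for n
      using A(2) by (metis infinity_ennreal_def leD top.not_eq_extremum)
  qed (use A in auto)
  moreover have "(\<Inter>n. A - cball 0 (real n)) = {}"
  proof -
    have "\<exists>n. x \<in> cball 0 (real n)" for x :: 'a
      using real_arch_simple[of "norm x"] by simp
    then show ?thesis by blast
  qed
  ultimately have "(\<lambda>n. emeasure lborel (A - cball 0 (real n))) \<longlonglongrightarrow> 0"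
    by (simp only: emeasure_empty)
  then have "\<forall>\<^sub>F n in sequentially. emeasure lborel (A - cball 0 (real n)) < ennreal (e / 3)"
    using \<open>e > 0\<close> by (intro order_tendstoD) auto
  then obtain n where n: "emeasure lborel (A - cball 0 (real n)) < ennreal (e / 3)"
    by (auto simp: eventually_sequentially)
  let ?A = "A \<inter> cball 0 (real n)"
  obtain K where K: "closed K" "K \<subseteq> ?A" "emeasure lebesgue (?A - K) < ennreal (e / 3)"
  proof (rule sets_lebesgue_inner_closed[of ?A "e / 3"])
    show "?A \<in> sets lebesgue" "0 < e / 3" using A(1) \<open>e > 0\<close> by auto
  qed
  obtain U where U: "open U" "A \<subseteq> U" "emeasure lborel (U - A) < ennreal (e / 3)"
    by (rule outer_regular_lborel[OF A(1), of "e / 3"]) (use \<open>e > 0\<close> in auto)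
  have [measurable]: "K \<in> sets borel" "U \<in> sets borel" "A \<in> sets borel"
    using K U A by auto
  have "compact K"
    using bounded_subset[OF bounded_cball, of K 0 "real n"] K(1,2) by (auto simp: compact_eq_bounded_closed)
  moreover have "emeasure lborel (U - K) \<le> ennreal e"
  proof -
    have "emeasure lborel (U - K) \<le> emeasure lborel ((U - A) \<union> ((A - cball 0 (real n)) \<union> (?A - K)))"
      by (intro emeasure_mono) auto
    also have "\<dots> \<le> emeasure lborel (U - A) +
        (emeasure lborel (A - cball 0 (real n)) + emeasure lborel (?A - K))"
      by (intro order_trans[OF emeasure_subadditive] add_left_mono emeasure_subadditive) auto
    also have "\<dots> \<le> ennreal (e / 3) + (ennreal (e / 3) + ennreal (e / 3))"
      using U n K(3) by (intro add_mono) (auto simp: less_imp_le)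
    also have "\<dots> = ennreal e"
      using \<open>e > 0\<close> by (simp flip: ennreal_plus)
    finally show ?thesis .
  qed
  ultimately show ?thesis
    using that[of K U] K U by auto
qed

text \<open>
  A compact set inside an open set has positive distance \<open>d\<close> from its complement. For \<open>norm z < d\<close>
  the points where \<open>A\<close> and its translate differ are therefore in \<open>U - K\<close> or in the translate
  of \<open>U - K\<close>.
\<close>
lemma translation_continuous_indicator:
  fixes A :: "'a::euclidean_space set"
  assumes A[measurable]: "A \<in> sets borel" and fin: "emeasure lborel A < \<infinity>" and "e > 0"
  shows "\<forall>\<^sub>F z in nhds 0. (\<integral>\<^sup>+x. ennreal \<bar>indicat_real A (x + z) - indicat_real A x\<bar> \<partial>lborel) \<le> ennreal e"
proof -
  obtain K U where KU: "compact K" "open U" "K \<subseteq> A" "A \<subseteq> U" "emeasure lborel (U - K) \<le> ennreal (e / 2)"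
    using borel_sandwich_compact_open[OF A fin, of "e / 2"] \<open>e > 0\<close> by auto
  have [measurable]: "K \<in> sets borel" "U \<in> sets borel"
    using KU by (auto simp: compact_imp_closed)
  obtain d where d: "d > 0" "\<And>x y. x \<in> K \<Longrightarrow> y \<notin> U \<Longrightarrow> d \<le> dist x y"
  proof -
    have "closed (- U)" "K \<inter> - U = {}"
      using KU(2-4) by auto
    from separate_compact_closed[OF KU(1) this] show ?thesis
      by (elim exE conjE) (rule that, auto)
  qed
  have "(\<integral>\<^sup>+x. ennreal \<bar>indicat_real A (x + z) - indicat_real A x\<bar> \<partial>lborel) \<le> ennreal e"
    if z: "norm z < d" for z
  proof -
    have "(\<integral>\<^sup>+x. ennreal \<bar>indicat_real A (x + z) - indicat_real A x\<bar> \<partial>lborel) \<le>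
        (\<integral>\<^sup>+x. indicator (U - K) x + indicator (U - K) (x + z) \<partial>lborel)"
    proof (intro nn_integral_mono)
      fix x
      have "x \<in> K \<Longrightarrow> x + z \<in> U" "x + z \<in> K \<Longrightarrow> x \<in> U"
        using d(2)[of x "x + z"] d(2)[of "x + z" x] z by (auto simp: dist_norm norm_minus_commute)
      with KU(3,4) show "ennreal \<bar>indicat_real A (x + z) - indicat_real A x\<bar> \<le>
          indicator (U - K) x + indicator (U - K) (x + z)"
        by (auto simp: indicator_def)
    qed
    also have "\<dots> = 2 * emeasure lborel (U - K)"
      using nn_integral_lborel_translate[of "indicator (U - K)" z]
      by (simp add: nn_integral_add mult_2)
    also have "\<dots> \<le> 2 * ennreal (e / 2)"
      using KU(5) by (rule mult_left_mono) simp
    also have "\<dots> = ennreal e"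
      using \<open>e > 0\<close> by (simp flip: ennreal_numeral ennreal_mult')
    finally show ?thesis .
  qed
  with d(1) show ?thesis
    by (auto simp: eventually_nhds_metric)
qed

lemma l1_mass_add_le:
  fixes f g :: "'a::euclidean_space \<Rightarrow> 'b::euclidean_space"
  assumes [measurable]: "f \<in> borel_measurable borel" "g \<in> borel_measurable borel"
  shows "l1_mass (\<lambda>x. f x + g x) \<le> l1_mass f + l1_mass g"
proof -
  have "l1_mass (\<lambda>x. f x + g x) \<le> (\<integral>\<^sup>+x. ennreal (norm (f x)) + ennreal (norm (g x)) \<partial>lborel)"
    by (intro nn_integral_mono) (simp flip: ennreal_plus add: norm_triangle_ineq)
  then show ?thesis
    by (simp add: nn_integral_add)
qed

lemma translation_continuous_L1:
  fixes f :: "'a::euclidean_space \<Rightarrow> 'b::euclidean_space"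
  assumes "integrable lborel f"
  shows "\<forall>e>0. \<forall>\<^sub>F z in nhds 0. l1_mass (\<lambda>x. f (x + z) - f x) \<le> ennreal e"
  using assms
proof (induction f rule: integrable_induct)
  case (base A c)
  show ?case
  proof (intro allI impI)
    fix e :: real assume "e > 0"
    then have "\<forall>\<^sub>F z in nhds 0. (\<integral>\<^sup>+x. ennreal \<bar>indicat_real A (x + z) - indicat_real A x\<bar> \<partial>lborel)
        \<le> ennreal (e / (norm c + 1))"
      using base by (intro translation_continuous_indicator) (auto intro!: divide_pos_pos add_nonneg_pos)
    then show "\<forall>\<^sub>F z in nhds 0. l1_mass (\<lambda>x. indicat_real A (x + z) *\<^sub>R c - indicat_real A x *\<^sub>R c) \<le> ennreal e"
    proof eventually_elim
      case (elim z)
      have "l1_mass (\<lambda>x. indicat_real A (x + z) *\<^sub>R c - indicat_real A x *\<^sub>R c) =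
          (\<integral>\<^sup>+x. ennreal (norm c) * ennreal \<bar>indicat_real A (x + z) - indicat_real A x\<bar> \<partial>lborel)"
        by (intro nn_integral_cong) (simp flip: scaleR_diff_left ennreal_mult' add: mult.commute)
      also have "\<dots> = ennreal (norm c) * (\<integral>\<^sup>+x. ennreal \<bar>indicat_real A (x + z) - indicat_real A x\<bar> \<partial>lborel)"
        using base by (intro nn_integral_cmult) auto
      also have "\<dots> \<le> ennreal (norm c) * ennreal (e / (norm c + 1))"
        by (intro mult_left_mono elim) simp
      also have "\<dots> = ennreal (norm c * (e / (norm c + 1)))"
        using \<open>e > 0\<close> by (intro ennreal_mult[symmetric]) auto
      also have "\<dots> \<le> ennreal e"
        using \<open>e > 0\<close> add_nonneg_pos[of "norm c" 1]
        by (intro ennreal_leI) (simp add: divide_le_eq mult.commute)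
      finally show ?case .
    qed
  qed
next
  case (add f g)
  have [measurable]: "f \<in> borel_measurable borel" "g \<in> borel_measurable borel"
    using borel_measurable_integrable[OF add(1)] borel_measurable_integrable[OF add(2)] by simp_all
  show ?case
  proof (intro allI impI)
    fix e :: real assume e: "e > 0"
    then have "\<forall>\<^sub>F z in nhds 0. l1_mass (\<lambda>x. f (x + z) - f x) \<le> ennreal (e / 2)"
      "\<forall>\<^sub>F z in nhds 0. l1_mass (\<lambda>x. g (x + z) - g x) \<le> ennreal (e / 2)"
      using add.IH by auto
    then show "\<forall>\<^sub>F z in nhds 0. l1_mass (\<lambda>x. f (x + z) + g (x + z) - (f x + g x)) \<le> ennreal e"
    proof eventually_elim
      case (elim z)
      have "l1_mass (\<lambda>x. f (x + z) + g (x + z) - (f x + g x)) \<le>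
          l1_mass (\<lambda>x. f (x + z) - f x) + l1_mass (\<lambda>x. g (x + z) - g x)"
        using l1_mass_add_le[of "\<lambda>x. f (x + z) - f x" "\<lambda>x. g (x + z) - g x"]
        by (simp add: add_diff_add)
      also have "\<dots> \<le> ennreal (e / 2) + ennreal (e / 2)"
        by (intro add_mono elim)
      also have "\<dots> = ennreal e"
        using e by (simp flip: ennreal_plus)
      finally show ?case .
    qed
  qed
next
  case (lim f s)
  have [measurable]: "f \<in> borel_measurable borel" "\<And>i. s i \<in> borel_measurable borel"
    using borel_measurable_integrable[OF lim(4)] borel_measurable_integrable[OF lim(1)] by simp_all
  show ?case
  proof (intro allI impI)
    fix e :: real assume e: "e > 0"
    have "(\<lambda>i. \<integral>\<^sup>+x. ennreal (norm (f x - s i x)) \<partial>lborel) \<longlonglongrightarrow> 0"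
    proof (rule nn_integral_dominated_convergence_norm)
      show "(\<integral>\<^sup>+x. ennreal (2 * norm (f x)) \<partial>lborel) < \<infinity>"
        using lim.hyps(4) by (simp add: integrable_iff_bounded ennreal_mult nn_integral_cmult ennreal_mult_less_top)
    qed (use lim.hyps in auto)
    then have "\<forall>\<^sub>F i in sequentially. l1_mass (\<lambda>x. f x - s i x) < ennreal (e / 3)"
      using e by (intro order_tendstoD) auto
    then obtain i where i: "l1_mass (\<lambda>x. f x - s i x) < ennreal (e / 3)"
      by (auto simp: eventually_sequentially)
    have "\<forall>\<^sub>F z in nhds 0. l1_mass (\<lambda>x. s i (x + z) - s i x) \<le> ennreal (e / 3)"
      using lim.IH e by auto
    then show "\<forall>\<^sub>F z in nhds 0. l1_mass (\<lambda>x. f (x + z) - f x) \<le> ennreal e"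
    proof eventually_elim
      case (elim z)
      have "l1_mass (\<lambda>x. f (x + z) - f x) =
          l1_mass (\<lambda>x. (f (x + z) - s i (x + z)) + ((s i (x + z) - s i x) + - (f x - s i x)))"
        by simp
      also have "\<dots> \<le> l1_mass (\<lambda>x. f (x + z) - s i (x + z)) +
          l1_mass (\<lambda>x. (s i (x + z) - s i x) + - (f x - s i x))"
        by (rule l1_mass_add_le) measurable
      also have "\<dots> \<le> l1_mass (\<lambda>x. f (x + z) - s i (x + z)) +
          (l1_mass (\<lambda>x. s i (x + z) - s i x) + l1_mass (\<lambda>x. - (f x - s i x)))"
        by (intro add_left_mono l1_mass_add_le) measurable
      also have "l1_mass (\<lambda>x. - (f x - s i x)) = l1_mass (\<lambda>x. f x - s i x)"
        by (simp add: norm_minus_commute)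
      also have "l1_mass (\<lambda>x. f (x + z) - s i (x + z)) = l1_mass (\<lambda>x. f x - s i x)"
        by (rule nn_integral_lborel_translate[of "\<lambda>x. ennreal (norm (f x - s i x))"]) simp
      also have "l1_mass (\<lambda>x. f x - s i x) +
          (l1_mass (\<lambda>x. s i (x + z) - s i x) + l1_mass (\<lambda>x. f x - s i x))
          \<le> ennreal (e / 3) + (ennreal (e / 3) + ennreal (e / 3))"
        using i elim by (intro add_mono) auto
      also have "\<dots> = ennreal e"
        using e by (simp flip: ennreal_plus)
      finally show ?case .
    qed
  qed
qed

text \<open>
  A bounded difference satisfies \<open>t powr r \<le> (2 * B) powr (r - 1) * t\<close>, which reduces the claim
  to \<open>r = 1\<close>.
\<close>
lemma translation_continuous_bounded:
  fixes f :: "'a::euclidean_space \<Rightarrow> 'b::euclidean_space"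
  assumes f: "integrable lborel f" and B: "\<And>x. norm (f x) \<le> B" and "r \<ge> 1" "e > 0"
  shows "\<forall>\<^sub>F z in nhds 0. lp_mass r (\<lambda>x. f (x + z) - f x) \<le> ennreal e"
proof -
  have [measurable]: "f \<in> borel_measurable borel" using f by auto
  define C where "C = (2 * B) powr (r - 1)"
  have C: "C \<ge> 0" by (simp add: C_def)
  have "\<forall>\<^sub>F z in nhds 0. l1_mass (\<lambda>x. f (x + z) - f x) \<le> ennreal (e / (C + 1))"
    using translation_continuous_L1[OF f] \<open>e > 0\<close> C by (auto intro: divide_pos_pos)
  then show ?thesis
  proof eventually_elim
    case (elim z)
    have "lp_mass r (\<lambda>x. f (x + z) - f x) \<le> (\<integral>\<^sup>+x. ennreal C * ennreal (norm (f (x + z) - f x)) \<partial>lborel)"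
    proof (intro nn_integral_mono)
      fix x
      let ?t = "norm (f (x + z) - f x)"
      have "?t powr r = ?t powr (r - 1) * ?t"
        by (cases "?t = 0") (auto simp: powr_diff)
      also have "\<dots> \<le> C * ?t"
        unfolding C_def using norm_triangle_ineq4[of "f (x + z)" "f x"] B[of x] B[of "x + z"] \<open>r \<ge> 1\<close>
        by (intro mult_right_mono powr_mono2) auto
      finally show "ennreal (?t powr r) \<le> ennreal C * ennreal ?t"
        using C by (simp flip: ennreal_mult')
    qed
    also have "\<dots> = ennreal C * l1_mass (\<lambda>x. f (x + z) - f x)"
      by (simp add: nn_integral_cmult)
    also have "\<dots> \<le> ennreal C * ennreal (e / (C + 1))"
      by (intro mult_left_mono elim) simp
    also have "\<dots> = ennreal (C * (e / (C + 1)))"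
      using C \<open>e > 0\<close> by (intro ennreal_mult[symmetric]) auto
    also have "\<dots> \<le> ennreal e"
      using C \<open>e > 0\<close> by (intro ennreal_leI) (simp add: field_simps)
    finally show ?case .
  qed
qed

text \<open>
  Cutting \<open>f\<close> off where it or its argument is large leaves a bounded integrable function and an
  error with small \<open>r\<close>-th power mass. Translations preserve that mass, so the error enters twice.
\<close>
lemma translation_continuous_Lp:
  fixes f :: "'a::euclidean_space \<Rightarrow> 'b::euclidean_space"
  assumes [measurable]: "f \<in> borel_measurable borel"
    and fin: "lp_mass r f < \<infinity>" and r: "r \<ge> 1" and e: "e > 0"
  shows "\<forall>\<^sub>F z in nhds 0. lp_mass r (\<lambda>x. f (x + z) - f x) \<le> ennreal e"
proof -
  define c where "c = 2 powr r"
  have c: "c > 0" by (simp add: c_def)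
  \<comment> \<open>Chosen so that \<open>c * (d + c * (d + d)) \<le> e\<close>, the total after two uses of the quasi-triangle inequality.\<close>
  define d where "d = e / (4 * c * (c + 1))"
  define h where "h n x = (if norm (f x) \<le> real n \<and> norm x \<le> real n then f x else 0)" for n x
  have [measurable]: "h n \<in> borel_measurable borel" for n
    unfolding h_def by measurable
  have "(\<lambda>n. lp_mass r (\<lambda>x. f x - h n x)) \<longlonglongrightarrow> (\<integral>\<^sup>+x. 0 \<partial>(lborel::'a measure))"
  proof (rule nn_integral_dominated_convergence[where w="\<lambda>x. ennreal (norm (f x) powr r)"])
    show "AE x in lborel. ennreal (norm (f x - h n x) powr r) \<le> ennreal (norm (f x) powr r)" for n
      using r by (intro AE_I2) (auto simp: h_def)
    show "AE x in lborel. (\<lambda>n. ennreal (norm (f x - h n x) powr r)) \<longlonglongrightarrow> 0"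
    proof (intro AE_I2 tendsto_eventually)
      fix x
      obtain N :: nat where "max (norm (f x)) (norm x) \<le> real N"
        using real_arch_simple by blast
      then show "\<forall>\<^sub>F n in sequentially. ennreal (norm (f x - h n x) powr r) = 0"
        using r by (intro eventually_sequentiallyI[of N]) (auto simp: h_def)
    qed
  qed (use fin in auto)
  moreover have c4: "d > 0"
    unfolding d_def using c e by (intro divide_pos_pos mult_pos_pos) auto
  ultimately have "\<forall>\<^sub>F n in sequentially. lp_mass r (\<lambda>x. f x - h n x) < ennreal (d)"
    by (intro order_tendstoD) auto
  then obtain n where n: "lp_mass r (\<lambda>x. f x - h n x) < ennreal (d)"
    by (auto simp: eventually_sequentially)
  have hn: "integrable lborel (h n)"
  proof (rule Bochner_Integration.integrable_bound)
    show "integrable lborel (\<lambda>x. real n * indicat_real (cball 0 (real n)) x)"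
      using emeasure_bounded_finite[of "cball 0 (real n)"]
      by (intro integrable_mult_right) (auto simp: integrable_indicator_iff)
    show "AE x in lborel. norm (h n x) \<le> norm (real n * indicat_real (cball 0 (real n)) x)"
      by (intro AE_I2) (auto simp: h_def)
  qed simp
  have "\<forall>\<^sub>F z in nhds 0. lp_mass r (\<lambda>x. h n (x + z) - h n x) \<le> ennreal (d)"
    by (rule translation_continuous_bounded[where B="real n", OF hn _ r c4]) (auto simp: h_def)
  then show ?thesis
  proof eventually_elim
    case (elim z)
    have "lp_mass r (\<lambda>x. f (x + z) - f x) =
        lp_mass r (\<lambda>x. (h n (x + z) - h n x) + ((f (x + z) - h n (x + z)) - (f x - h n x)))"
      by (simp add: algebra_simps)
    also have "\<dots> \<le> ennreal c * (lp_mass r (\<lambda>x. h n (x + z) - h n x) +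
        lp_mass r (\<lambda>x. (f (x + z) - h n (x + z)) - (f x - h n x)))"
      unfolding c_def using r by (intro lp_mass_add_le) auto
    also have "\<dots> \<le> ennreal c * (lp_mass r (\<lambda>x. h n (x + z) - h n x) +
        ennreal c * (lp_mass r (\<lambda>x. f (x + z) - h n (x + z)) + lp_mass r (\<lambda>x. f x - h n x)))"
      unfolding c_def using r by (intro mult_left_mono add_left_mono lp_mass_diff_le) auto
    also have "lp_mass r (\<lambda>x. f (x + z) - h n (x + z)) = lp_mass r (\<lambda>x. f x - h n x)"
      by (rule lp_mass_translate[of "\<lambda>x. f x - h n x"]) simp
    also have "ennreal c * (lp_mass r (\<lambda>x. h n (x + z) - h n x) +
        ennreal c * (lp_mass r (\<lambda>x. f x - h n x) + lp_mass r (\<lambda>x. f x - h n x))) \<le>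
        ennreal c * (ennreal (d) +
        ennreal c * (ennreal (d) + ennreal (d)))"
      using n elim by (intro mult_left_mono add_mono) auto
    also have "\<dots> = ennreal (c * (d + c * (d + d)))"
      using c less_imp_le[OF c4] by (simp only: ennreal_mult ennreal_plus add_nonneg_nonneg mult_nonneg_nonneg less_imp_le)
    also have "\<dots> \<le> ennreal e"
    proof (intro ennreal_leI)
      have "c * (d + c * (d + d)) \<le> d * (4 * c * (c + 1))"
        using mult_pos_pos[OF c c4] mult_pos_pos[OF c mult_pos_pos[OF c c4]] by (simp add: algebra_simps)
      also have "\<dots> = e"
        using c by (simp add: d_def)
      finally show "c * (d + c * (d + d)) \<le> e" .
    qed
    finally show ?case .
  qed
qed

section \<open>Increments of functions with a weak gradient\<close>

lemma cball_borel [measurable]: "cball c R \<in> sets borel"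
  by simp

lemma locally_integrable_borel:
  fixes f :: "'a::euclidean_space \<Rightarrow> 'b::euclidean_space"
  assumes "locally_integrable f" and [measurable]: "f \<in> borel_measurable borel"
  shows "integrable lborel (\<lambda>x. indicat_real (cball 0 R) x *\<^sub>R f x)"
proof -
  have "integrable lebesgue (\<lambda>x. indicat_real (cball 0 R) x *\<^sub>R f x)"
    using assms(1) compact_cball[of 0 R] by (auto simp: locally_integrable_def set_integrable_def)
  then show ?thesis
    by (subst (asm) integrable_completion) auto
qed

lemma nn_integral_locally_integrable_finite:
  fixes f :: "'a::euclidean_space \<Rightarrow> 'b::euclidean_space"
  assumes "locally_integrable f" and "f \<in> borel_measurable borel"
  shows "(\<integral>\<^sup>+x. ennreal (indicat_real (cball 0 R) x * norm (f x)) \<partial>lborel) < \<infinity>"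
  using locally_integrable_borel[OF assms, of R] by (simp add: integrable_iff_bounded)

lemma integrable_locally_integrable_mult:
  fixes f :: "'a::euclidean_space \<Rightarrow> real"
  assumes f: "locally_integrable f" and [measurable]: "f \<in> borel_measurable borel" "h \<in> borel_measurable borel"
    and h: "\<And>x. \<bar>h x\<bar> \<le> B * indicat_real (cball 0 R) x"
  shows "integrable lborel (\<lambda>x. f x * h x)"
proof (rule Bochner_Integration.integrable_bound)
  show "integrable lborel (\<lambda>x. B * (indicat_real (cball 0 R) x *\<^sub>R f x))"
    by (intro integrable_mult_right locally_integrable_borel f) simp
  show "AE x in lborel. norm (f x * h x) \<le> norm (B * (indicat_real (cball 0 R) x *\<^sub>R f x))"
  proof (intro AE_I2)
    fix x
    have "\<bar>h x\<bar> * \<bar>f x\<bar> \<le> \<bar>B * indicat_real (cball 0 R) x\<bar> * \<bar>f x\<bar>"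
      using h[of x] by (intro mult_right_mono) auto
    then show "norm (f x * h x) \<le> norm (B * (indicat_real (cball 0 R) x *\<^sub>R f x))"
      by (simp add: abs_mult mult_ac)
  qed
qed simp

lemma locally_integrable_inner:
  fixes g :: "'a::euclidean_space \<Rightarrow> 'b::euclidean_space"
  assumes "locally_integrable g"
  shows "locally_integrable (\<lambda>x. g x \<bullet> z)"
  unfolding locally_integrable_def set_integrable_def
proof (intro allI impI)
  fix K :: "'a set" assume "compact K"
  with assms have "integrable lebesgue (\<lambda>x. (indicat_real K x *\<^sub>R g x) \<bullet> z)"
    by (intro integrable_inner_left) (auto simp: locally_integrable_def set_integrable_def)
  then show "integrable lebesgue (\<lambda>x. indicat_real K x *\<^sub>R (g x \<bullet> z))"
    by simp
qed

lemma continuous_compact_support_bounded: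
  fixes h :: "'a::euclidean_space \<Rightarrow> real"
  assumes "continuous_on UNIV h" "\<And>x. x \<notin> cball 0 R \<Longrightarrow> h x = 0"
  shows "\<exists>B\<ge>0. \<forall>x. \<bar>h x\<bar> \<le> B * indicat_real (cball 0 R) x"
proof -
  have "compact (h ` cball 0 R)"
    using assms(1) by (intro compact_continuous_image) (auto intro: continuous_on_subset)
  then obtain B where B: "B > 0" "\<And>y. y \<in> h ` cball 0 R \<Longrightarrow> norm y \<le> B"
    using compact_imp_bounded bounded_pos by metis
  show ?thesis
    by (intro exI[of _ B]) (use B assms(2) in \<open>auto simp: indicator_def\<close>)
qed

lemma test_function_differentiable: "test_function \<psi> \<Longrightarrow> \<psi> differentiable (at x)"
  unfolding test_function_def by (auto dest: spec[of _ 1])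

lemma test_function_has_derivative:
  "test_function \<psi> \<Longrightarrow> (\<psi> has_derivative frechet_derivative \<psi> (at x)) (at x)"
  using test_function_differentiable frechet_derivative_works by blast

lemma frechet_derivative_eq_sum_partial:
  fixes f :: "'a::euclidean_space \<Rightarrow> real"
  assumes "f differentiable (at x)"
  shows "frechet_derivative f (at x) z = (\<Sum>i\<in>Basis. (z \<bullet> i) * partial_deriv i f x)"
proof -
  have lin: "linear (frechet_derivative f (at x))"
    by (rule linear_frechet_derivative[OF assms])
  have "frechet_derivative f (at x) z = frechet_derivative f (at x) (\<Sum>i\<in>Basis. (z \<bullet> i) *\<^sub>R i)"
    by (simp add: euclidean_representation)
  also have "\<dots> = (\<Sum>i\<in>Basis. (z \<bullet> i) * partial_deriv i f x)"
    by (simp add: linear_sum[OF lin] linear_cmul[OF lin])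
  finally show ?thesis .
qed

lemma test_function_continuous: "test_function \<psi> \<Longrightarrow> continuous_on UNIV \<psi>"
  unfolding test_function_def by (auto dest: spec[of _ 0])

lemma test_function_partial_continuous:
  assumes "test_function \<psi>" "i \<in> Basis"
  shows "continuous_on UNIV (partial_deriv i \<psi>)"
proof -
  have "C_k (Suc 0) \<psi>" using assms(1) unfolding test_function_def by blast
  then show ?thesis using assms(2) by simp
qed

lemma test_function_derivative_continuous:
  assumes "test_function \<psi>"
  shows "continuous_on UNIV (\<lambda>x. frechet_derivative \<psi> (at x) z)"
  by (subst frechet_derivative_eq_sum_partial[OF test_function_differentiable[OF assms]])
     (intro continuous_on_sum continuous_on_mult continuous_on_const test_function_partial_continuous assms)

lemma test_function_support:
  assumes "test_function \<psi>"
  obtains R where "R \<ge> 0" "\<And>x. x \<notin> cball 0 R \<Longrightarrow> \<psi> x = 0"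
    "\<And>x z. x \<notin> cball 0 R \<Longrightarrow> frechet_derivative \<psi> (at x) z = 0"
proof -
  have "bounded (closure {x. \<psi> x \<noteq> 0})"
    using assms unfolding test_function_def by (intro compact_imp_bounded) blast
  then obtain R where R: "R > 0" "\<And>x. x \<in> closure {x. \<psi> x \<noteq> 0} \<Longrightarrow> norm x \<le> R"
    unfolding bounded_pos by blast
  have zero: "\<psi> x = 0" if "x \<notin> cball 0 R" for x
    using R(2)[of x] closure_subset[of "{x. \<psi> x \<noteq> 0}"] that by auto
  have "frechet_derivative \<psi> (at x) z = 0" if x: "x \<notin> cball 0 R" for x z
  proof -
    have "((\<lambda>_. 0) has_derivative (\<lambda>_. 0)) (at x)" by simp
    then have "(\<psi> has_derivative (\<lambda>_. 0)) (at x)"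
      by (rule has_derivative_transform_within_open[where s="- cball 0 R"]) (use x zero in auto)
    then show ?thesis
      using frechet_derivative_at by metis
  qed
  with zero R(1) show ?thesis
    by (intro that[of R]) auto
qed

lemma test_function_bounds:
  assumes "test_function \<psi>"
  obtains R B where "R \<ge> 0" "B \<ge> 0" "\<And>x. \<bar>\<psi> x\<bar> \<le> B * indicat_real (cball 0 R) x"
    "\<And>x. \<bar>frechet_derivative \<psi> (at x) z\<bar> \<le> B * indicat_real (cball 0 R) x"
proof -
  obtain R where R: "R \<ge> 0" "\<And>x. x \<notin> cball 0 R \<Longrightarrow> \<psi> x = 0"
    "\<And>x z. x \<notin> cball 0 R \<Longrightarrow> frechet_derivative \<psi> (at x) z = 0"
    by (rule test_function_support[OF assms]) (rule that)
  obtain B1 where B1: "B1 \<ge> 0" "\<And>x. \<bar>\<psi> x\<bar> \<le> B1 * indicat_real (cball 0 R) x"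
    using continuous_compact_support_bounded[OF test_function_continuous[OF assms] R(2)] by metis
  obtain B2 where B2: "B2 \<ge> 0" "\<And>x. \<bar>frechet_derivative \<psi> (at x) z\<bar> \<le> B2 * indicat_real (cball 0 R) x"
    using continuous_compact_support_bounded[OF test_function_derivative_continuous[OF assms] R(3)] by metis
  have max: "B1 * indicat_real (cball 0 R) x \<le> max B1 B2 * indicat_real (cball 0 R) x"
    "B2 * indicat_real (cball 0 R) x \<le> max B1 B2 * indicat_real (cball 0 R) x" for x
    by (auto intro!: mult_right_mono)
  show ?thesis
  proof (rule that[of R "max B1 B2"])
    show "\<bar>\<psi> x\<bar> \<le> max B1 B2 * indicat_real (cball 0 R) x" for x
      using B1(2) max(1) by (rule order_trans)
    show "\<bar>frechet_derivative \<psi> (at x) z\<bar> \<le> max B1 B2 * indicat_real (cball 0 R) x" for x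
      using B2(2) max(2) by (rule order_trans)
  qed (use R(1) B1(1) in auto)
qed

lemma frechet_derivative_translate:
  assumes "f differentiable (at (x - c))"
  shows "frechet_derivative (\<lambda>x. f (x - c)) (at x) = frechet_derivative f (at (x - c))"
proof -
  have "((\<lambda>x. f (x - c)) has_derivative frechet_derivative f (at (x - c))) (at x)"
  proof (rule has_derivative_compose[where f="\<lambda>x. x - c" and f'="\<lambda>h. h" and g=f])
    show "((\<lambda>x. x - c) has_derivative (\<lambda>h. h)) (at x)"
      by (auto intro!: derivative_eq_intros)
  qed (use assms in \<open>simp add: frechet_derivative_works\<close>)
  then show ?thesis
    using frechet_derivative_at by metis
qed

lemma test_function_translate:
  assumes "test_function \<psi>"
  shows "test_function (\<lambda>x. \<psi> (x - c))"
  unfolding test_function_def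
proof
  have "C_k k \<psi>" for k
    using assms by (simp add: test_function_def)
  then show "\<forall>k. C_k k (\<lambda>x. \<psi> (x - c))"
    by (intro allI C_k_translate)
  obtain R where R: "R \<ge> 0" "\<And>x. x \<notin> cball 0 R \<Longrightarrow> \<psi> x = 0"
    "\<And>x z. x \<notin> cball 0 R \<Longrightarrow> frechet_derivative \<psi> (at x) z = 0"
    by (rule test_function_support[OF assms]) (rule that)
  have "{x. \<psi> (x - c) \<noteq> 0} \<subseteq> cball c R"
  proof
    fix x assume "x \<in> {x. \<psi> (x - c) \<noteq> 0}"
    then have "x - c \<in> cball 0 R" using R(2) by blast
    then show "x \<in> cball c R" by (simp add: dist_norm norm_minus_commute)
  qed
  then show "compact (closure {x. \<psi> (x - c) \<noteq> 0})"
    by (meson bounded_cball bounded_subset compact_closure)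
qed

lemma weak_gradient_directional:
  fixes u :: "'a::euclidean_space \<Rightarrow> real"
  assumes wg: "weak_gradient u g" and ug[measurable]: "u \<in> borel_measurable borel" "g \<in> borel_measurable borel"
    and \<psi>: "test_function \<psi>"
  shows "(LBINT x. u x * frechet_derivative \<psi> (at x) z) = - (LBINT x. (g x \<bullet> z) * \<psi> x)"
proof -
  have li: "locally_integrable u" "locally_integrable g"
    using wg by (auto simp: weak_gradient_def)
  have [measurable]: "\<psi> \<in> borel_measurable borel" "\<And>z. (\<lambda>x. frechet_derivative \<psi> (at x) z) \<in> borel_measurable borel"
    using \<psi> by (auto intro!: borel_measurable_continuous_onI test_function_continuous test_function_derivative_continuous)
  have int1: "integrable lborel (\<lambda>x. u x * partial_deriv i \<psi> x)"
    and int2: "integrable lborel (\<lambda>x. (g x \<bullet> i) * \<psi> x)" for i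
  proof -
    obtain R B where "R \<ge> 0" "B \<ge> 0" and RB: "\<And>x. \<bar>\<psi> x\<bar> \<le> B * indicat_real (cball 0 R) x"
      "\<And>x. \<bar>partial_deriv i \<psi> x\<bar> \<le> B * indicat_real (cball 0 R) x"
      by (rule test_function_bounds[OF \<psi>, of i]) (rule that)
    show "integrable lborel (\<lambda>x. u x * partial_deriv i \<psi> x)"
      by (rule integrable_locally_integrable_mult[OF li(1) _ _ RB(2)]) simp_all
    show "integrable lborel (\<lambda>x. (g x \<bullet> i) * \<psi> x)"
      by (rule integrable_locally_integrable_mult[OF locally_integrable_inner[OF li(2)] _ _ RB(1)]) simp_all
  qed
  have part: "(LBINT x. u x * partial_deriv i \<psi> x) = - (LBINT x. (g x \<bullet> i) * \<psi> x)" if "i \<in> Basis" for i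
  proof -
    have "(\<integral>x. u x * partial_deriv i \<psi> x \<partial>lebesgue) = - (\<integral>x. (g x \<bullet> i) * \<psi> x \<partial>lebesgue)"
      using wg \<psi> that unfolding weak_gradient_def by blast
    then show ?thesis
      by (subst (asm) (1 2) integral_completion) simp_all
  qed
  have "(LBINT x. u x * frechet_derivative \<psi> (at x) z) =
      (LBINT x. (\<Sum>i\<in>Basis. (z \<bullet> i) * (u x * partial_deriv i \<psi> x)))"
    by (subst frechet_derivative_eq_sum_partial[OF test_function_differentiable[OF \<psi>]])
       (simp add: sum_distrib_left mult_ac)
  also have "\<dots> = (\<Sum>i\<in>Basis. (z \<bullet> i) * (LBINT x. u x * partial_deriv i \<psi> x))"
    using int1 by simp
  also have "\<dots> = - (\<Sum>i\<in>Basis. (z \<bullet> i) * (LBINT x. (g x \<bullet> i) * \<psi> x))"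
    by (simp add: part sum_negf)
  also have "(\<Sum>i\<in>Basis. (z \<bullet> i) * (LBINT x. (g x \<bullet> i) * \<psi> x)) =
      (LBINT x. (\<Sum>i\<in>Basis. (z \<bullet> i) * ((g x \<bullet> i) * \<psi> x)))"
    using int2 by simp
  also have "\<dots> = (LBINT x. (g x \<bullet> z) * \<psi> x)"
    by (simp add: euclidean_inner[of _ z] sum_distrib_left mult_ac)
  finally show ?thesis .
qed

lemma integrable_pairI:
  fixes F :: "'a::euclidean_space \<Rightarrow> 'c::euclidean_space \<Rightarrow> real"
  assumes [measurable]: "case_prod F \<in> borel_measurable (lborel \<Otimes>\<^sub>M lborel)"
    and fin: "(\<integral>\<^sup>+x. (\<integral>\<^sup>+y. ennreal \<bar>F x y\<bar> \<partial>lborel) \<partial>lborel) < \<infinity>"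
  shows "integrable (lborel \<Otimes>\<^sub>M lborel) (case_prod F)"
proof (rule integrableI_bounded)
  have "(\<integral>\<^sup>+p. ennreal (norm (case_prod F p)) \<partial>(lborel \<Otimes>\<^sub>M lborel)) =
      (\<integral>\<^sup>+x. (\<integral>\<^sup>+y. ennreal (norm (case_prod F (x, y))) \<partial>lborel) \<partial>lborel)"
    by (rule lborel.nn_integral_fst[symmetric]) measurable
  with fin show "(\<integral>\<^sup>+p. ennreal (norm (case_prod F p)) \<partial>(lborel \<Otimes>\<^sub>M lborel)) < \<infinity>"
    by simp
qed simp

lemma nn_integral_translate_cball_le:
  fixes g :: "'a::euclidean_space \<Rightarrow> 'b::euclidean_space"
  assumes [measurable]: "g \<in> borel_measurable borel" and "norm c \<le> S"
  shows "(\<integral>\<^sup>+x. ennreal (indicat_real (cball 0 R) x * norm (g (x + c))) \<partial>lborel) \<le>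
    (\<integral>\<^sup>+x. ennreal (indicat_real (cball 0 (R + S)) x * norm (g x)) \<partial>lborel)"
proof -
  have "(\<integral>\<^sup>+x. ennreal (indicat_real (cball 0 R) x * norm (g (x + c))) \<partial>lborel) \<le>
      (\<integral>\<^sup>+x. ennreal (indicat_real (cball 0 (R + S)) (x + c) * norm (g (x + c))) \<partial>lborel)"
  proof (intro nn_integral_mono ennreal_leI mult_right_mono)
    fix x
    show "indicat_real (cball 0 R) x \<le> indicat_real (cball 0 (R + S)) (x + c)"
      using norm_triangle_ineq[of x c] \<open>norm c \<le> S\<close> by (auto simp: indicator_def)
  qed simp
  also have "\<dots> = (\<integral>\<^sup>+x. ennreal (indicat_real (cball 0 (R + S)) x * norm (g x)) \<partial>lborel)"
    by (rule nn_integral_lborel_translate[of "\<lambda>x. ennreal (indicat_real (cball 0 (R + S)) x * norm (g x))"]) simp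
  finally show ?thesis .
qed

abbreviation segment_gradient :: "('a::euclidean_space \<Rightarrow> 'a) \<Rightarrow> 'a \<Rightarrow> 'a \<Rightarrow> real \<Rightarrow> real" where
  "segment_gradient g z x t \<equiv> indicat_real {0..1} t * (g (x + t *\<^sub>R z) \<bullet> z)"

text \<open>
  Fubini's theorem on the segment from \<open>x\<close> to
  \<open>x + z\<close> applies because, as long as \<open>x\<close> stays in a ball, so do all points of the segment, in a larger
  ball.
\<close>
lemma integrable_segment_gradient_times:
  fixes g :: "'a::euclidean_space \<Rightarrow> 'a"
  assumes li: "locally_integrable g" and [measurable]: "g \<in> borel_measurable borel"
    "h \<in> borel_measurable borel"
    and h: "\<And>x. \<bar>h x\<bar> \<le> B * indicat_real (cball 0 R) x" "B \<ge> 0"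
  shows "integrable (lborel \<Otimes>\<^sub>M lborel) (\<lambda>(t, x). segment_gradient g z x t * h x)"
proof (rule integrable_pairI)
  let ?I = "\<integral>\<^sup>+x. ennreal (indicat_real (cball 0 (R + norm z)) x * norm (g x)) \<partial>lborel"
  have "(\<integral>\<^sup>+t. (\<integral>\<^sup>+x. ennreal \<bar>segment_gradient g z x t * h x\<bar> \<partial>lborel) \<partial>lborel) \<le>
      (\<integral>\<^sup>+t. indicator {0..1} t * (ennreal (norm z * B) * ?I) \<partial>(lborel :: real measure))"
  proof (intro nn_integral_mono)
    fix t :: real
    show "(\<integral>\<^sup>+x. ennreal \<bar>segment_gradient g z x t * h x\<bar> \<partial>lborel) \<le>
        indicator {0..1} t * (ennreal (norm z * B) * ?I)"
    proof (cases "t \<in> {0..1}")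
      case True
      have "(\<integral>\<^sup>+x. ennreal \<bar>segment_gradient g z x t * h x\<bar> \<partial>lborel) \<le>
          (\<integral>\<^sup>+x. ennreal (norm z * B) * ennreal (indicat_real (cball 0 R) x * norm (g (x + t *\<^sub>R z))) \<partial>lborel)"
      proof (intro nn_integral_mono)
        fix x
        have "\<bar>g (x + t *\<^sub>R z) \<bullet> z\<bar> * \<bar>h x\<bar> \<le> (norm (g (x + t *\<^sub>R z)) * norm z) * (B * indicat_real (cball 0 R) x)"
          by (intro mult_mono Cauchy_Schwarz_ineq2 h mult_nonneg_nonneg) auto
        then show "ennreal \<bar>segment_gradient g z x t * h x\<bar> \<le>
            ennreal (norm z * B) * ennreal (indicat_real (cball 0 R) x * norm (g (x + t *\<^sub>R z)))"
          using True h(2) by (simp flip: ennreal_mult' add: abs_mult mult_ac ennreal_leI)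
      qed
      also have "\<dots> = ennreal (norm z * B) * (\<integral>\<^sup>+x. ennreal (indicat_real (cball 0 R) x * norm (g (x + t *\<^sub>R z))) \<partial>lborel)"
        by (simp add: nn_integral_cmult)
      also have "\<dots> \<le> ennreal (norm z * B) * ?I"
        using True by (intro mult_left_mono nn_integral_translate_cball_le) (auto simp: mult_left_le_one_le)
      finally show ?thesis using True by simp
    qed simp
  qed
  also have "\<dots> = ennreal (norm z * B) * ?I"
    by (simp add: nn_integral_multc)
  also have "\<dots> < \<infinity>"
    using nn_integral_locally_integrable_finite[OF li, of "R + norm z"]
    by (simp add: ennreal_mult_less_top)
  finally show "(\<integral>\<^sup>+t. (\<integral>\<^sup>+x. ennreal \<bar>segment_gradient g z x t * h x\<bar> \<partial>lborel) \<partial>lborel) < \<infinity>" .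
qed measurable

lemma AE_if_AE_boxes:
  assumes "\<And>a b. AE x in lborel. x \<in> box a b \<longrightarrow> P (x::'a::euclidean_space)"
  shows "AE x in lborel. P x"
proof -
  have "AE x in lborel. \<forall>n::nat. x \<in> box (- (real n *\<^sub>R One)) (real n *\<^sub>R One) \<longrightarrow> P x"
    unfolding AE_all_countable using assms by blast
  then show ?thesis
  proof eventually_elim
    case (elim x)
    have "x \<in> (\<Union>n::nat. box (- (real n *\<^sub>R One)) (real n *\<^sub>R One))"
      unfolding UN_box_eq_UNIV by simp
    with elim show ?case by blast
  qed
qed

lemma indicator_box_le_cball:
  fixes a b :: "'a::euclidean_space"
  obtains R where "\<And>x. \<bar>indicat_real (box a b) x\<bar> \<le> 1 * indicat_real (cball 0 R) x"
proof -
  obtain R where "box a b \<subseteq> cball 0 R"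
    using bounded_subset_ballD[OF bounded_box, of a b 0] ball_subset_cball by fast
  then show ?thesis
    by (intro that[of R]) (auto simp: indicator_def)
qed

lemma AE_integrable_segment:
  fixes g :: "'a::euclidean_space \<Rightarrow> 'a"
  assumes li: "locally_integrable g" and [measurable]: "g \<in> borel_measurable borel"
  shows "AE x in lborel. integrable lborel (\<lambda>t. segment_gradient g z x t)"
proof (rule AE_if_AE_boxes)
  fix a b :: 'a
  obtain R where R: "\<And>x. \<bar>indicat_real (box a b) x\<bar> \<le> 1 * indicat_real (cball 0 R) x"
    using indicator_box_le_cball[of a b] by blast
  have "AE x in lborel. integrable lborel
      (\<lambda>t. segment_gradient g z x t * indicat_real (box a b) x)"
    by (rule lborel_pair.AE_integrable_snd, rule integrable_segment_gradient_times[OF li _ _ R]) auto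
  then show "AE x in lborel. x \<in> box a b \<longrightarrow>
      integrable lborel (\<lambda>t. segment_gradient g z x t)"
    by eventually_elim auto
qed

lemma test_function_increment:
  assumes \<psi>: "test_function \<psi>"
  shows "\<psi> (x - z) - \<psi> x = - (LBINT t. indicat_real {0..1} t * frechet_derivative \<psi> (at (x - t *\<^sub>R z)) z)"
proof -
  have lin: "linear (frechet_derivative \<psi> (at y))" for y
    by (rule linear_frechet_derivative[OF test_function_differentiable[OF \<psi>]])
  have "(LBINT t. (- frechet_derivative \<psi> (at (x - t *\<^sub>R z)) z) * indicat_real {0..1} t) =
      \<psi> (x - 1 *\<^sub>R z) - \<psi> (x - 0 *\<^sub>R z)"
  proof (rule integral_FTC_Icc_real)
    fix t :: real
    have "((\<lambda>t. \<psi> (x - t *\<^sub>R z)) has_derivative (\<lambda>s. frechet_derivative \<psi> (at (x - t *\<^sub>R z)) (- (s *\<^sub>R z)))) (at t)"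
    proof (rule has_derivative_compose[where f="\<lambda>t. x - t *\<^sub>R z" and f'="\<lambda>s. - (s *\<^sub>R z)" and g=\<psi>])
      show "((\<lambda>t. x - t *\<^sub>R z) has_derivative (\<lambda>s. - (s *\<^sub>R z))) (at t)"
        by (auto intro!: derivative_eq_intros)
    qed (rule test_function_has_derivative[OF \<psi>])
    then show "((\<lambda>t. \<psi> (x - t *\<^sub>R z)) has_real_derivative - frechet_derivative \<psi> (at (x - t *\<^sub>R z)) z) (at t)"
      unfolding has_field_derivative_def
      by (rule has_derivative_eq_rhs) (simp add: fun_eq_iff linear_neg[OF lin] linear_cmul[OF lin])
    have "continuous_on UNIV (\<lambda>t. - frechet_derivative \<psi> (at (x - t *\<^sub>R z)) z)"
      by (intro continuous_on_minus continuous_on_compose2[OF test_function_derivative_continuous[OF \<psi>]]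
          continuous_intros) auto
    then show "isCont (\<lambda>t. - frechet_derivative \<psi> (at (x - t *\<^sub>R z)) z) t"
      by (simp add: continuous_on_eq_continuous_at)
  qed simp
  then show ?thesis
    by (simp add: mult.commute)
qed

text \<open>
  Move the translation to the test function, write the increment of the test function as an
  integral over \<open>t\<close>, exchange the integrals, use the weak gradient for each translated test
  function, and undo the translation.
\<close>
lemma weak_gradient_increment_tested:
  fixes u :: "'a::euclidean_space \<Rightarrow> real"
  assumes wg: "weak_gradient u g" and ug[measurable]: "u \<in> borel_measurable borel" "g \<in> borel_measurable borel"
    and \<psi>: "test_function \<psi>"
  shows "(LBINT x. (u (x + z) - u x) * \<psi> x) =
    (LBINT x. (LBINT t. segment_gradient g z x t) * \<psi> x)"
proof -
  have li: "locally_integrable u" "locally_integrable g"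
    using wg by (auto simp: weak_gradient_def)
  define D where "D x = frechet_derivative \<psi> (at x) z" for x
  obtain R B where RB: "R \<ge> 0" "B \<ge> 0" "\<And>x. \<bar>\<psi> x\<bar> \<le> B * indicat_real (cball 0 R) x"
    "\<And>x. \<bar>frechet_derivative \<psi> (at x) z\<bar> \<le> B * indicat_real (cball 0 R) x"
    by (rule test_function_bounds[OF \<psi>, of z]) (rule that)
  have [measurable]: "\<psi> \<in> borel_measurable borel" "D \<in> borel_measurable borel"
    unfolding D_def[abs_def] using \<psi>
    by (auto intro!: borel_measurable_continuous_onI test_function_continuous test_function_derivative_continuous)
  have int_u\<psi>: "integrable lborel (\<lambda>x. u x * \<psi> (x - c))" for c
  proof -
    obtain R B where "R \<ge> 0" "B \<ge> 0" and RB: "\<And>x. \<bar>\<psi> (x - c)\<bar> \<le> B * indicat_real (cball 0 R) x"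
      "\<And>x. \<bar>frechet_derivative (\<lambda>x. \<psi> (x - c)) (at x) z\<bar> \<le> B * indicat_real (cball 0 R) x"
      by (rule test_function_bounds[OF test_function_translate[OF \<psi>, of c], of z]) (rule that)
    show ?thesis
      by (rule integrable_locally_integrable_mult[OF li(1) _ _ RB(1)]) simp_all
  qed
  have int_u\<psi>': "integrable lborel (\<lambda>x. u (x + z) * \<psi> x)"
    using integrable_lborel_translate[OF int_u\<psi>[of z], of z] by simp
  have D_bound: "\<bar>D (x - t *\<^sub>R z)\<bar> \<le> B * indicat_real (cball 0 (R + norm z)) x" if "t \<in> {0..1}" for x t
  proof -
    have "norm (t *\<^sub>R z) \<le> norm z" using that by (simp add: mult_left_le_one_le)
    then have "indicat_real (cball 0 R) (x - t *\<^sub>R z) \<le> indicat_real (cball 0 (R + norm z)) x"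
      using norm_triangle_sub[of x "t *\<^sub>R z"] by (auto simp: indicator_def)
    with RB(2) have "B * indicat_real (cball 0 R) (x - t *\<^sub>R z) \<le> B * indicat_real (cball 0 (R + norm z)) x"
      by (intro mult_left_mono)
    with RB(4)[of "x - t *\<^sub>R z", folded D_def] show ?thesis
      by (rule order_trans)
  qed
  have int_pair: "integrable (lborel \<Otimes>\<^sub>M lborel) (\<lambda>(x, t). u x * (indicat_real {0..1} t * D (x - t *\<^sub>R z)))"
  proof (rule integrable_pairI)
    let ?w = "\<lambda>x. indicat_real (cball 0 (R + norm z)) x * norm (u x)"
    have "(\<integral>\<^sup>+x. (\<integral>\<^sup>+t. ennreal \<bar>u x * (indicat_real {0..1} t * D (x - t *\<^sub>R z))\<bar> \<partial>lborel) \<partial>lborel) \<le>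
        (\<integral>\<^sup>+x. (\<integral>\<^sup>+t. ennreal (B * ?w x) * indicator {0..1} t \<partial>(lborel::real measure)) \<partial>lborel)"
    proof (intro nn_integral_mono)
      fix x and t :: real
      show "ennreal \<bar>u x * (indicat_real {0..1} t * D (x - t *\<^sub>R z))\<bar> \<le> ennreal (B * ?w x) * indicator {0..1} t"
      proof (cases "t \<in> {0..1}")
        case True
        have "\<bar>u x\<bar> * \<bar>D (x - t *\<^sub>R z)\<bar> \<le> \<bar>u x\<bar> * (B * indicat_real (cball 0 (R + norm z)) x)"
          by (intro mult_left_mono D_bound True) simp
        then show ?thesis
          using True by (simp add: abs_mult mult_ac ennreal_leI)
      qed simp
    qed
    also have "\<dots> = ennreal B * (\<integral>\<^sup>+x. ennreal (?w x) \<partial>lborel)"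
      using RB(2) by (simp add: ennreal_mult nn_integral_cmult)
    also have "\<dots> < \<infinity>"
      using nn_integral_locally_integrable_finite[OF li(1), of "R + norm z"] by (simp add: ennreal_mult_less_top)
    finally show "(\<integral>\<^sup>+x. (\<integral>\<^sup>+t. ennreal \<bar>u x * (indicat_real {0..1} t * D (x - t *\<^sub>R z))\<bar> \<partial>lborel) \<partial>lborel) < \<infinity>" .
  qed measurable
  have "(LBINT x. (u (x + z) - u x) * \<psi> x) = (LBINT x. u (x + z) * \<psi> x) - (LBINT x. u x * \<psi> x)"
    using int_u\<psi>' int_u\<psi>[of 0] by (simp add: left_diff_distrib)
  also have "(LBINT x. u (x + z) * \<psi> x) = (LBINT x. u x * \<psi> (x - z))"
    using integral_lborel_translate[of "\<lambda>x. u x * \<psi> (x - z)" z] by simp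
  also have "\<dots> - (LBINT x. u x * \<psi> x) = (LBINT x. u x * (\<psi> (x - z) - \<psi> x))"
    using int_u\<psi>[of z] int_u\<psi>[of 0] by (simp add: right_diff_distrib)
  also have "\<dots> = (LBINT x. - (LBINT t. u x * (indicat_real {0..1} t * D (x - t *\<^sub>R z))))"
    unfolding test_function_increment[OF \<psi>] D_def by simp
  also have "\<dots> = - (LBINT x. (LBINT t. u x * (indicat_real {0..1} t * D (x - t *\<^sub>R z))))"
    by simp
  also have "(LBINT x. (LBINT t. u x * (indicat_real {0..1} t * D (x - t *\<^sub>R z)))) =
      (LBINT t. (LBINT x. u x * (indicat_real {0..1} t * D (x - t *\<^sub>R z))))"
    by (rule lborel_pair.Fubini_integral[OF int_pair, symmetric])
  also have "\<dots> = (LBINT t. - (LBINT x. segment_gradient g z x t * \<psi> x))"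
  proof (intro Bochner_Integration.integral_cong refl)
    fix t :: real
    have "(LBINT x. u x * D (x - t *\<^sub>R z)) = - (LBINT x. (g x \<bullet> z) * \<psi> (x - t *\<^sub>R z))"
      using weak_gradient_directional[OF wg ug test_function_translate[OF \<psi>, of "t *\<^sub>R z"], of z]
      by (simp add: D_def frechet_derivative_translate test_function_differentiable[OF \<psi>])
    also have "(LBINT x. (g x \<bullet> z) * \<psi> (x - t *\<^sub>R z)) = (LBINT x. (g (x + t *\<^sub>R z) \<bullet> z) * \<psi> x)"
      using integral_lborel_translate[of "\<lambda>x. (g x \<bullet> z) * \<psi> (x - t *\<^sub>R z)" "t *\<^sub>R z"] by simp
    finally show "(LBINT x. u x * (indicat_real {0..1} t * D (x - t *\<^sub>R z))) =
        - (LBINT x. segment_gradient g z x t * \<psi> x)"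
      by (cases "t \<in> {0..1}") simp_all
  qed
  also have "- \<dots> = (LBINT t. (LBINT x. segment_gradient g z x t * \<psi> x))"
    by simp
  also have "\<dots> = (LBINT x. (LBINT t. segment_gradient g z x t * \<psi> x))"
    by (rule lborel_pair.Fubini_integral[symmetric], rule integrable_segment_gradient_times[OF li(2) _ _ RB(3) RB(2)]) auto
  finally show ?thesis by simp
qed

text \<open>
  The fundamental theorem of calculus survives for weak gradients: both sides have the same
  integral against every test function. This identity carries both claims about Sobolev
  functions.
\<close>
lemma weak_gradient_increment:
  fixes u :: "'a::euclidean_space \<Rightarrow> real"
  assumes wg: "weak_gradient u g" and ug[measurable]: "u \<in> borel_measurable borel" "g \<in> borel_measurable borel"
  shows "AE x in lborel. u (x + z) - u x = (LBINT t. segment_gradient g z x t)"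
proof -
  have li: "locally_integrable u" "locally_integrable g"
    using wg by (auto simp: weak_gradient_def)
  define G where "G x = (LBINT t. segment_gradient g z x t)" for x
  have [measurable]: "G \<in> borel_measurable borel"
    unfolding G_def[abs_def] by measurable
  have int_mult: "integrable lborel (\<lambda>x. (u (x + z) - u x) * h x)" "integrable lborel (\<lambda>x. G x * h x)"
    if h: "\<And>x. \<bar>h x\<bar> \<le> B * indicat_real (cball 0 R) x" "B \<ge> 0" and [measurable]: "h \<in> borel_measurable borel" for h B R
  proof -
    have "indicat_real (cball 0 R) (x - z) \<le> indicat_real (cball 0 (R + norm z)) x" for x
      using norm_triangle_sub[of x z] by (auto simp: indicator_def)
    then have "B * indicat_real (cball 0 R) (x - z) \<le> B * indicat_real (cball 0 (R + norm z)) x" for x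
      using h(2) by (intro mult_left_mono)
    then have "\<bar>h (x - z)\<bar> \<le> B * indicat_real (cball 0 (R + norm z)) x" for x
      by (rule order_trans[OF h(1)])
    then have "integrable lborel (\<lambda>x. u x * h (x - z))"
      by (intro integrable_locally_integrable_mult[OF li(1), where B=B and R="R + norm z"]) auto
    then have "integrable lborel (\<lambda>x. u (x + z) * h x)"
      using integrable_lborel_translate[of "\<lambda>x. u x * h (x - z)" z] by simp
    moreover have "integrable lborel (\<lambda>x. u x * h x)"
      by (intro integrable_locally_integrable_mult[OF li(1) _ _ h(1)]) auto
    ultimately show "integrable lborel (\<lambda>x. (u (x + z) - u x) * h x)"
      by (simp add: left_diff_distrib)
    have "integrable lborel (\<lambda>x. LBINT t. segment_gradient g z x t * h x)"
      by (rule lborel_pair.integrable_snd, rule integrable_segment_gradient_times[OF li(2) _ _ h]) auto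
    then show "integrable lborel (\<lambda>x. G x * h x)"
      by (simp add: G_def)
  qed
  have "AE x in lborel. (u (x + z) - u x) - G x = 0"
  proof (rule fundamental_lemma_calculus_of_variations)
    fix a b :: 'a
    obtain R where R: "\<And>x. \<bar>indicat_real (box a b) x\<bar> \<le> 1 * indicat_real (cball 0 R) x"
      using indicator_box_le_cball[of a b] by blast
    have "integrable lborel (\<lambda>x. (u (x + z) - u x) * indicat_real (box a b) x - G x * indicat_real (box a b) x)"
      by (intro Bochner_Integration.integrable_diff int_mult[OF R]) auto
    also have "(\<lambda>x. (u (x + z) - u x) * indicat_real (box a b) x - G x * indicat_real (box a b) x) =
        (\<lambda>x. indicat_real (box a b) x *\<^sub>R ((u (x + z) - u x) - G x))"
      by (simp add: fun_eq_iff algebra_simps)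
    finally show "set_integrable lborel (box a b) (\<lambda>x. (u (x + z) - u x) - G x)"
      by (simp only: set_integrable_def)
  next
    fix \<psi> :: "'a \<Rightarrow> real" assume \<psi>: "test_function \<psi>"
    obtain R B where RB: "R \<ge> 0" "B \<ge> 0" "\<And>x. \<bar>\<psi> x\<bar> \<le> B * indicat_real (cball 0 R) x"
      "\<And>x. \<bar>frechet_derivative \<psi> (at x) z\<bar> \<le> B * indicat_real (cball 0 R) x"
      by (rule test_function_bounds[OF \<psi>, of z]) (rule that)
    have [measurable]: "\<psi> \<in> borel_measurable borel"
      using \<psi> by (auto intro!: borel_measurable_continuous_onI test_function_continuous)
    have "(LBINT x. ((u (x + z) - u x) - G x) * \<psi> x) =
        (LBINT x. (u (x + z) - u x) * \<psi> x) - (LBINT x. G x * \<psi> x)"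
      using int_mult[OF RB(3) RB(2)] by (simp add: left_diff_distrib)
    also have "\<dots> = 0"
      unfolding G_def using weak_gradient_increment_tested[OF wg ug \<psi>] by simp
    finally show "(LBINT x. ((u (x + z) - u x) - G x) * \<psi> x) = 0" .
  qed simp
  then show ?thesis
    by eventually_elim (simp add: G_def)
qed

section \<open>The nonlocal derivative in Lebesgue spaces\<close>

text \<open>
  Substitute for Minkowski's integral inequality: Jensen's inequality pointwise in \<open>x\<close>, followed by
  Tonelli's theorem.
\<close>
lemma lp_mass_integral_jensen_le:
  fixes F k :: "'a::euclidean_space \<Rightarrow> 'c::euclidean_space \<Rightarrow> real" and w :: "'c \<Rightarrow> real"
  assumes [measurable]: "w \<in> borel_measurable borel" "case_prod k \<in> borel_measurable (lborel \<Otimes>\<^sub>M lborel)"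
    and r: "r \<ge> 1" and M: "M \<ge> 0"
    and w: "\<And>z. w z \<ge> 0" "(\<integral>\<^sup>+z. ennreal (w z) \<partial>lborel) \<le> ennreal M"
    and k: "\<And>x z. k x z \<ge> 0" and F: "\<And>x z. \<bar>F x z\<bar> \<le> w z * k x z"
  shows "lp_mass r (\<lambda>x. LBINT z. F x z) \<le>
    ennreal (M powr (r - 1)) * (\<integral>\<^sup>+z. ennreal (w z) * lp_mass r (\<lambda>x. k x z) \<partial>lborel)"
proof -
  have "lp_mass r (\<lambda>x. LBINT z. F x z) \<le>
      (\<integral>\<^sup>+x. ennreal (M powr (r - 1)) * (\<integral>\<^sup>+z. ennreal (w z * k x z powr r) \<partial>lborel) \<partial>lborel)"
  proof (rule nn_integral_mono)
    fix x
    have [measurable]: "k x \<in> borel_measurable lborel"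
      using measurable_compose[OF measurable_Pair1' assms(2), of x] by simp
    show "ennreal (norm (LBINT z. F x z) powr r) \<le>
        ennreal (M powr (r - 1)) * (\<integral>\<^sup>+z. ennreal (w z * k x z powr r) \<partial>lborel)"
      unfolding real_norm_def
      by (rule jensen_powr_integral_le) (use r M w k F in \<open>auto simp: measurable_lborel1\<close>)
  qed
  also have "\<dots> = ennreal (M powr (r - 1)) * (\<integral>\<^sup>+x. (\<integral>\<^sup>+z. ennreal (w z * k x z powr r) \<partial>lborel) \<partial>lborel)"
    by (rule nn_integral_cmult) measurable
  also have "(\<integral>\<^sup>+x. (\<integral>\<^sup>+z. ennreal (w z * k x z powr r) \<partial>lborel) \<partial>lborel) =
      (\<integral>\<^sup>+z. (\<integral>\<^sup>+x. ennreal (w z * k x z powr r) \<partial>lborel) \<partial>lborel)"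
    by (rule lborel_pair.Fubini'[symmetric]) measurable
  also have "\<dots> = (\<integral>\<^sup>+z. ennreal (w z) * lp_mass r (\<lambda>x. k x z) \<partial>lborel)"
  proof (rule nn_integral_cong)
    fix z
    have [measurable]: "(\<lambda>x. k x z) \<in> borel_measurable lborel"
      using measurable_compose[OF measurable_Pair2' assms(2), of z] by simp
    have "(\<integral>\<^sup>+x. ennreal (w z * k x z powr r) \<partial>lborel) =
        (\<integral>\<^sup>+x. ennreal (w z) * ennreal (norm (k x z) powr r) \<partial>lborel)"
      using w k by (simp add: ennreal_mult)
    also have "\<dots> = ennreal (w z) * lp_mass r (\<lambda>x. k x z)"
      by (rule nn_integral_cmult) measurable
    finally show "(\<integral>\<^sup>+x. ennreal (w z * k x z powr r) \<partial>lborel) = ennreal (w z) * lp_mass r (\<lambda>x. k x z)" .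
  qed
  finally show ?thesis .
qed

lemma lp_mass_translate_diff_le:
  fixes f :: "'a::euclidean_space \<Rightarrow> 'b::euclidean_space"
  assumes [measurable]: "f \<in> borel_measurable borel" and "r \<ge> 0" and N: "lp_mass r f = ennreal N" "N \<ge> 0"
  shows "lp_mass r (\<lambda>x. f (x + z) - f x) \<le> ennreal (2 powr r * (2 * N))"
proof -
  have "lp_mass r (\<lambda>x. f (x + z) - f x) \<le> ennreal (2 powr r) * (lp_mass r (\<lambda>x. f (x + z)) + lp_mass r f)"
    using \<open>r \<ge> 0\<close> by (intro lp_mass_diff_le) auto
  also have "lp_mass r (\<lambda>x. f (x + z)) = ennreal N"
    using lp_mass_translate[where f=f and r=r and z=z] N by simp
  also have "ennreal (2 powr r) * (ennreal N + lp_mass r f) = ennreal (2 powr r * (2 * N))"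
    using N by (simp add: ennreal_mult' flip: ennreal_plus)
  finally show ?thesis .
qed

text \<open>
  By Tonelli, the integral of \<open>\<bar>k z\<bar> * \<bar>u (x + z) - u x\<bar> powr r\<close> over \<open>z\<close> is finite for almost every
  \<open>x\<close>. Since \<open>t \<le> 1 + t powr r\<close> and \<open>k\<close> is integrable, the first power is integrable there too.
\<close>
lemma AE_integrable_nonlocal:
  fixes u k :: "'a::euclidean_space \<Rightarrow> real"
  assumes [measurable]: "u \<in> borel_measurable borel" and k: "integrable lborel k"
    and r: "r \<ge> 1" and u: "lp_mass r u < \<infinity>"
  shows "AE x in lborel. integrable lborel (\<lambda>z. (u (x + z) - u x) * k z)"
proof -
  have [measurable]: "k \<in> borel_measurable borel" using k by auto
  obtain N where N: "lp_mass r u = ennreal N" "N \<ge> 0"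
    using u by (cases "lp_mass r u") auto
  have kfin: "(\<integral>\<^sup>+z. ennreal \<bar>k z\<bar> \<partial>lborel) < \<infinity>"
    using k by (simp add: integrable_iff_bounded)
  have "(\<integral>\<^sup>+x. (\<integral>\<^sup>+z. ennreal (\<bar>k z\<bar> * \<bar>u (x + z) - u x\<bar> powr r) \<partial>lborel) \<partial>lborel) =
      (\<integral>\<^sup>+z. (\<integral>\<^sup>+x. ennreal (\<bar>k z\<bar> * \<bar>u (x + z) - u x\<bar> powr r) \<partial>lborel) \<partial>lborel)"
    by (rule lborel_pair.Fubini'[symmetric]) measurable
  also have "\<dots> = (\<integral>\<^sup>+z. ennreal \<bar>k z\<bar> * lp_mass r (\<lambda>x. u (x + z) - u x) \<partial>lborel)"
    by (intro nn_integral_cong) (simp add: ennreal_mult nn_integral_cmult)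
  also have "\<dots> \<le> (\<integral>\<^sup>+z. ennreal \<bar>k z\<bar> * ennreal (2 powr r * (2 * N)) \<partial>lborel)"
    using r N by (intro nn_integral_mono mult_left_mono lp_mass_translate_diff_le) auto
  also have "\<dots> = (\<integral>\<^sup>+z. ennreal \<bar>k z\<bar> \<partial>lborel) * ennreal (2 powr r * (2 * N))"
    by (simp add: nn_integral_multc)
  also have "\<dots> < \<infinity>"
    using kfin by (simp add: ennreal_mult_less_top)
  finally have "(\<integral>\<^sup>+x. (\<integral>\<^sup>+z. ennreal (\<bar>k z\<bar> * \<bar>u (x + z) - u x\<bar> powr r) \<partial>lborel) \<partial>lborel) \<noteq> \<infinity>"
    by simp
  then have "AE x in lborel. (\<integral>\<^sup>+z. ennreal (\<bar>k z\<bar> * \<bar>u (x + z) - u x\<bar> powr r) \<partial>lborel) \<noteq> \<infinity>"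
    by (intro nn_integral_PInf_AE) measurable
  then show ?thesis
  proof eventually_elim
    case (elim x)
    show ?case
    proof (rule integrableI_bounded)
      have "(\<integral>\<^sup>+z. ennreal (norm ((u (x + z) - u x) * k z)) \<partial>lborel) \<le>
          (\<integral>\<^sup>+z. ennreal \<bar>k z\<bar> + ennreal (\<bar>k z\<bar> * \<bar>u (x + z) - u x\<bar> powr r) \<partial>lborel)"
      proof (intro nn_integral_mono)
        fix z
        let ?t = "\<bar>u (x + z) - u x\<bar>"
        have "?t \<le> 1 + ?t powr r"
        proof (cases "?t \<le> 1")
          case False
          then have "?t powr 1 \<le> ?t powr r" using r by (intro powr_mono) auto
          then show ?thesis using False by simp
        qed (auto intro: add_increasing2)
        then have "\<bar>k z\<bar> * ?t \<le> \<bar>k z\<bar> * (1 + ?t powr r)"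
          by (intro mult_left_mono) auto
        then show "ennreal (norm ((u (x + z) - u x) * k z)) \<le> ennreal \<bar>k z\<bar> + ennreal (\<bar>k z\<bar> * ?t powr r)"
          by (simp add: abs_mult mult.commute distrib_left flip: ennreal_plus)
      qed
      also have "\<dots> = (\<integral>\<^sup>+z. ennreal \<bar>k z\<bar> \<partial>lborel) + (\<integral>\<^sup>+z. ennreal (\<bar>k z\<bar> * \<bar>u (x + z) - u x\<bar> powr r) \<partial>lborel)"
        by (rule nn_integral_add) measurable
      also have "\<dots> < \<infinity>"
        using kfin elim by (simp add: less_top)
      finally show "(\<integral>\<^sup>+z. ennreal (norm ((u (x + z) - u x) * k z)) \<partial>lborel) < \<infinity>" .
    qed simp
  qed
qed

lemma lp_mass_nonlocal_finite:
  fixes u k :: "'a::euclidean_space \<Rightarrow> real"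
  assumes [measurable]: "u \<in> borel_measurable borel" and k: "integrable lborel k"
    and r: "r \<ge> 1" and u: "lp_mass r u < \<infinity>"
  shows "lp_mass r (\<lambda>x. LBINT z. (u (x + z) - u x) * k z) < \<infinity>"
proof -
  have [measurable]: "k \<in> borel_measurable borel" using k by auto
  obtain N where N: "lp_mass r u = ennreal N" "N \<ge> 0"
    using u by (cases "lp_mass r u") auto
  define M where "M = (LBINT z. \<bar>k z\<bar>)"
  have M: "(\<integral>\<^sup>+z. ennreal \<bar>k z\<bar> \<partial>lborel) = ennreal M" "M \<ge> 0"
    unfolding M_def using k by (auto intro!: nn_integral_eq_integral)
  have "lp_mass r (\<lambda>x. LBINT z. (u (x + z) - u x) * k z) \<le>
      ennreal (M powr (r - 1)) * (\<integral>\<^sup>+z. ennreal \<bar>k z\<bar> * lp_mass r (\<lambda>x. \<bar>u (x + z) - u x\<bar>) \<partial>lborel)"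
    by (rule lp_mass_integral_jensen_le) (use r M in \<open>auto simp: abs_mult\<close>)
  also have "\<dots> \<le> ennreal (M powr (r - 1)) * (\<integral>\<^sup>+z. ennreal \<bar>k z\<bar> * ennreal (2 powr r * (2 * N)) \<partial>lborel)"
    using lp_mass_translate_diff_le[of u r N] r N by (intro nn_integral_mono mult_left_mono) auto
  also have "\<dots> = ennreal (M powr (r - 1)) * (ennreal M * ennreal (2 powr r * (2 * N)))"
    by (simp add: nn_integral_multc M)
  also have "\<dots> < \<infinity>"
    by (simp add: ennreal_mult_less_top)
  finally show ?thesis .
qed

abbreviation abs_moment :: "'a::euclidean_space measure \<Rightarrow> ('a \<Rightarrow> real) \<Rightarrow> ennreal" where
  "abs_moment M k \<equiv> \<integral>\<^sup>+z. ennreal (\<bar>k z\<bar> * norm z) \<partial>M"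

abbreviation tail_moment :: "'a::euclidean_space measure \<Rightarrow> real \<Rightarrow> ('a \<Rightarrow> real) \<Rightarrow> ennreal" where
  "tail_moment M d k \<equiv> \<integral>\<^sup>+z\<in>- ball 0 d. ennreal (\<bar>k z\<bar> * norm z) \<partial>M"

text \<open>
  How the moment bounds on a kernel are used: \<open>\<tau>\<close> is an error per unit of \<open>norm z\<close>, small near the
  origin by continuity of translations and merely bounded by \<open>K\<close> far away, where the moment of
  the kernel is small.
\<close>
lemma nn_integral_kernel_split:
  fixes k :: "'a::euclidean_space \<Rightarrow> real"
  assumes [measurable]: "k \<in> borel_measurable borel"
    and M: "abs_moment lborel k \<le> ennreal M" "M \<ge> 0"
    and w: "tail_moment lborel d k \<le> ennreal w" "w \<ge> 0"
    and \<tau>: "\<And>z. z \<noteq> 0 \<Longrightarrow> norm z < d \<Longrightarrow> \<tau> z \<le> ennreal e" "\<And>z. z \<noteq> 0 \<Longrightarrow> \<tau> z \<le> ennreal K" and eK: "e \<ge> 0" "K \<ge> 0"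
  shows "(\<integral>\<^sup>+z. ennreal (\<bar>k z\<bar> * norm z) * \<tau> z \<partial>lborel) \<le> ennreal (M * e + w * K)"
proof -
  have "(\<integral>\<^sup>+z. ennreal (\<bar>k z\<bar> * norm z) * \<tau> z \<partial>lborel) \<le>
      (\<integral>\<^sup>+z. ennreal (\<bar>k z\<bar> * norm z) * ennreal e +
        (ennreal (\<bar>k z\<bar> * norm z) * indicator (- ball 0 d) z) * ennreal K \<partial>lborel)"
  proof (intro nn_integral_mono)
    fix z
    show "ennreal (\<bar>k z\<bar> * norm z) * \<tau> z \<le> ennreal (\<bar>k z\<bar> * norm z) * ennreal e +
        (ennreal (\<bar>k z\<bar> * norm z) * indicator (- ball 0 d) z) * ennreal K"
    proof (cases "z = 0")
      case False
      show ?thesis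
      proof (cases "norm z < d")
        case True
        with False show ?thesis using mult_left_mono[OF \<tau>(1)[of z], of "ennreal (\<bar>k z\<bar> * norm z)"] by simp
      next
        case near: False
        with False have "ennreal (\<bar>k z\<bar> * norm z) * \<tau> z \<le> ennreal (\<bar>k z\<bar> * norm z) * ennreal K"
          by (intro mult_left_mono \<tau>(2)) auto
        with near show ?thesis by (simp add: add_increasing)
      qed
    qed simp
  qed
  also have "\<dots> = abs_moment lborel k * ennreal e +
      tail_moment lborel d k * ennreal K"
    by (simp add: nn_integral_add nn_integral_multc)
  also have "\<dots> \<le> ennreal M * ennreal e + ennreal w * ennreal K"
    using M w by (intro add_mono mult_right_mono) auto
  also have "\<dots> = ennreal (M * e + w * K)"
    using M w eK by (simp add: ennreal_mult)
  finally show ?thesis .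
qed

lemma integrable_kernel_moment:
  fixes k :: "'a::euclidean_space \<Rightarrow> real"
  assumes [measurable]: "k \<in> borel_measurable borel"
    and M: "abs_moment lborel k \<le> ennreal M"
  shows "integrable lborel (\<lambda>z. k z *\<^sub>R z)"
proof (rule integrableI_bounded)
  show "(\<integral>\<^sup>+z. ennreal (norm (k z *\<^sub>R z)) \<partial>lborel) < \<infinity>"
    using M by (simp add: le_less_trans)
qed simp

text \<open>
  By the increment formula, the remainder of the Taylor expansion divided by \<open>norm z\<close> is at most the average over
  the segment of the change of the gradient.
\<close>
lemma lp_mass_remainder_le:
  fixes u :: "'a::euclidean_space \<Rightarrow> real"
  assumes wg: "weak_gradient u g" and ug[measurable]: "u \<in> borel_measurable borel" "g \<in> borel_measurable borel"
    and r: "r \<ge> 1" and z: "z \<noteq> 0"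
    and b: "\<And>t. t \<in> {0..1} \<Longrightarrow> lp_mass r (\<lambda>x. g (x + t *\<^sub>R z) - g x) \<le> b"
  shows "lp_mass r (\<lambda>x. \<bar>u (x + z) - u x - g x \<bullet> z\<bar> / norm z) \<le> b"
proof -
  have li: "locally_integrable g"
    using wg by (simp add: weak_gradient_def)
  \<comment> \<open>The remainder divided by \<open>norm z\<close>, before integration over the segment.\<close>
  define F where "F x t = indicat_real {0..1} t * ((g (x + t *\<^sub>R z) - g x) \<bullet> z) / norm z" for x t
  have "AE x in lborel. \<bar>u (x + z) - u x - g x \<bullet> z\<bar> / norm z = \<bar>LBINT t. F x t\<bar>"
    using weak_gradient_increment[OF wg ug, of z] AE_integrable_segment[OF li ug(2), of z]
  proof eventually_elim
    case (elim x)
    have "(LBINT t. F x t) = (LBINT t. segment_gradient g z x t - indicat_real {0..1} t * (g x \<bullet> z)) / norm z"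
      by (simp add: F_def inner_diff_left right_diff_distrib)
    also have "(LBINT t. segment_gradient g z x t - indicat_real {0..1} t * (g x \<bullet> z)) =
        (LBINT t. segment_gradient g z x t) - (LBINT t. indicat_real {0..1::real} t * (g x \<bullet> z))"
      by (rule Bochner_Integration.integral_diff[OF elim(2)]) (auto simp: integrable_indicator_iff)
    finally show ?case
      using elim by (simp add: abs_divide)
  qed
  then have "lp_mass r (\<lambda>x. \<bar>u (x + z) - u x - g x \<bullet> z\<bar> / norm z) = lp_mass r (\<lambda>x. LBINT t. F x t)"
    by (intro nn_integral_cong_AE) (auto elim!: eventually_mono)
  also have "\<dots> \<le> ennreal (1 powr (r - 1)) *
      (\<integral>\<^sup>+t. ennreal (indicat_real {0..1} t) * lp_mass r (\<lambda>x. norm (g (x + t *\<^sub>R z) - g x)) \<partial>lborel)"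
  proof (rule lp_mass_integral_jensen_le)
    show "\<bar>F x t\<bar> \<le> indicat_real {0..1} t * norm (g (x + t *\<^sub>R z) - g x)" for x t
      using Cauchy_Schwarz_ineq2[of "g (x + t *\<^sub>R z) - g x" z] z
      by (auto simp: F_def abs_mult indicator_def divide_le_eq)
  qed (use r in \<open>auto simp: ennreal_indicator\<close>)
  also have "\<dots> = (\<integral>\<^sup>+t. ennreal (indicat_real {0..1} t) * lp_mass r (\<lambda>x. g (x + t *\<^sub>R z) - g x) \<partial>lborel)"
    by simp
  also have "\<dots> \<le> (\<integral>\<^sup>+t. ennreal (indicat_real {0..1} t) * b \<partial>(lborel::real measure))"
    using b by (intro nn_integral_mono) (auto simp: indicator_def)
  also have "\<dots> = b"
    by (simp add: nn_integral_multc ennreal_indicator)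
  finally show ?thesis .
qed

text \<open>
  With the Taylor remainder \<open>h\<close>, the error is the integral of \<open>h x z * k z\<close> plus the product of
  \<open>g x\<close> with the error of the first moment. In the bound, \<open>e\<close> and \<open>w\<close> can be made
  small while \<open>M\<close> and \<open>N\<close> stay fixed.
\<close>
lemma lp_mass_nonlocal_error_le:
  fixes u k :: "'a::euclidean_space \<Rightarrow> real" and a :: 'a
  assumes wg: "weak_gradient u g" and ug[measurable]: "u \<in> borel_measurable borel" "g \<in> borel_measurable borel"
    and r: "r \<ge> 1" and u: "lp_mass r u < \<infinity>" and g: "lp_mass r g = ennreal N" "N \<ge> 0"
    and k: "integrable lborel k"
    and M: "abs_moment lborel k \<le> ennreal M" "M \<ge> 0"
    and w: "tail_moment lborel d k \<le> ennreal w" "w \<ge> 0"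
    and V: "norm ((LBINT z. k z *\<^sub>R z) - a) \<le> w"
    and e: "\<And>z. norm z < d \<Longrightarrow> lp_mass r (\<lambda>x. g (x + z) - g x) \<le> ennreal e" "e \<ge> 0"
  shows "lp_mass r (\<lambda>x. (LBINT z. (u (x + z) - u x) * k z) - a \<bullet> g x) \<le>
    ennreal (2 powr r * (M powr (r - 1) * (M * e + w * (2 powr r * (2 * N))) + w powr r * N))"
proof -
  have [measurable]: "k \<in> borel_measurable borel" using k by auto
  define h where "h x z = u (x + z) - u x - g x \<bullet> z" for x z
  define v where "v = (LBINT z. k z *\<^sub>R z) - a"
  have [measurable]: "case_prod h \<in> borel_measurable (lborel \<Otimes>\<^sub>M lborel)"
    unfolding h_def[abs_def] by measurable
  have mom: "integrable lborel (\<lambda>z. k z *\<^sub>R z)"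
    by (rule integrable_kernel_moment[OF _ M(1)]) simp
  have "AE x in lborel. (LBINT z. (u (x + z) - u x) * k z) - a \<bullet> g x =
      (LBINT z. h x z * k z) + v \<bullet> g x"
    using AE_integrable_nonlocal[OF ug(1) k r u]
  proof eventually_elim
    case (elim x)
    have "integrable lborel (\<lambda>z. (k z *\<^sub>R z) \<bullet> g x)"
      using mom by (intro integrable_inner_left) auto
    then have int2: "integrable lborel (\<lambda>z. (g x \<bullet> z) * k z)"
      by (simp add: inner_commute mult.commute)
    have "(LBINT z. h x z * k z) = (LBINT z. (u (x + z) - u x) * k z - (g x \<bullet> z) * k z)"
      by (simp add: h_def left_diff_distrib)
    also have "\<dots> = (LBINT z. (u (x + z) - u x) * k z) - (LBINT z. (g x \<bullet> z) * k z)"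
      using elim int2 by (rule Bochner_Integration.integral_diff)
    also have "(LBINT z. (g x \<bullet> z) * k z) = (LBINT z. (k z *\<^sub>R z) \<bullet> g x)"
      by (simp add: inner_commute mult.commute)
    also have "\<dots> = (LBINT z. k z *\<^sub>R z) \<bullet> g x"
      using mom by (intro integral_inner_left) auto
    finally show ?case
      by (simp add: v_def inner_diff_left)
  qed
  then have "lp_mass r (\<lambda>x. (LBINT z. (u (x + z) - u x) * k z) - a \<bullet> g x) =
      lp_mass r (\<lambda>x. (LBINT z. h x z * k z) + v \<bullet> g x)"
    by (intro nn_integral_cong_AE) (auto elim!: eventually_mono)
  also have "\<dots> \<le> ennreal (2 powr r) * (lp_mass r (\<lambda>x. LBINT z. h x z * k z) + lp_mass r (\<lambda>x. v \<bullet> g x))"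
    using r by (intro lp_mass_add_le) auto
  also have "\<dots> \<le> ennreal (2 powr r) * (ennreal (M powr (r - 1) * (M * e + w * (2 powr r * (2 * N)))) + ennreal (w powr r * N))"
  proof (intro mult_left_mono add_mono)
    have "lp_mass r (\<lambda>x. LBINT z. h x z * k z) \<le>
        ennreal (M powr (r - 1)) * (\<integral>\<^sup>+z. ennreal (\<bar>k z\<bar> * norm z) * lp_mass r (\<lambda>x. \<bar>h x z\<bar> / norm z) \<partial>lborel)"
    proof (rule lp_mass_integral_jensen_le)
      show "\<bar>h x z * k z\<bar> \<le> \<bar>k z\<bar> * norm z * (\<bar>h x z\<bar> / norm z)" for x z
        by (cases "z = 0") (auto simp: h_def abs_mult)
    qed (use r M in auto)
    also have "\<dots> \<le> ennreal (M powr (r - 1)) * ennreal (M * e + w * (2 powr r * (2 * N)))"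
    proof (intro mult_left_mono nn_integral_kernel_split[OF _ M w])
      fix z :: 'a assume z: "z \<noteq> 0"
      show "lp_mass r (\<lambda>x. \<bar>h x z\<bar> / norm z) \<le> ennreal e" if zd: "norm z < d"
        unfolding h_def
      proof (rule lp_mass_remainder_le[OF wg ug r z])
        fix t :: real assume "t \<in> {0..1}"
        then have "norm (t *\<^sub>R z) \<le> norm z" by (simp add: mult_left_le_one_le)
        then show "lp_mass r (\<lambda>x. g (x + t *\<^sub>R z) - g x) \<le> ennreal e"
          using zd by (intro e) simp
      qed
      show "lp_mass r (\<lambda>x. \<bar>h x z\<bar> / norm z) \<le> ennreal (2 powr r * (2 * N))"
        unfolding h_def
        by (intro lp_mass_remainder_le[OF wg ug r z] lp_mass_translate_diff_le) (use r g in auto)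
    qed (use e g in auto)
    also have "\<dots> = ennreal (M powr (r - 1) * (M * e + w * (2 powr r * (2 * N))))"
      using M e w g by (intro ennreal_mult[symmetric]) auto
    finally show "lp_mass r (\<lambda>x. LBINT z. h x z * k z) \<le>
        ennreal (M powr (r - 1) * (M * e + w * (2 powr r * (2 * N))))" .
    have "lp_mass r (\<lambda>x. v \<bullet> g x) \<le> (\<integral>\<^sup>+x. ennreal (w powr r) * ennreal (norm (g x) powr r) \<partial>lborel)"
    proof (intro nn_integral_mono)
      fix x
      have "\<bar>v \<bullet> g x\<bar> \<le> norm v * norm (g x)"
        by (rule Cauchy_Schwarz_ineq2)
      also have "\<dots> \<le> w * norm (g x)"
        using V by (intro mult_right_mono) (auto simp: v_def)
      finally have "\<bar>v \<bullet> g x\<bar> powr r \<le> (w * norm (g x)) powr r"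
        using r by (intro powr_mono2) auto
      then show "ennreal (norm (v \<bullet> g x) powr r) \<le> ennreal (w powr r) * ennreal (norm (g x) powr r)"
        using w by (simp add: powr_mult flip: ennreal_mult')
    qed
    also have "\<dots> = ennreal (w powr r * N)"
      using g by (simp add: nn_integral_cmult ennreal_mult')
    finally show "lp_mass r (\<lambda>x. v \<bullet> g x) \<le> ennreal (w powr r * N)" .
  qed simp
  also have "\<dots> = ennreal (2 powr r * (M powr (r - 1) * (M * e + w * (2 powr r * (2 * N))) + w powr r * N))"
    using M e w g by (simp add: ennreal_mult')
  finally show ?thesis .
qed

section \<open>The nonlocal derivative against Sobolev functions\<close>

text \<open>
  Express the increment of \<open>\<phi>\<close> by its gradient and move the translation from the gradient back to
  \<open>u\<close>. Hence only translates of \<open>u\<close> are compared, which is what makes the estimate useful even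
  if \<open>g\<close> is merely bounded, where translations are not continuous.
\<close>
lemma increment_pairing_error_le:
  fixes u \<phi> :: "'a::euclidean_space \<Rightarrow> real" and g :: "'a \<Rightarrow> 'a"
  assumes wg: "weak_gradient \<phi> g" and meas[measurable]: "u \<in> borel_measurable borel"
    "\<phi> \<in> borel_measurable borel" "g \<in> borel_measurable borel"
    and P\<phi>: "\<And>c. (\<integral>\<^sup>+x. ennreal (\<bar>u (x + c)\<bar> * \<bar>\<phi> x\<bar>) \<partial>lborel) \<le> ennreal C"
    and Pg: "\<And>c. abs_pairing (\<lambda>x. u (x + c)) g \<le> ennreal C"
    and b: "\<And>t. t \<in> {0..1} \<Longrightarrow> abs_pairing (\<lambda>x. u (x + t *\<^sub>R z) - u x) g \<le> ennreal b" "b \<ge> 0"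
  shows "\<bar>(LBINT x. (u (x + z) - u x) * \<phi> x) + (LBINT x. u x *\<^sub>R g x) \<bullet> z\<bar> \<le> norm z * b"
proof -
  have int_\<phi>: "integrable lborel (\<lambda>x. u (x + c) * \<phi> x)" for c
  proof (rule integrableI_bounded)
    show "(\<integral>\<^sup>+x. ennreal (norm (u (x + c) * \<phi> x)) \<partial>lborel) < \<infinity>"
      using P\<phi>[of c] by (simp add: abs_mult le_less_trans)
  qed simp
  have int_gv: "integrable lborel (\<lambda>x. u (x + c) *\<^sub>R g x)" for c
  proof (rule integrableI_bounded)
    show "(\<integral>\<^sup>+x. ennreal (norm (u (x + c) *\<^sub>R g x)) \<partial>lborel) < \<infinity>"
      using Pg[of c] by (simp add: le_less_trans)
  qed simp
  have int_g: "integrable lborel (\<lambda>x. u (x + c) * (g x \<bullet> z))" for c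
    using integrable_inner_left[of z lborel "\<lambda>x. u (x + c) *\<^sub>R g x"] int_gv[of c] by simp
  define B where "B t = (LBINT x. u (x + t *\<^sub>R z) * (g x \<bullet> z))" for t :: real
  have B0: "B 0 = (LBINT x. u x *\<^sub>R g x) \<bullet> z"
    using integral_inner_left[of z lborel "\<lambda>x. u x *\<^sub>R g x"] int_gv[of 0] by (simp add: B_def)
  define F where "F t x = u x * (segment_gradient g (- z) x t)" for t x
  have F_int: "(LBINT x. F t x) = - (indicat_real {0..1} t * B t)" for t
  proof -
    have "(LBINT x. F t x) = (LBINT x. F t (x + t *\<^sub>R z))"
      by (rule integral_lborel_translate[symmetric]) (simp add: F_def)
    also have "\<dots> = (LBINT x. - indicat_real {0..1} t * (u (x + t *\<^sub>R z) * (g x \<bullet> z)))"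
      by (simp add: F_def mult_ac)
    finally show ?thesis by (simp add: B_def)
  qed
  have F_pair: "integrable (lborel \<Otimes>\<^sub>M lborel) (case_prod F)"
  proof (rule integrable_pairI)
    show "case_prod F \<in> borel_measurable (lborel \<Otimes>\<^sub>M lborel)"
      unfolding F_def[abs_def] by measurable
    have "(\<integral>\<^sup>+t. (\<integral>\<^sup>+x. ennreal \<bar>F t x\<bar> \<partial>lborel) \<partial>lborel) \<le>
        (\<integral>\<^sup>+t. ennreal (norm z) * ennreal C * indicator {0..1} t \<partial>(lborel::real measure))"
    proof (intro nn_integral_mono)
      fix t :: real
      have "(\<integral>\<^sup>+x. ennreal \<bar>F t x\<bar> \<partial>lborel) = (\<integral>\<^sup>+x. ennreal \<bar>F t (x + t *\<^sub>R z)\<bar> \<partial>lborel)"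
        by (rule nn_integral_lborel_translate[symmetric]) (simp add: F_def)
      also have "\<dots> \<le> (\<integral>\<^sup>+x. ennreal (norm z) * ennreal (\<bar>u (x + t *\<^sub>R z)\<bar> * norm (g x)) * indicator {0..1} t \<partial>lborel)"
      proof (intro nn_integral_mono)
        fix x
        have "\<bar>u (x + t *\<^sub>R z)\<bar> * \<bar>g x \<bullet> z\<bar> \<le> \<bar>u (x + t *\<^sub>R z)\<bar> * (norm (g x) * norm z)"
          by (intro mult_left_mono Cauchy_Schwarz_ineq2) auto
        then show "ennreal \<bar>F t (x + t *\<^sub>R z)\<bar> \<le>
            ennreal (norm z) * ennreal (\<bar>u (x + t *\<^sub>R z)\<bar> * norm (g x)) * indicator {0..1} t"
          by (cases "t \<in> {0..1}") (simp_all add: F_def abs_mult mult_ac ennreal_leI flip: ennreal_mult')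
      qed
      also have "\<dots> = ennreal (norm z) * abs_pairing (\<lambda>x. u (x + t *\<^sub>R z)) g * indicator {0..1} t"
        by (simp add: nn_integral_cmult nn_integral_multc)
      also have "\<dots> \<le> ennreal (norm z) * ennreal C * indicator {0..1} t"
        by (intro mult_right_mono mult_left_mono Pg) auto
      finally show "(\<integral>\<^sup>+x. ennreal \<bar>F t x\<bar> \<partial>lborel) \<le> ennreal (norm z) * ennreal C * indicator {0..1} t" .
    qed
    also have "\<dots> = ennreal (norm z) * ennreal C"
      by (simp add: nn_integral_cmult)
    also have "\<dots> < \<infinity>"
      by (simp add: ennreal_mult_less_top)
    finally show "(\<integral>\<^sup>+t. (\<integral>\<^sup>+x. ennreal \<bar>F t x\<bar> \<partial>lborel) \<partial>lborel) < \<infinity>" .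
  qed
  have int_B: "integrable lborel (\<lambda>t. indicat_real {0..1} t * B t)"
    using integrable_minus[OF lborel_pair.integrable_fst[OF F_pair]] by (simp add: F_int)
  have "(LBINT x. (u (x + z) - u x) * \<phi> x) = (LBINT x. u (x + z) * \<phi> x) - (LBINT x. u x * \<phi> x)"
    using int_\<phi>[of z] int_\<phi>[of 0] by (simp add: left_diff_distrib)
  also have "(LBINT x. u (x + z) * \<phi> x) = (LBINT x. u x * \<phi> (x + - z))"
    using integral_lborel_translate[of "\<lambda>x. u (x + z) * \<phi> x" "- z"] by simp
  also have "\<dots> - (LBINT x. u x * \<phi> x) = (LBINT x. u x * (\<phi> (x + - z) - \<phi> x))"
    using integrable_lborel_translate[OF int_\<phi>[of z], of "- z"] int_\<phi>[of 0]
    by (simp add: right_diff_distrib)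
  also have "\<dots> = (LBINT x. (LBINT t. F t x))"
  proof (rule integral_cong_AE)
    show "AE x in lborel. u x * (\<phi> (x + - z) - \<phi> x) = (LBINT t. F t x)"
      using weak_gradient_increment[OF wg meas(2,3), of "- z"]
      by eventually_elim (simp add: F_def)
  qed (simp_all add: F_def[abs_def])
  also have "\<dots> = (LBINT t. (LBINT x. F t x))"
    by (rule lborel_pair.Fubini_integral[OF F_pair])
  also have "\<dots> = - (LBINT t. indicat_real {0..1} t * B t)"
    by (simp add: F_int)
  finally have "(LBINT x. (u (x + z) - u x) * \<phi> x) + B 0 =
      (LBINT t. indicat_real {0..1::real} t * B 0) - (LBINT t. indicat_real {0..1} t * B t)"
    by simp
  also have "\<dots> = (LBINT t. indicat_real {0..1} t * B 0 - indicat_real {0..1} t * B t)"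
    using int_B by (intro Bochner_Integration.integral_diff[symmetric]) (auto simp: integrable_indicator_iff)
  finally have eq: "(LBINT x. (u (x + z) - u x) * \<phi> x) + B 0 =
      (LBINT t. indicat_real {0..1} t * B 0 - indicat_real {0..1} t * B t)" .
  have B_bound: "\<bar>B 0 - B t\<bar> \<le> norm z * b" if t: "t \<in> {0..1}" for t
  proof -
    have "B t - B 0 = (LBINT x. (u (x + t *\<^sub>R z) - u x) * (g x \<bullet> z))"
      using int_g[of "t *\<^sub>R z"] int_g[of 0] by (simp add: B_def left_diff_distrib)
    moreover have "ennreal (norm (LBINT x. (u (x + t *\<^sub>R z) - u x) * (g x \<bullet> z))) \<le>
        (\<integral>\<^sup>+x. ennreal (norm ((u (x + t *\<^sub>R z) - u x) * (g x \<bullet> z))) \<partial>lborel)"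
      using int_g[of "t *\<^sub>R z"] int_g[of 0] by (intro integral_norm_bound_ennreal) (simp add: left_diff_distrib)
    moreover have "\<dots> \<le> (\<integral>\<^sup>+x. ennreal (norm z) * ennreal (\<bar>u (x + t *\<^sub>R z) - u x\<bar> * norm (g x)) \<partial>lborel)"
    proof (intro nn_integral_mono)
      fix x
      have "\<bar>u (x + t *\<^sub>R z) - u x\<bar> * \<bar>g x \<bullet> z\<bar> \<le> \<bar>u (x + t *\<^sub>R z) - u x\<bar> * (norm (g x) * norm z)"
        by (intro mult_left_mono Cauchy_Schwarz_ineq2) auto
      then show "ennreal (norm ((u (x + t *\<^sub>R z) - u x) * (g x \<bullet> z))) \<le>
          ennreal (norm z) * ennreal (\<bar>u (x + t *\<^sub>R z) - u x\<bar> * norm (g x))"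
        by (simp add: abs_mult mult_ac ennreal_leI flip: ennreal_mult')
    qed
    moreover have "\<dots> = ennreal (norm z) * abs_pairing (\<lambda>x. u (x + t *\<^sub>R z) - u x) g"
      by (simp add: nn_integral_cmult)
    moreover have "\<dots> \<le> ennreal (norm z) * ennreal b"
      by (intro mult_left_mono b(1)[OF t]) simp
    moreover have "\<dots> = ennreal (norm z * b)"
      by (simp add: ennreal_mult')
    ultimately have "ennreal \<bar>B t - B 0\<bar> \<le> ennreal (norm z * b)"
      by simp
    then show ?thesis
      using b(2) by (subst (asm) ennreal_le_iff) auto
  qed
  have "ennreal (norm (LBINT t. indicat_real {0..1} t * B 0 - indicat_real {0..1} t * B t)) \<le>
      (\<integral>\<^sup>+t. ennreal (norm (indicat_real {0..1} t * B 0 - indicat_real {0..1} t * B t)) \<partial>lborel)"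
    using int_B by (intro integral_norm_bound_ennreal Bochner_Integration.integrable_diff) (auto simp: integrable_indicator_iff)
  also have "\<dots> \<le> (\<integral>\<^sup>+t. ennreal (norm z * b) * indicator {0..1::real} t \<partial>lborel)"
    using B_bound by (intro nn_integral_mono) (auto simp: indicator_def intro!: ennreal_leI)
  also have "\<dots> = ennreal (norm z * b)"
    by (simp add: nn_integral_cmult)
  finally have "\<bar>(LBINT x. (u (x + z) - u x) * \<phi> x) + B 0\<bar> \<le> norm z * b"
    unfolding eq using b(2) by (subst (asm) ennreal_le_iff) auto
  then show ?thesis
    by (simp only: B0)
qed

text \<open>
  Fubini's theorem turns the pairing into the integral of \<open>k z * A z\<close>, where \<open>A z\<close> is the pairing of the
  increment of \<open>u\<close> with \<open>\<phi>\<close>. Near the origin \<open>A z\<close> is close to \<open>- W \<bullet> z\<close>, and integrating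
  \<open>k z *\<^sub>R z\<close> gives \<open>a\<close> up to \<open>w\<close>.
\<close>
lemma nonlocal_pairing_error_le:
  fixes u \<phi> k :: "'a::euclidean_space \<Rightarrow> real" and g :: "'a \<Rightarrow> 'a" and a :: 'a
  assumes wg: "weak_gradient \<phi> g" and meas[measurable]: "u \<in> borel_measurable borel"
    "\<phi> \<in> borel_measurable borel" "g \<in> borel_measurable borel"
    and P\<phi>: "\<And>c. (\<integral>\<^sup>+x. ennreal (\<bar>u (x + c)\<bar> * \<bar>\<phi> x\<bar>) \<partial>lborel) \<le> ennreal C"
    and Pg: "\<And>c. abs_pairing (\<lambda>x. u (x + c)) g \<le> ennreal C" and C: "C \<ge> 0"
    and k: "integrable lborel k"
    and M: "abs_moment lborel k \<le> ennreal M" "M \<ge> 0"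
    and w: "tail_moment lborel d k \<le> ennreal w" "w \<ge> 0"
    and V: "norm ((LBINT z. k z *\<^sub>R z) - a) \<le> w"
    and e: "\<And>z. norm z < d \<Longrightarrow> abs_pairing (\<lambda>x. u (x + z) - u x) g \<le> ennreal e" "e \<ge> 0"
  shows "\<bar>(LBINT x. (LBINT z. (u (x + z) - u x) * k z) * \<phi> x) + (LBINT x. u x * (a \<bullet> g x))\<bar>
    \<le> M * e + w * (2 * C) + w * norm (LBINT x. u x *\<^sub>R g x)"
proof -
  have [measurable]: "k \<in> borel_measurable borel" using k by auto
  define A where "A z = (LBINT x. (u (x + z) - u x) * \<phi> x)" for z
  define W where "W = (LBINT x. u x *\<^sub>R g x)"
  define v where "v = (LBINT z. k z *\<^sub>R z)"
  have diff_bound: "(\<integral>\<^sup>+x. ennreal (\<bar>u (x + z) - u x\<bar> * f x) \<partial>lborel) \<le> ennreal (2 * C)"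
    if f: "\<And>c. (\<integral>\<^sup>+x. ennreal (\<bar>u (x + c)\<bar> * f x) \<partial>lborel) \<le> ennreal C" "\<And>x. f x \<ge> 0"
      and [measurable]: "f \<in> borel_measurable borel" for f z
  proof -
    have "(\<integral>\<^sup>+x. ennreal (\<bar>u (x + z) - u x\<bar> * f x) \<partial>lborel) \<le>
        (\<integral>\<^sup>+x. ennreal (\<bar>u (x + z)\<bar> * f x) + ennreal (\<bar>u (x + 0)\<bar> * f x) \<partial>lborel)"
    proof (intro nn_integral_mono)
      fix x
      have "\<bar>u (x + z) - u x\<bar> * f x \<le> (\<bar>u (x + z)\<bar> + \<bar>u x\<bar>) * f x"
        using f(2) by (intro mult_right_mono) auto
      then show "ennreal (\<bar>u (x + z) - u x\<bar> * f x) \<le> ennreal (\<bar>u (x + z)\<bar> * f x) + ennreal (\<bar>u (x + 0)\<bar> * f x)"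
        using f(2) by (simp add: distrib_right ennreal_leI flip: ennreal_plus)
    qed
    also have "\<dots> = (\<integral>\<^sup>+x. ennreal (\<bar>u (x + z)\<bar> * f x) \<partial>lborel) + (\<integral>\<^sup>+x. ennreal (\<bar>u (x + 0)\<bar> * f x) \<partial>lborel)"
      by (rule nn_integral_add) measurable
    also have "\<dots> \<le> ennreal C + ennreal C"
      by (intro add_mono f)
    finally show ?thesis using C by (simp flip: ennreal_plus)
  qed
  have mom: "integrable lborel (\<lambda>z. k z *\<^sub>R z)"
    by (rule integrable_kernel_moment[OF _ M(1)]) simp
  have W: "integrable lborel (\<lambda>x. u x *\<^sub>R g x)"
  proof (rule integrableI_bounded)
    show "(\<integral>\<^sup>+x. ennreal (norm (u x *\<^sub>R g x)) \<partial>lborel) < \<infinity>"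
      using Pg[of 0] by (simp add: le_less_trans)
  qed simp
  define F where "F z x = (u (x + z) - u x) * k z * \<phi> x" for z x
  have F_pair: "integrable (lborel \<Otimes>\<^sub>M lborel) (case_prod F)"
  proof (rule integrable_pairI)
    show "case_prod F \<in> borel_measurable (lborel \<Otimes>\<^sub>M lborel)"
      unfolding F_def[abs_def] by measurable
    have "(\<integral>\<^sup>+z. (\<integral>\<^sup>+x. ennreal \<bar>F z x\<bar> \<partial>lborel) \<partial>lborel) \<le>
        (\<integral>\<^sup>+z. ennreal \<bar>k z\<bar> * ennreal (2 * C) \<partial>lborel)"
    proof (intro nn_integral_mono)
      fix z
      have "(\<integral>\<^sup>+x. ennreal \<bar>F z x\<bar> \<partial>lborel) = (\<integral>\<^sup>+x. ennreal \<bar>k z\<bar> * ennreal (\<bar>u (x + z) - u x\<bar> * \<bar>\<phi> x\<bar>) \<partial>lborel)"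
        by (intro nn_integral_cong) (simp add: F_def abs_mult mult_ac flip: ennreal_mult')
      also have "\<dots> = ennreal \<bar>k z\<bar> * (\<integral>\<^sup>+x. ennreal (\<bar>u (x + z) - u x\<bar> * \<bar>\<phi> x\<bar>) \<partial>lborel)"
        by (rule nn_integral_cmult) measurable
      also have "\<dots> \<le> ennreal \<bar>k z\<bar> * ennreal (2 * C)"
        by (intro mult_left_mono diff_bound P\<phi>) auto
      finally show "(\<integral>\<^sup>+x. ennreal \<bar>F z x\<bar> \<partial>lborel) \<le> ennreal \<bar>k z\<bar> * ennreal (2 * C)" .
    qed
    also have "\<dots> = (\<integral>\<^sup>+z. ennreal \<bar>k z\<bar> \<partial>lborel) * ennreal (2 * C)"
      by (simp add: nn_integral_multc)
    also have "\<dots> < \<infinity>"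
      using k by (simp add: integrable_iff_bounded ennreal_mult_less_top)
    finally show "(\<integral>\<^sup>+z. (\<integral>\<^sup>+x. ennreal \<bar>F z x\<bar> \<partial>lborel) \<partial>lborel) < \<infinity>" .
  qed
  have F_int: "(LBINT x. F z x) = k z * A z" for z
    by (simp add: F_def A_def mult_ac flip: integral_mult_right_zero)
  have int_kA: "integrable lborel (\<lambda>z. k z * A z)"
    using lborel_pair.integrable_fst[OF F_pair] by (simp add: F_int)
  have int_kW: "integrable lborel (\<lambda>z. k z * (W \<bullet> z))"
    using integrable_inner_right[of W lborel "\<lambda>z. k z *\<^sub>R z"] mom by simp
  have "(LBINT x. (LBINT z. (u (x + z) - u x) * k z) * \<phi> x) = (LBINT x. (LBINT z. F z x))"
    by (simp add: F_def)
  also have "\<dots> = (LBINT z. (LBINT x. F z x))"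
    by (rule lborel_pair.Fubini_integral[OF F_pair])
  also have "\<dots> = (LBINT z. k z * A z)"
    by (simp add: F_int)
  also have "\<dots> = (LBINT z. k z * (A z + W \<bullet> z)) - (LBINT z. k z * (W \<bullet> z))"
    using int_kA int_kW by (simp add: distrib_left)
  also have "(LBINT z. k z * (W \<bullet> z)) = W \<bullet> v"
    using integral_inner_right[of W lborel "\<lambda>z. k z *\<^sub>R z"] mom by (simp add: v_def)
  finally have D: "(LBINT x. (LBINT z. (u (x + z) - u x) * k z) * \<phi> x) =
      (LBINT z. k z * (A z + W \<bullet> z)) - W \<bullet> v" .
  have E: "(LBINT x. u x * (a \<bullet> g x)) = W \<bullet> a"
    using integral_inner_left[of a lborel "\<lambda>x. u x *\<^sub>R g x"] W by (simp add: W_def inner_commute)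
  have first: "\<bar>LBINT z. k z * (A z + W \<bullet> z)\<bar> \<le> M * e + w * (2 * C)"
  proof -
    define \<tau> where "\<tau> z = ennreal (\<bar>A z + W \<bullet> z\<bar> / norm z)" for z
    have "ennreal (norm (LBINT z. k z * (A z + W \<bullet> z))) \<le> (\<integral>\<^sup>+z. ennreal (norm (k z * (A z + W \<bullet> z))) \<partial>lborel)"
      using int_kA int_kW by (intro integral_norm_bound_ennreal) (simp add: distrib_left)
    also have "\<dots> = (\<integral>\<^sup>+z. ennreal (\<bar>k z\<bar> * norm z) * \<tau> z \<partial>lborel)"
    proof (intro nn_integral_cong)
      fix z :: 'a
      have "A 0 = 0" by (simp add: A_def)
      then show "ennreal (norm (k z * (A z + W \<bullet> z))) = ennreal (\<bar>k z\<bar> * norm z) * \<tau> z"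
        by (cases "z = 0") (simp_all add: \<tau>_def abs_mult flip: ennreal_mult')
    qed
    also have "\<dots> \<le> ennreal (M * e + w * (2 * C))"
    proof (rule nn_integral_kernel_split[OF _ M w])
      fix z :: 'a assume z: "z \<noteq> 0"
      have le: "\<tau> z \<le> ennreal b" if b: "b \<ge> 0"
        "\<And>t. t \<in> {0..1} \<Longrightarrow> abs_pairing (\<lambda>x. u (x + t *\<^sub>R z) - u x) g \<le> ennreal b" for b
      proof -
        have "\<bar>A z + W \<bullet> z\<bar> \<le> norm z * b"
          unfolding A_def W_def by (rule increment_pairing_error_le[OF wg meas P\<phi> Pg b(2) b(1)])
        with z show ?thesis
          unfolding \<tau>_def by (intro ennreal_leI) (simp add: field_simps)
      qed
      show "\<tau> z \<le> ennreal e" if zd: "norm z < d"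
      proof (rule le[OF e(2)])
        fix t :: real assume "t \<in> {0..1}"
        then have "norm (t *\<^sub>R z) \<le> norm z" by (simp add: mult_left_le_one_le)
        then show "abs_pairing (\<lambda>x. u (x + t *\<^sub>R z) - u x) g \<le> ennreal e"
          using zd by (intro e) simp
      qed
      show "\<tau> z \<le> ennreal (2 * C)"
        by (intro le diff_bound Pg) (use C in auto)
    qed (use e C in auto)
    finally show ?thesis
      using M e w C by (subst (asm) ennreal_le_iff) auto
  qed
  have "\<bar>W \<bullet> (v - a)\<bar> \<le> norm W * norm (v - a)"
    by (rule Cauchy_Schwarz_ineq2)
  also have "\<dots> \<le> norm W * w"
    using V by (intro mult_left_mono) (auto simp: v_def)
  finally have second: "\<bar>W \<bullet> (v - a)\<bar> \<le> w * norm W"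
    by (simp add: mult.commute)
  have "(LBINT x. (LBINT z. (u (x + z) - u x) * k z) * \<phi> x) + (LBINT x. u x * (a \<bullet> g x)) =
      (LBINT z. k z * (A z + W \<bullet> z)) - W \<bullet> (v - a)"
    unfolding D E by (simp add: inner_diff_right)
  with first second show ?thesis
    unfolding W_def[symmetric] by linarith
qed

section \<open>Borel representatives and Lebesgue norms\<close>

text \<open>
  Completeness of the Lebesgue measure.
\<close>
lemma borel_measurable_lebesgue_AE:
  assumes f': "f' \<in> borel_measurable borel" and ae: "AE x in lborel. f x = f' x"
  shows "f \<in> borel_measurable lebesgue"
proof (rule measurableI)
  fix A :: "'b set" assume "A \<in> sets borel"
  then have 1: "f' -` A \<inter> space lebesgue \<in> sets lebesgue"
    using measurable_sets[OF f', of A] by (auto intro: sets_completionI_sets)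
  have 2: "AE x in lebesgue. x \<in> f' -` A \<inter> space lebesgue \<longleftrightarrow> x \<in> f -` A \<inter> space lebesgue"
    using ae by (auto simp: AE_completion_iff elim!: eventually_mono)
  show "f -` A \<inter> space lebesgue \<in> sets lebesgue"
    by (rule completion.in_sets_AE[OF 2 1]) simp
qed simp

lemma borel_representative:
  fixes f :: "'a::euclidean_space \<Rightarrow> 'b::euclidean_space"
  assumes f: "f \<in> borel_measurable lebesgue"
  obtains f' where "f' \<in> borel_measurable borel" "AE x in lborel. f x = f' x"
proof -
  have "\<exists>h. h \<in> borel_measurable lborel \<and> (AE x in lborel. f x \<bullet> i = h x)" for i
    using completion_ex_borel_measurable_real[of "\<lambda>x. f x \<bullet> i" lborel] f by auto
  then obtain h where h: "\<And>i. h i \<in> borel_measurable lborel" "\<And>i. AE x in lborel. f x \<bullet> i = h i x"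
    by metis
  have "AE x in lborel. \<forall>i\<in>Basis. f x \<bullet> i = h i x"
    using h(2) by (simp add: AE_finite_all)
  then have "AE x in lborel. f x = (\<Sum>i\<in>Basis. h i x *\<^sub>R i)"
  proof eventually_elim
    case (elim x)
    have "f x = (\<Sum>i\<in>Basis. (f x \<bullet> i) *\<^sub>R i)" by (simp add: euclidean_representation)
    with elim show ?case by simp
  qed
  moreover have "(\<lambda>x. \<Sum>i\<in>Basis. h i x *\<^sub>R i) \<in> borel_measurable borel"
    using h(1) by (auto intro!: borel_measurable_sum borel_measurable_scaleR)
  ultimately show ?thesis using that by blast
qed

lemma AE_lborel_translate:
  fixes P :: "'a::euclidean_space \<Rightarrow> bool"
  assumes "AE x in lborel. P x"
  shows "AE z in lborel. P (x + z)"
proof -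
  obtain N where N: "{y \<in> space lborel. \<not> P y} \<subseteq> N" "N \<in> null_sets lborel"
    using assms by (auto simp: eventually_ae_filter)
  show ?thesis
  proof (rule AE_I')
    show "{z. z - (- x) \<in> N} \<in> null_sets lborel"
      by (rule null_sets_translation[OF N(2)])
    show "{z \<in> space lborel. \<not> P (x + z)} \<subseteq> {z. z - (- x) \<in> N}"
      using N(1) by (auto simp: add.commute)
  qed
qed

lemma lebesgue_integral_cong_borel:
  fixes f :: "'a::euclidean_space \<Rightarrow> 'b::{banach, second_countable_topology}"
  assumes "AE x in lborel. f x = f' x" "f' \<in> borel_measurable borel"
  shows "integral\<^sup>L lebesgue f = integral\<^sup>L lborel f'"
    and "integrable lebesgue f \<longleftrightarrow> integrable lborel f'"
proof -
  have m: "f \<in> borel_measurable lebesgue" "f' \<in> borel_measurable lebesgue"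
    using assms by (auto intro: borel_measurable_lebesgue_AE measurable_completion)
  have ae: "AE x in lebesgue. f x = f' x"
    using assms(1) by (simp add: AE_completion_iff)
  show "integral\<^sup>L lebesgue f = integral\<^sup>L lborel f'"
    using integral_cong_AE[OF m ae] integral_completion[of f' lborel] assms(2) by simp
  show "integrable lebesgue f \<longleftrightarrow> integrable lborel f'"
    using integrable_cong_AE[OF m ae] integrable_completion[of f' lborel] assms(2) by simp
qed

lemma nn_integral_lebesgue_cong_borel:
  assumes "AE x in lborel. f x = f' x"
  shows "(\<integral>\<^sup>+x. F x (f x) \<partial>lebesgue) = (\<integral>\<^sup>+x. F x (f' x) \<partial>lborel)"
  unfolding nn_integral_completion by (intro nn_integral_cong_AE) (use assms in \<open>auto elim!: eventually_mono\<close>)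

text \<open>
  Changing \<open>u\<close> and \<open>k\<close> on null sets does not affect the integral defining the nonlocal
  derivative at \<open>x\<close>, provided that the value \<open>u x\<close> itself is unchanged. Borel representatives are
  needed because Fubini's theorem is applied to functions of \<open>x + z\<close> on product spaces.
\<close>
lemma nonlocal_deriv_borel:
  fixes u k :: "'a::euclidean_space \<Rightarrow> real"
  assumes u: "AE x in lborel. u x = u' x" "u' \<in> borel_measurable borel"
    and k: "AE x in lborel. k x = k' x" "k' \<in> borel_measurable borel"
  shows "AE x in lborel. nonlocal_deriv k u x = (LBINT z. (u' (x + z) - u' x) * k' z) \<and>
    (nonlocal_deriv_exists k u x \<longleftrightarrow> integrable lborel (\<lambda>z. (u' (x + z) - u' x) * k' z))"
  using u(1)
proof eventually_elim
  case (elim x)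
  have "AE z in lborel. (u (x + z) - u x) * k z = (u' (x + z) - u' x) * k' z"
    using AE_lborel_translate[OF u(1), of x] k(1)
    by eventually_elim (simp add: elim)
  moreover have "(\<lambda>z. (u' (x + z) - u' x) * k' z) \<in> borel_measurable borel"
    using u(2) k(2) by measurable
  ultimately show ?case
    unfolding nonlocal_deriv_def nonlocal_deriv_exists_def by (auto dest: lebesgue_integral_cong_borel)
qed

lemma weak_gradient_borel:
  fixes u :: "'a::euclidean_space \<Rightarrow> real"
  assumes wg: "weak_gradient u g"
    and u: "AE x in lborel. u x = u' x" "u' \<in> borel_measurable borel"
    and g: "AE x in lborel. g x = g' x" "g' \<in> borel_measurable borel"
  shows "weak_gradient u' g'"
proof -
  have li: "locally_integrable f'" if f: "locally_integrable f" "AE x in lborel. f x = f' x" "f' \<in> borel_measurable borel"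
    for f f' :: "'a \<Rightarrow> 'c::euclidean_space"
    unfolding locally_integrable_def set_integrable_def
  proof (intro allI impI)
    fix K :: "'a set" assume K: "compact K"
    then have [measurable]: "K \<in> sets borel" by (simp add: compact_imp_closed)
    have m: "(\<lambda>x. indicat_real K x *\<^sub>R f' x) \<in> borel_measurable borel"
      using f(3) by measurable
    have "integrable lebesgue (\<lambda>x. indicat_real K x *\<^sub>R f x)"
      using f(1) K by (simp add: locally_integrable_def set_integrable_def)
    moreover have ae: "AE x in lborel. indicat_real K x *\<^sub>R f x = indicat_real K x *\<^sub>R f' x"
      using f(2) by eventually_elim simp
    ultimately have "integrable lborel (\<lambda>x. indicat_real K x *\<^sub>R f' x)"
      by (simp only: lebesgue_integral_cong_borel(2)[OF ae m])
    then show "integrable lebesgue (\<lambda>x. indicat_real K x *\<^sub>R f' x)"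
      using m by (simp add: integrable_completion)
  qed
  have "(\<integral>x. u' x * partial_deriv i \<psi> x \<partial>lebesgue) = - (\<integral>x. (g' x \<bullet> i) * \<psi> x \<partial>lebesgue)"
    if \<psi>: "test_function \<psi>" and i: "i \<in> Basis" for \<psi> i
  proof -
    have [measurable]: "\<psi> \<in> borel_measurable borel" "partial_deriv i \<psi> \<in> borel_measurable borel"
      using \<psi> by (auto intro!: borel_measurable_continuous_onI test_function_continuous test_function_derivative_continuous)
    have m: "(\<lambda>x. u' x * partial_deriv i \<psi> x) \<in> borel_measurable borel"
      "(\<lambda>x. (g' x \<bullet> i) * \<psi> x) \<in> borel_measurable borel"
      using u(2) g(2) by measurable
    have "AE x in lborel. u x * partial_deriv i \<psi> x = u' x * partial_deriv i \<psi> x"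
      "AE x in lborel. (g x \<bullet> i) * \<psi> x = (g' x \<bullet> i) * \<psi> x"
      using u(1) g(1) by auto
    note eqs = lebesgue_integral_cong_borel(1)[OF this(1) m(1)] lebesgue_integral_cong_borel(1)[OF this(2) m(2)]
    have "(\<integral>x. u x * partial_deriv i \<psi> x \<partial>lebesgue) = - (\<integral>x. (g x \<bullet> i) * \<psi> x \<partial>lebesgue)"
      using wg \<psi> i unfolding weak_gradient_def by blast
    then show ?thesis
      using m unfolding eqs by (simp add: integral_completion)
  qed
  with wg li[of u u'] li[of g g'] u g show ?thesis
    unfolding weak_gradient_def by blast
qed

lemma Lp_iff:
  assumes "p < \<infinity>"
  shows "f \<in> Lp p \<longleftrightarrow> f \<in> borel_measurable lebesgue \<and> (\<integral>\<^sup>+x. ennreal (norm (f x) powr enn2real p) \<partial>lebesgue) < \<infinity>"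
  using assms by (auto simp: Lp_def Lp_norm_def Let_def less_top)

lemma Lp_borel_representative:
  fixes u :: "'a::euclidean_space \<Rightarrow> 'b::euclidean_space"
  assumes p: "p < \<infinity>" and u: "u \<in> Lp p"
  obtains u' where "u' \<in> borel_measurable borel" "AE x in lborel. u x = u' x"
    "lp_mass (enn2real p) u' < \<infinity>"
proof -
  have um: "u \<in> borel_measurable lebesgue" "(\<integral>\<^sup>+x. ennreal (norm (u x) powr enn2real p) \<partial>lebesgue) < \<infinity>"
    using u p by (auto simp: Lp_iff)
  obtain u' where u': "u' \<in> borel_measurable borel" "AE x in lborel. u x = u' x"
    using borel_representative[OF um(1)] by blast
  show ?thesis
    using um(2) nn_integral_lebesgue_cong_borel[OF u'(2), of "\<lambda>_ y. ennreal (norm y powr enn2real p)"]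
    by (intro that[OF u']) simp
qed

lemma Lp_norm_less:
  assumes p: "p < \<infinity>" "enn2real p > 0" and e: "e > 0"
    and I: "(\<integral>\<^sup>+x. ennreal (norm (f x) powr enn2real p) \<partial>lebesgue) \<le> ennreal ((e / 2) powr enn2real p)"
  shows "Lp_norm p f < ennreal e"
proof -
  let ?I = "\<integral>\<^sup>+x. ennreal (norm (f x) powr enn2real p) \<partial>lebesgue"
  obtain y where y: "?I = ennreal y" "y \<ge> 0"
    using I by (cases ?I) (auto simp: top_unique)
  have "y \<le> (e / 2) powr enn2real p"
    using I unfolding y(1) by (subst (asm) ennreal_le_iff) auto
  then have "y powr (1 / enn2real p) \<le> ((e / 2) powr enn2real p) powr (1 / enn2real p)"
    using y p by (intro powr_mono2) auto
  also have "\<dots> = e / 2"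
    using p e by (simp add: powr_powr)
  also have "\<dots> < e" using e by simp
  finally show ?thesis
    using p(1) y by (auto simp: Lp_norm_def Let_def ennreal_less_iff)
qed

lemma Lp_norm_pos:
  assumes p: "p < \<infinity>" and u: "u \<in> Lp p" and nz: "\<not> (AE x in lebesgue. u x = 0)"
  obtains c where "c > 0" "Lp_norm p u = ennreal c"
proof -
  let ?I = "\<integral>\<^sup>+x. ennreal (norm (u x) powr enn2real p) \<partial>lebesgue"
  have um: "u \<in> borel_measurable lebesgue" "?I < \<infinity>"
    using u p by (auto simp: Lp_iff)
  obtain y where y: "?I = ennreal y" "y \<ge> 0"
    using um(2) by (cases ?I) auto
  have "?I \<noteq> 0"
  proof
    assume "?I = 0"
    then have "AE x in lebesgue. ennreal (norm (u x) powr enn2real p) = 0"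
      using um(1) by (subst (asm) nn_integral_0_iff_AE) auto
    then have "AE x in lebesgue. u x = 0"
      by (auto elim!: eventually_mono simp: ennreal_eq_0_iff)
    with nz show False ..
  qed
  with y have "y > 0" by (cases "y = 0") auto
  then show ?thesis
    using y p by (intro that[of "y powr (1 / enn2real p)"]) (auto simp: Lp_norm_def Let_def)
qed

text \<open>
  The conjugate of \<open>p = 1\<close> is \<open>\<infinity>\<close>, where \<open>g\<close> is essentially bounded; for \<open>1 < p\<close> both exponents
  are finite and greater than \<open>1\<close>.
\<close>
lemma pairing_bounded_Lp_conjugate:
  fixes g :: "'a::euclidean_space \<Rightarrow> 'b::euclidean_space"
  assumes p: "1 \<le> p" "p < \<infinity>" and conj: "hoelder_conjugate p p'"
    and g: "g \<in> Lp p'" and g': "AE x in lborel. g x = g' x" "g' \<in> borel_measurable borel"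
  shows "pairing_bounded (enn2real p) g'"
proof -
  obtain r where r: "p = ennreal r" "r \<ge> 1"
    using p by (cases p) auto
  have ip: "inverse p = ennreal (1 / r)"
    using r by (simp add: inverse_ennreal divide_inverse)
  have sum: "ennreal (1 / r) + inverse p' = 1"
    using conj by (simp add: hoelder_conjugate_def ip)
  show ?thesis
  proof (cases p')
    case top
    have "Lp_norm p' g < \<infinity>" using g by (simp add: Lp_def)
    then have fin: "esssup lebesgue (\<lambda>x. ennreal (norm (g x))) < \<infinity>"
      using top by (simp add: Lp_norm_def)
    then obtain B where B: "esssup lebesgue (\<lambda>x. ennreal (norm (g x))) = ennreal B" "B \<ge> 0"
      by (cases "esssup lebesgue (\<lambda>x. ennreal (norm (g x)))") auto
    have "AE x in lborel. ennreal (norm (g x)) \<le> ennreal B"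
      using esssup_AE[of "\<lambda>x. ennreal (norm (g x))" lebesgue] by (simp add: B(1) AE_completion_iff)
    with g'(1) have "AE x in lborel. norm (g' x) \<le> B"
      by eventually_elim (use B(2) in \<open>simp add: ennreal_le_iff\<close>)
    moreover have "r = 1"
      using sum top r by (simp add: ennreal_1[symmetric] del: ennreal_1)
    ultimately show ?thesis
      using pairing_boundedI_bounded[of g' B] B r by simp
  next
    case (real q)
    have "q > 0"
    proof (rule ccontr)
      assume "\<not> q > 0"
      with real sum show False by simp
    qed
    then have "ennreal (1 / r) + ennreal (1 / q) = ennreal 1"
      using sum real by (simp add: inverse_ennreal divide_inverse)
    then have rq: "1 / r + 1 / q = 1"
      using r \<open>q > 0\<close> by (subst (asm) ennreal_plus[symmetric]) (auto simp del: ennreal_1 ennreal_plus)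
    have "1 / q > 0" using \<open>q > 0\<close> by simp
    then have "1 / r < 1" using rq by linarith
    then have "r > 1" using r by (simp add: divide_less_eq)
    then have "1 / r > 0" by simp
    then have "1 / q < 1" using rq by linarith
    then have "q > 1" using \<open>q > 0\<close> by (simp add: divide_less_eq)
    have "lp_mass q g' = (\<integral>\<^sup>+x. ennreal (norm (g x) powr q) \<partial>lebesgue)"
      using nn_integral_lebesgue_cong_borel[OF g'(1), of "\<lambda>_ y. ennreal (norm y powr q)"] by simp
    also have "\<dots> < \<infinity>"
      using g real by (simp add: Lp_iff)
    finally show ?thesis
      using pairing_boundedI_conjugate[OF g'(2) \<open>r > 1\<close> \<open>q > 1\<close> rq] r by simp
  qed
qed

lemma pairing_bounded_translates:
  fixes u :: "'a::euclidean_space \<Rightarrow> real"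
  assumes pb: "pairing_bounded r g" and [measurable]: "u \<in> borel_measurable borel" and N: "lp_mass r u = ennreal N" "N \<ge> 0"
  obtains C where "C \<ge> 0" "\<And>c. abs_pairing (\<lambda>x. u (x + c)) g \<le> ennreal C"
proof -
  obtain C where C: "C \<ge> 0" "\<And>f::'a \<Rightarrow> real. f \<in> borel_measurable borel \<Longrightarrow>
     abs_pairing f g \<le> ennreal C * lp_mass r f + ennreal 1"
    using pb unfolding pairing_bounded_def by (meson zero_less_one)
  have "abs_pairing (\<lambda>x. u (x + c)) g \<le> ennreal (C * N + 1)" for c
  proof -
    have "abs_pairing (\<lambda>x. u (x + c)) g \<le> ennreal C * lp_mass r (\<lambda>x. u (x + c)) + ennreal 1"
      by (rule C(2)) simp
    also have "lp_mass r (\<lambda>x. u (x + c)) = ennreal N"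
      using lp_mass_translate[where f=u and r=r and z=c] N by simp
    also have "ennreal C * ennreal N + ennreal 1 = ennreal (C * N + 1)"
      using C(1) N by (simp add: ennreal_mult ennreal_plus del: ennreal_1)
    finally show ?thesis .
  qed
  then show ?thesis
    using that[of "C * N + 1"] C(1) N by simp
qed

lemma pairing_bounded_translation_continuous:
  fixes u :: "'a::euclidean_space \<Rightarrow> real"
  assumes pb: "pairing_bounded r g" and [measurable]: "u \<in> borel_measurable borel"
    and u: "lp_mass r u < \<infinity>" and r: "r \<ge> 1" and e: "e > 0"
  shows "\<forall>\<^sub>F z in nhds 0. abs_pairing (\<lambda>x. u (x + z) - u x) g \<le> ennreal e"
proof -
  have "e / 2 > 0" using e by simp
  then obtain C where C: "C \<ge> 0" "\<And>f::'a \<Rightarrow> real. f \<in> borel_measurable borel \<Longrightarrow>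
     abs_pairing f g \<le> ennreal C * lp_mass r f + ennreal (e / 2)"
    using pb unfolding pairing_bounded_def by meson
  have "e / (2 * (C + 1)) > 0" using e C(1) by simp
  from translation_continuous_Lp[OF assms(2) u r this] show ?thesis
  proof eventually_elim
    case (elim z)
    have "abs_pairing (\<lambda>x. u (x + z) - u x) g \<le>
        ennreal C * lp_mass r (\<lambda>x. u (x + z) - u x) + ennreal (e / 2)"
      by (rule C(2)) simp
    also have "\<dots> \<le> ennreal C * ennreal (e / (2 * (C + 1))) + ennreal (e / 2)"
      by (intro add_right_mono mult_left_mono elim) simp
    also have "\<dots> = ennreal (C * (e / (2 * (C + 1))) + e / 2)"
      using C(1) e by (simp only: ennreal_mult ennreal_plus mult_nonneg_nonneg divide_nonneg_nonneg
          less_imp_le add_nonneg_nonneg zero_le_numeral zero_le_one)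
    also have "\<dots> \<le> ennreal e"
    proof (rule ennreal_leI)
      have "C * (e / (2 * (C + 1))) \<le> (C + 1) * (e / (2 * (C + 1)))"
        using C(1) e by (intro mult_right_mono) auto
      also have "\<dots> = e / 2" using C(1) by (simp add: divide_simps)
      finally show "C * (e / (2 * (C + 1))) + e / 2 \<le> e" by linarith
    qed
    finally show ?case .
  qed
qed

section \<open>Estimates for a single kernel\<close>

lemma kernel_representative:
  fixes k :: "'a::euclidean_space \<Rightarrow> real"
  assumes k: "integrable lebesgue k"
    and M: "abs_moment lebesgue k \<le> ennreal M"
    and w: "tail_moment lebesgue d k \<le> ennreal w"
    and V: "norm ((\<integral>z. k z *\<^sub>R z \<partial>lebesgue) - a) \<le> w"
  obtains k' where "AE z in lborel. k z = k' z" "k' \<in> borel_measurable borel" "integrable lborel k'"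
    "abs_moment lborel k' \<le> ennreal M"
    "tail_moment lborel d k' \<le> ennreal w"
    "norm ((LBINT z. k' z *\<^sub>R z) - a) \<le> w"
proof -
  obtain k' where k': "k' \<in> borel_measurable borel" "AE z in lborel. k z = k' z"
    using k by (blast intro: borel_representative)
  have "AE z in lborel. k z *\<^sub>R z = k' z *\<^sub>R z"
    using k'(2) by eventually_elim simp
  moreover have "(\<lambda>z. k' z *\<^sub>R z) \<in> borel_measurable borel"
    using k'(1) by measurable
  ultimately have eq: "(\<integral>z. k z *\<^sub>R z \<partial>lebesgue) = (LBINT z. k' z *\<^sub>R z)"
    by (rule lebesgue_integral_cong_borel(1))
  show ?thesis
  proof (rule that[OF k'(2,1)])
    show "integrable lborel k'"
      using lebesgue_integral_cong_borel(2)[OF k'(2,1)] k by simp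
    show "abs_moment lborel k' \<le> ennreal M"
      using M nn_integral_lebesgue_cong_borel[OF k'(2), of "\<lambda>z y. ennreal (\<bar>y\<bar> * norm z)"] by simp
    show "tail_moment lborel d k' \<le> ennreal w"
      using w nn_integral_lebesgue_cong_borel[OF k'(2),
          of "\<lambda>z y. ennreal (\<bar>y\<bar> * norm z) * indicator (- ball 0 d) z"] by simp
    show "norm ((LBINT z. k' z *\<^sub>R z) - a) \<le> w"
      using V by (simp add: eq)
  qed
qed

lemma modulus_tendsto_0:
  assumes "continuous_on {0..} \<omega>" "\<omega> 0 = (0::real)"
  shows "(\<omega> \<longlongrightarrow> 0) (at_right (0::real))"
proof -
  have "(\<omega> \<longlongrightarrow> \<omega> 0) (at 0 within {0..})"
    using assms(1) by (simp add: continuous_on)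
  then have "(\<omega> \<longlongrightarrow> \<omega> 0) (at_right 0)"
    by (rule tendsto_within_subset) auto
  with assms(2) show ?thesis by simp
qed

proposition nonlocal_deriv_Lp:
  fixes u k :: "'a::euclidean_space \<Rightarrow> real"
  assumes p: "1 \<le> p" "p < \<infinity>" and k: "integrable lebesgue k" and u: "u \<in> Lp p"
  shows "(AE x in lebesgue. nonlocal_deriv_exists k u x) \<and> nonlocal_deriv k u \<in> Lp p"
proof -
  have r: "enn2real p \<ge> 1"
    using p by (cases p) auto
  obtain u' where u': "u' \<in> borel_measurable borel" "AE x in lborel. u x = u' x"
    and fin: "lp_mass (enn2real p) u' < \<infinity>"
    using Lp_borel_representative[OF p(2) u] by blast
  have km: "k \<in> borel_measurable lebesgue" using k by auto
  obtain k' where k': "k' \<in> borel_measurable borel" "AE x in lborel. k x = k' x"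
    using borel_representative[OF km] by blast
  have k'_int: "integrable lborel k'"
    using lebesgue_integral_cong_borel(2)[OF k'(2,1)] k by simp
  define D where "D x = (LBINT z. (u' (x + z) - u' x) * k' z)" for x
  have Dm: "D \<in> borel_measurable borel"
    unfolding D_def[abs_def] using u'(1) k'(1) by measurable
  note nb = nonlocal_deriv_borel[OF u'(2,1) k'(2,1), folded D_def]
  have "AE x in lborel. nonlocal_deriv_exists k u x"
    using nb AE_integrable_nonlocal[OF u'(1) k'_int r fin] by eventually_elim simp
  then have 1: "AE x in lebesgue. nonlocal_deriv_exists k u x"
    by (simp add: AE_completion_iff)
  have ae: "AE x in lborel. nonlocal_deriv k u x = D x"
    using nb by eventually_elim simp
  have "lp_mass (enn2real p) D < \<infinity>"
    unfolding D_def by (rule lp_mass_nonlocal_finite[OF u'(1) k'_int r fin])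
  then have "nonlocal_deriv k u \<in> Lp p"
    using p borel_measurable_lebesgue_AE[OF Dm ae]
      nn_integral_lebesgue_cong_borel[OF ae, of "\<lambda>_ y. ennreal (norm y powr enn2real p)"]
    by (simp add: Lp_iff)
  with 1 show ?thesis by blast
qed

text \<open>
  The open sets on which \<open>f\<close> vanishes almost everywhere may be uncountably many; by Lindeloef's
  theorem countably many of them have the same union.
\<close>
lemma AE_zero_outside_ess_support:
  assumes "ess_support f \<subseteq> S"
  shows "AE x in lebesgue. x \<notin> S \<longrightarrow> f x = 0"
proof -
  let ?F = "{U. open U \<and> (AE x in lebesgue. x \<in> U \<longrightarrow> f x = 0)}"
  obtain F' where F': "F' \<subseteq> ?F" "countable F'" "\<Union>F' = \<Union>?F"
    using Lindelof[of ?F] by blast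
  have "AE x in lebesgue. \<forall>U\<in>F'. x \<in> U \<longrightarrow> f x = 0"
    using F'(1,2) by (subst AE_ball_countable) auto
  then show ?thesis
  proof eventually_elim
    case (elim x)
    show ?case
    proof
      assume "x \<notin> S"
      with assms have "x \<in> \<Union>?F" unfolding ess_support_def by blast
      then have "x \<in> \<Union>F'" unfolding F'(3) .
      with elim show "f x = 0" by blast
    qed
  qed
qed

text \<open>
  By the mean value theorem the increment is \<open>z \<bullet> G y\<close> for some \<open>y\<close> on the segment, which has
  distance at most \<open>norm z\<close> from \<open>x\<close>.
\<close>
lemma hoelder_gradient_remainder:
  fixes u :: "'a::euclidean_space \<Rightarrow> real"
  assumes G: "\<And>x. GDERIV u x :> G x" and \<alpha>: "\<alpha> > 0"
    and L: "\<And>x y. norm (G x - G y) \<le> L * norm (x - y) powr \<alpha>" "L \<ge> 0"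
  shows "\<bar>u (x + z) - u x - G x \<bullet> z\<bar> \<le> L * norm z powr \<alpha> * norm z"
proof -
  have "\<exists>t\<in>{0<..<1}. u (x + 1 *\<^sub>R z) - u (x + 0 *\<^sub>R z) = (1 - 0) *\<^sub>R z \<bullet> G (x + t *\<^sub>R z)"
  proof (rule mvt_simple[where f="\<lambda>t. u (x + t *\<^sub>R z)" and f'="\<lambda>t s. s *\<^sub>R z \<bullet> G (x + t *\<^sub>R z)"])
    fix t :: real
    have "((\<lambda>t. u (x + t *\<^sub>R z)) has_derivative (\<lambda>s. s *\<^sub>R z \<bullet> G (x + t *\<^sub>R z))) (at t)"
    proof (rule has_derivative_compose[where f="\<lambda>t. x + t *\<^sub>R z" and f'="\<lambda>s. s *\<^sub>R z" and g=u])
      show "((\<lambda>t. x + t *\<^sub>R z) has_derivative (\<lambda>s. s *\<^sub>R z)) (at t)"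
        by (auto intro!: derivative_eq_intros)
      show "(u has_derivative (\<lambda>h. h \<bullet> G (x + t *\<^sub>R z))) (at (x + t *\<^sub>R z))"
        using G[of "x + t *\<^sub>R z"] by (simp add: gderiv_def)
    qed
    then show "((\<lambda>t. u (x + t *\<^sub>R z)) has_derivative (\<lambda>s. s *\<^sub>R z \<bullet> G (x + t *\<^sub>R z))) (at t within {0..1})"
      by (rule has_derivative_at_withinI)
  qed simp
  then obtain t where t: "t \<in> {0<..<1}" "u (x + z) - u x = z \<bullet> G (x + t *\<^sub>R z)"
    by auto
  have "\<bar>u (x + z) - u x - G x \<bullet> z\<bar> = \<bar>z \<bullet> (G (x + t *\<^sub>R z) - G x)\<bar>"
    unfolding t(2) by (simp add: inner_diff_right inner_commute)
  also have "\<dots> \<le> norm z * norm (G (x + t *\<^sub>R z) - G x)"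
    by (rule Cauchy_Schwarz_ineq2)
  also have "\<dots> \<le> norm z * (L * norm (t *\<^sub>R z) powr \<alpha>)"
    using L(1)[of "x + t *\<^sub>R z" x] by (intro mult_left_mono) auto
  also have "\<dots> \<le> norm z * (L * norm z powr \<alpha>)"
    using t(1) \<alpha> L(2) by (intro mult_left_mono powr_mono2) (auto simp: mult_left_le_one_le)
  finally show ?thesis by (simp add: mult_ac)
qed

text \<open>
  On the support of the kernel \<open>norm z \<le> d\<close>, so the remainder of the Taylor expansion is at most
  \<open>L * d powr \<alpha> * norm z\<close>, and its integral is controlled by the first absolute moment. The second
  term of the bound is the error of the first moment.
\<close>
proposition nonlocal_deriv_hoelder_rate:
  fixes u k :: "'a::euclidean_space \<Rightarrow> real"
  assumes G: "\<And>x. GDERIV u x :> G x" and \<alpha>: "\<alpha> > 0"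
    and L: "\<And>x y. norm (G x - G y) \<le> L * norm (x - y) powr \<alpha>" "L \<ge> 0"
    and k: "integrable lebesgue k" and d: "d > 0"
    and supp: "ess_support k \<subseteq> cball 0 d"
    and M: "abs_moment lebesgue k \<le> ennreal M" "M \<ge> 0"
    and V: "norm ((\<integral>z. k z *\<^sub>R z \<partial>lebesgue) - a) \<le> w"
  shows "nonlocal_deriv_exists k u x"
    and "\<bar>nonlocal_deriv k u x - a \<bullet> G x\<bar> \<le> L * M * d powr \<alpha> + w * norm (G x)"
proof -
  have "continuous_on UNIV u"
    using G unfolding gderiv_def
    by (intro continuous_at_imp_continuous_on ballI) (blast intro: has_derivative_continuous)
  then have u: "u \<in> borel_measurable borel"
    by (rule borel_measurable_continuous_onI)
  then have "(\<lambda>z. u (x + z) - u x) \<in> borel_measurable borel" by measurable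
  then have um: "(\<lambda>z. u (x + z) - u x) \<in> borel_measurable lebesgue"
    by (intro measurable_completion) simp
  have km: "k \<in> borel_measurable lebesgue" using k by auto
  have idm: "(\<lambda>z::'a. z) \<in> borel_measurable lebesgue"
    by (rule measurable_completion) simp
  note rem = hoelder_gradient_remainder[OF G \<alpha> L]
  have zero: "AE z in lebesgue. z \<notin> cball 0 d \<longrightarrow> k z = 0"
    by (rule AE_zero_outside_ess_support[OF supp])
  define B where "B = L * d powr \<alpha> * d + norm (G x) * d"
  have B: "\<bar>u (x + z) - u x\<bar> \<le> B" if z: "z \<in> cball 0 d" for z
  proof -
    have "\<bar>G x \<bullet> z\<bar> \<le> norm (G x) * norm z" by (rule Cauchy_Schwarz_ineq2)
    also have "\<dots> \<le> norm (G x) * d" using z by (intro mult_left_mono) auto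
    finally have 1: "\<bar>G x \<bullet> z\<bar> \<le> norm (G x) * d" .
    have "L * norm z powr \<alpha> * norm z \<le> L * d powr \<alpha> * d"
      using z \<alpha> L(2) by (intro mult_mono powr_mono2) auto
    with rem[of x z] 1 show ?thesis unfolding B_def by linarith
  qed
  have B0: "B \<ge> 0" using d L(2) by (simp add: B_def)
  have int: "integrable lebesgue (\<lambda>z. (u (x + z) - u x) * k z)"
  proof (rule Bochner_Integration.integrable_bound)
    show "integrable lebesgue (\<lambda>z. B * k z)" using k by simp
    show "AE z in lebesgue. norm ((u (x + z) - u x) * k z) \<le> norm (B * k z)"
      using zero
    proof eventually_elim
      case (elim z)
      show ?case
        using elim B[of z] B0 by (cases "z \<in> cball 0 d") (auto simp: abs_mult intro!: mult_right_mono)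
    qed
  qed (use um km in measurable)
  then show "nonlocal_deriv_exists k u x"
    by (simp add: nonlocal_deriv_exists_def)
  have mom: "integrable lebesgue (\<lambda>z. k z *\<^sub>R z)"
  proof (rule integrableI_bounded)
    show "(\<integral>\<^sup>+z. ennreal (norm (k z *\<^sub>R z)) \<partial>lebesgue) < \<infinity>"
      using M(1) by (simp add: le_less_trans)
  qed (use km idm in measurable)
  define v where "v = (\<integral>z. k z *\<^sub>R z \<partial>lebesgue)"
  have int2: "integrable lebesgue (\<lambda>z. (G x \<bullet> z) * k z)"
    using integrable_inner_right[of "G x" lebesgue "\<lambda>z. k z *\<^sub>R z"] mom by (simp add: mult.commute)
  have v: "(\<integral>z. (G x \<bullet> z) * k z \<partial>lebesgue) = G x \<bullet> v"
    using integral_inner_right[of "G x" lebesgue "\<lambda>z. k z *\<^sub>R z"] mom by (simp add: v_def mult.commute)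
  define h where "h z = (u (x + z) - u x) * k z - (G x \<bullet> z) * k z" for z
  have h: "integrable lebesgue h" unfolding h_def[abs_def] using int int2 by simp
  have split: "nonlocal_deriv k u x - a \<bullet> G x = (\<integral>z. h z \<partial>lebesgue) + G x \<bullet> (v - a)"
    using int int2 v by (simp add: h_def nonlocal_deriv_def inner_diff_right inner_commute)
  have "ennreal (norm (\<integral>z. h z \<partial>lebesgue)) \<le> (\<integral>\<^sup>+z. ennreal (norm (h z)) \<partial>lebesgue)"
    by (rule integral_norm_bound_ennreal[OF h])
  also have "\<dots> \<le> (\<integral>\<^sup>+z. ennreal (L * d powr \<alpha>) * ennreal (\<bar>k z\<bar> * norm z) \<partial>lebesgue)"
  proof (rule nn_integral_mono_AE)
    show "AE z in lebesgue. ennreal (norm (h z)) \<le> ennreal (L * d powr \<alpha>) * ennreal (\<bar>k z\<bar> * norm z)"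
      using zero
    proof eventually_elim
      case (elim z)
      show ?case
      proof (cases "z \<in> cball 0 d")
        case True
        have "norm (h z) = \<bar>u (x + z) - u x - G x \<bullet> z\<bar> * \<bar>k z\<bar>"
          by (simp add: h_def abs_mult flip: left_diff_distrib)
        also have "\<dots> \<le> L * norm z powr \<alpha> * norm z * \<bar>k z\<bar>"
          by (intro mult_right_mono rem) simp
        also have "\<dots> \<le> L * d powr \<alpha> * norm z * \<bar>k z\<bar>"
          using True \<alpha> L(2) by (intro mult_right_mono mult_left_mono powr_mono2) auto
        finally show ?thesis
          using L(2) by (simp add: mult_ac ennreal_leI flip: ennreal_mult')
      next
        case False
        with elim show ?thesis by (simp add: h_def)
      qed
    qed
  qed
  also have "\<dots> = ennreal (L * d powr \<alpha>) * abs_moment lebesgue k"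
    by (rule nn_integral_cmult) (use km idm in measurable)
  also have "\<dots> \<le> ennreal (L * d powr \<alpha>) * ennreal M"
    by (intro mult_left_mono M) simp
  also have "\<dots> = ennreal (L * d powr \<alpha> * M)"
    using L(2) M(2) by (intro ennreal_mult[symmetric]) auto
  finally have first: "\<bar>\<integral>z. h z \<partial>lebesgue\<bar> \<le> L * M * d powr \<alpha>"
    using L(2) M(2) by (subst (asm) ennreal_le_iff) (auto simp: mult_ac)
  have "\<bar>G x \<bullet> (v - a)\<bar> \<le> norm (G x) * norm (v - a)"
    by (rule Cauchy_Schwarz_ineq2)
  also have "\<dots> \<le> norm (G x) * w"
    using V by (intro mult_left_mono) (auto simp: v_def)
  finally have "\<bar>G x \<bullet> (v - a)\<bar> \<le> w * norm (G x)"
    by (simp add: mult.commute)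
  with first show "\<bar>nonlocal_deriv k u x - a \<bullet> G x\<bar> \<le> L * M * d powr \<alpha> + w * norm (G x)"
    unfolding split by linarith
qed

section \<open>Families of kernels\<close>

lemma bounded_momentsE:
  assumes "bounded_moments \<mu>"
  obtains M where "M \<ge> 0" "\<And>\<delta>. \<delta> > 0 \<Longrightarrow> abs_moment lebesgue (\<mu> \<delta>) \<le> ennreal M"
proof -
  obtain M where M: "\<And>\<delta>. \<delta> > 0 \<Longrightarrow> abs_moment lebesgue (\<mu> \<delta>) < ennreal M"
    using assms unfolding bounded_moments_def by blast
  have "ennreal M \<le> ennreal (max M 0)" by (intro ennreal_leI) simp
  show ?thesis
  proof (rule that[of "max M 0"])
    fix \<delta> :: real assume "\<delta> > 0"
    from less_imp_le[OF M[OF this]] \<open>ennreal M \<le> ennreal (max M 0)\<close>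
    show "abs_moment lebesgue (\<mu> \<delta>) \<le> ennreal (max M 0)"
      by (rule order_trans)
  qed simp
qed

text \<open>
  The error bound of \<open>nonlocal_pairing_error_le\<close> is \<open>M * e\<close> plus a multiple of \<open>\<omega> \<delta>\<close>. The threshold for
  \<open>\<delta>\<close> depends on \<open>u\<close> through the rate at which its translates converge.
\<close>
proposition nonlocal_deriv_weak_convergence:
  fixes \<mu> :: "real \<Rightarrow> 'a::euclidean_space \<Rightarrow> real" and a :: 'a and \<omega> :: "real \<Rightarrow> real"
  assumes \<mu>: "\<And>\<delta>. \<delta> > 0 \<Longrightarrow> integrable lebesgue (\<mu> \<delta>)"
    and \<omega>: "continuous_on {0..} \<omega>" "\<omega> 0 = 0" "\<And>\<delta>. \<delta> \<ge> 0 \<Longrightarrow> \<omega> \<delta> \<ge> 0"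
    and p: "1 \<le> p" "p < \<infinity>" and conj: "hoelder_conjugate p p'"
    and bm: "bounded_moments \<mu>" and mc: "moments_converge \<mu> a \<omega>" and mt: "moments_concentrate \<mu> \<omega>"
    and u: "u \<in> Lp p" and \<phi>: "\<phi> \<in> Lp p'" and g: "g \<in> Lp p'" and wg: "weak_gradient \<phi> g"
    and \<epsilon>: "\<epsilon> > 0"
  shows "\<exists>\<delta>\<^sub>\<epsilon>>0. \<forall>\<delta>. 0 < \<delta> \<and> \<delta> < \<delta>\<^sub>\<epsilon> \<longrightarrow>
    \<bar>(\<integral>x. nonlocal_deriv (\<mu> \<delta>) u x * \<phi> x \<partial>lebesgue) + (\<integral>x. u x * (a \<bullet> g x) \<partial>lebesgue)\<bar> \<le> \<epsilon>"
proof -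
  let ?r = "enn2real p"
  have r: "?r \<ge> 1" using p by (cases p) auto
  obtain u' where u': "u' \<in> borel_measurable borel" "AE x in lborel. u x = u' x"
    and fin: "lp_mass ?r u' < \<infinity>"
    using Lp_borel_representative[OF p(2) u] by blast
  have \<phi>m: "\<phi> \<in> borel_measurable lebesgue" and gm: "g \<in> borel_measurable lebesgue"
    using \<phi> g by (auto simp: Lp_def)
  obtain \<phi>' where \<phi>': "\<phi>' \<in> borel_measurable borel" "AE x in lborel. \<phi> x = \<phi>' x"
    using borel_representative[OF \<phi>m] by blast
  obtain g' where g': "g' \<in> borel_measurable borel" "AE x in lborel. g x = g' x"
    using borel_representative[OF gm] by blast
  have wg': "weak_gradient \<phi>' g'"
    by (rule weak_gradient_borel[OF wg \<phi>'(2,1) g'(2,1)])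
  obtain N where N: "lp_mass ?r u' = ennreal N" "N \<ge> 0"
    using fin by (cases "lp_mass ?r u'") auto
  have pb\<phi>: "pairing_bounded ?r \<phi>'" by (rule pairing_bounded_Lp_conjugate[OF p conj \<phi> \<phi>'(2,1)])
  have pbg: "pairing_bounded ?r g'" by (rule pairing_bounded_Lp_conjugate[OF p conj g g'(2,1)])
  obtain C1 where C1: "C1 \<ge> 0" "\<And>c. (\<integral>\<^sup>+x. ennreal (\<bar>u' (x + c)\<bar> * norm (\<phi>' x)) \<partial>lborel) \<le> ennreal C1"
    using pairing_bounded_translates[OF pb\<phi> u'(1) N] by blast
  obtain C2 where C2: "C2 \<ge> 0" "\<And>c. abs_pairing (\<lambda>x. u' (x + c)) g' \<le> ennreal C2"
    using pairing_bounded_translates[OF pbg u'(1) N] by blast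
  define C where "C = max C1 C2"
  have le: "ennreal C1 \<le> ennreal C" "ennreal C2 \<le> ennreal C"
    by (auto simp: C_def intro!: ennreal_leI)
  have C: "C \<ge> 0" "\<And>c. (\<integral>\<^sup>+x. ennreal (\<bar>u' (x + c)\<bar> * \<bar>\<phi>' x\<bar>) \<partial>lborel) \<le> ennreal C"
    "\<And>c. abs_pairing (\<lambda>x. u' (x + c)) g' \<le> ennreal C"
    using C1 order_trans[OF C2(2) le(2)] order_trans[OF C1(2) le(1)] by (auto simp: C_def)
  obtain M where M: "M \<ge> 0" "\<And>\<delta>. \<delta> > 0 \<Longrightarrow> abs_moment lebesgue (\<mu> \<delta>) \<le> ennreal M"
    using bounded_momentsE[OF bm] by blast
  define e where "e = \<epsilon> / (2 * (M + 1))"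
  have e: "e > 0" "M * e \<le> \<epsilon> / 2"
    using \<epsilon> M(1) by (auto simp: e_def divide_simps)
  obtain d where d: "d > 0" "\<forall>z. dist z 0 < d \<longrightarrow> abs_pairing (\<lambda>x. u' (x + z) - u' x) g' \<le> ennreal e"
    using pairing_bounded_translation_continuous[OF pbg u'(1) fin r e(1)]
    unfolding eventually_nhds_metric by (elim exE conjE) (rule that)
  define W where "W = (LBINT x. u' x *\<^sub>R g' x)"
  have "((\<lambda>\<delta>. \<omega> \<delta> * (2 * C) + \<omega> \<delta> * norm W) \<longlongrightarrow> 0 * (2 * C) + 0 * norm W) (at_right 0)"
    by (intro tendsto_intros modulus_tendsto_0 \<omega>)
  then have "\<forall>\<^sub>F \<delta> in at_right 0. \<omega> \<delta> * (2 * C) + \<omega> \<delta> * norm W < \<epsilon> / 2"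
    using \<epsilon> by (intro order_tendstoD) auto
  then obtain d' where d': "d' > 0" "\<And>\<delta>. \<delta> > 0 \<Longrightarrow> \<delta> < d' \<Longrightarrow> \<omega> \<delta> * (2 * C) + \<omega> \<delta> * norm W < \<epsilon> / 2"
    unfolding eventually_at_right_field by blast
  have "\<bar>(\<integral>x. nonlocal_deriv (\<mu> \<delta>) u x * \<phi> x \<partial>lebesgue) + (\<integral>x. u x * (a \<bullet> g x) \<partial>lebesgue)\<bar> \<le> \<epsilon>"
    if \<delta>: "0 < \<delta>" "\<delta> < min d d'" for \<delta>
  proof -
    have tail: "tail_moment lebesgue \<delta> (\<mu> \<delta>) \<le> ennreal (\<omega> \<delta>)"
      and V: "norm ((\<integral>z. \<mu> \<delta> z *\<^sub>R z \<partial>lebesgue) - a) \<le> \<omega> \<delta>"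
      using mt mc \<delta>(1) unfolding moments_concentrate_def moments_converge_def by blast+
    obtain k where k: "AE z in lborel. \<mu> \<delta> z = k z" "k \<in> borel_measurable borel" "integrable lborel k"
      "abs_moment lborel k \<le> ennreal M"
      "tail_moment lborel \<delta> k \<le> ennreal (\<omega> \<delta>)"
      "norm ((LBINT z. k z *\<^sub>R z) - a) \<le> \<omega> \<delta>"
      by (rule kernel_representative[OF \<mu>[OF \<delta>(1)] M(2)[OF \<delta>(1)] tail V]) (rule that)
    define D where "D x = (LBINT z. (u' (x + z) - u' x) * k z)" for x
    have Dm: "D \<in> borel_measurable borel"
      unfolding D_def[abs_def] using u'(1) k(2) by measurable
    have "AE x in lborel. nonlocal_deriv (\<mu> \<delta>) u x = D x"
      using nonlocal_deriv_borel[OF u'(2,1) k(1,2), folded D_def] by eventually_elim simp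
    with \<phi>'(2) have "AE x in lborel. nonlocal_deriv (\<mu> \<delta>) u x * \<phi> x = D x * \<phi>' x"
      by eventually_elim simp
    moreover have "(\<lambda>x. D x * \<phi>' x) \<in> borel_measurable borel"
      using Dm \<phi>'(1) by measurable
    ultimately have 1: "(\<integral>x. nonlocal_deriv (\<mu> \<delta>) u x * \<phi> x \<partial>lebesgue) = (LBINT x. D x * \<phi>' x)"
      by (rule lebesgue_integral_cong_borel(1))
    have "AE x in lborel. u x * (a \<bullet> g x) = u' x * (a \<bullet> g' x)"
      using u'(2) g'(2) by eventually_elim simp
    moreover have "(\<lambda>x. u' x * (a \<bullet> g' x)) \<in> borel_measurable borel"
      using u'(1) g'(1) by measurable
    ultimately have 2: "(\<integral>x. u x * (a \<bullet> g x) \<partial>lebesgue) = (LBINT x. u' x * (a \<bullet> g' x))"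
      by (rule lebesgue_integral_cong_borel(1))
    have "\<bar>(LBINT x. D x * \<phi>' x) + (LBINT x. u' x * (a \<bullet> g' x))\<bar>
        \<le> M * e + \<omega> \<delta> * (2 * C) + \<omega> \<delta> * norm W"
      unfolding D_def W_def
    proof (rule nonlocal_pairing_error_le[OF wg' u'(1) \<phi>'(1) g'(1) C(2,3,1) k(3,4) M(1) k(5) _ k(6)])
      show "abs_pairing (\<lambda>x. u' (x + z) - u' x) g' \<le> ennreal e" if "norm z < \<delta>" for z
        using that \<delta> d(2) by simp
    qed (use \<omega>(3) \<delta> e in auto)
    also have "\<dots> \<le> \<epsilon>"
      using e(2) d'(2)[of \<delta>] \<delta> by auto
    finally show ?thesis unfolding 1 2 .
  qed
  then show ?thesis
    using d(1) d'(1) by (intro exI[of _ "min d d'"]) auto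
qed

text \<open>
  In the error bound of \<open>lp_mass_nonlocal_error_le\<close>, let \<open>w = \<omega> \<delta>\<close> tend to \<open>0\<close> for fixed \<open>e\<close>; the
  limit is proportional to \<open>e\<close>.
\<close>
proposition nonlocal_deriv_Lp_convergence:
  fixes \<mu> :: "real \<Rightarrow> 'a::euclidean_space \<Rightarrow> real" and a :: 'a and \<omega> :: "real \<Rightarrow> real"
  assumes \<mu>: "\<And>\<delta>. \<delta> > 0 \<Longrightarrow> integrable lebesgue (\<mu> \<delta>)"
    and \<omega>: "continuous_on {0..} \<omega>" "\<omega> 0 = 0" "\<And>\<delta>. \<delta> \<ge> 0 \<Longrightarrow> \<omega> \<delta> \<ge> 0"
    and p: "1 \<le> p" "p < \<infinity>"
    and bm: "bounded_moments \<mu>" and mc: "moments_converge \<mu> a \<omega>" and mt: "moments_concentrate \<mu> \<omega>"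
    and u: "u \<in> Lp p" and g: "g \<in> Lp p" and wg: "weak_gradient u g"
    and \<epsilon>: "\<epsilon> > 0"
  shows "\<exists>\<delta>\<^sub>\<epsilon>>0. \<forall>\<delta>. 0 < \<delta> \<and> \<delta> < \<delta>\<^sub>\<epsilon> \<longrightarrow>
    Lp_norm p (\<lambda>x. nonlocal_deriv (\<mu> \<delta>) u x - a \<bullet> g x) < ennreal \<epsilon>"
proof -
  define r where "r = enn2real p"
  have r: "r \<ge> 1" using p unfolding r_def by (cases p) auto
  obtain u' where u': "u' \<in> borel_measurable borel" "AE x in lborel. u x = u' x"
    and ufin: "lp_mass r u' < \<infinity>"
    unfolding r_def using Lp_borel_representative[OF p(2) u] by blast
  obtain g' where g': "g' \<in> borel_measurable borel" "AE x in lborel. g x = g' x"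
    and gfin: "lp_mass r g' < \<infinity>"
    unfolding r_def using Lp_borel_representative[OF p(2) g] by blast
  have wg': "weak_gradient u' g'"
    by (rule weak_gradient_borel[OF wg u'(2,1) g'(2,1)])
  obtain N where N: "lp_mass r g' = ennreal N" "N \<ge> 0"
    using gfin by (cases "lp_mass r g'") auto
  obtain M where M: "M \<ge> 0" "\<And>\<delta>. \<delta> > 0 \<Longrightarrow> abs_moment lebesgue (\<mu> \<delta>) \<le> ennreal M"
    using bounded_momentsE[OF bm] by blast
  define T where "T = (\<epsilon> / 2) powr r"
  have T: "T > 0" using \<epsilon> by (simp add: T_def)
  \<comment> \<open>\<open>B * e\<close> is the limit of the error bound as \<open>\<omega> \<delta>\<close> tends to \<open>0\<close>.\<close>
  define B where "B = 2 powr r * (M powr (r - 1) * M)"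
  have B: "B \<ge> 0" using M(1) by (simp add: B_def)
  define e where "e = T / (B + 1)"
  have e: "e > 0" "B * e < T"
  proof -
    show "e > 0" using T B by (simp add: e_def)
    have "B * e < (B + 1) * e" using \<open>e > 0\<close> by simp
    also have "\<dots> = T" using B by (simp add: e_def)
    finally show "B * e < T" .
  qed
  have "\<forall>\<^sub>F z in nhds 0. lp_mass r (\<lambda>x. g' (x + z) - g' x) \<le> ennreal e"
    by (rule translation_continuous_Lp[OF g'(1) gfin r e(1)])
  then have "\<exists>d>0. \<forall>z. dist z 0 < d \<longrightarrow> lp_mass r (\<lambda>x. g' (x + z) - g' x) \<le> ennreal e"
    by (simp only: eventually_nhds_metric)
  then obtain d where d_conj: "d > 0 \<and> (\<forall>z. dist z 0 < d \<longrightarrow> lp_mass r (\<lambda>x. g' (x + z) - g' x) \<le> ennreal e)" ..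
  note d = conjunct1[OF d_conj] conjunct2[OF d_conj]
  define bound :: "real \<Rightarrow> real" where "bound w = 2 powr r * (M powr (r - 1) * (M * e + w * (2 powr r * (2 * N))) + w powr r * N)" for w :: real
  have nonneg: "\<forall>\<^sub>F \<delta> in at_right 0. 0 \<le> \<omega> \<delta>"
    using eventually_at_right_less[of "0::real"] by eventually_elim (simp add: \<omega>(3))
  have \<omega>_0: "(\<omega> \<longlongrightarrow> 0) (at_right 0)"
    by (rule modulus_tendsto_0[OF \<omega>(1,2)])
  have "((\<lambda>\<delta>. \<omega> \<delta> powr r) \<longlongrightarrow> 0) (at_right 0)"
    using r by (intro tendsto_zero_powrI[OF \<omega>_0 tendsto_const nonneg]) simp
  then have "((\<lambda>\<delta>. bound (\<omega> \<delta>)) \<longlongrightarrow> 2 powr r * (M powr (r - 1) * (M * e + 0 * (2 powr r * (2 * N))) + 0 * N)) (at_right 0)"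
    unfolding bound_def by (intro tendsto_mult tendsto_add tendsto_const \<omega>_0)
  moreover have "2 powr r * (M powr (r - 1) * (M * e + 0 * (2 powr r * (2 * N))) + 0 * N) < T"
    using e(2) by (simp add: B_def mult_ac)
  ultimately have "\<forall>\<^sub>F \<delta> in at_right 0. bound (\<omega> \<delta>) < T"
    by (rule order_tendstoD(2))
  then obtain d' where d': "d' > 0" "\<And>\<delta>. \<delta> > 0 \<Longrightarrow> \<delta> < d' \<Longrightarrow> bound (\<omega> \<delta>) < T"
    unfolding eventually_at_right_field by blast
  have "Lp_norm p (\<lambda>x. nonlocal_deriv (\<mu> \<delta>) u x - a \<bullet> g x) < ennreal \<epsilon>"
    if \<delta>: "0 < \<delta>" "\<delta> < min d d'" for \<delta>
  proof (rule Lp_norm_less)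
    have tail: "tail_moment lebesgue \<delta> (\<mu> \<delta>) \<le> ennreal (\<omega> \<delta>)"
      and V: "norm ((\<integral>z. \<mu> \<delta> z *\<^sub>R z \<partial>lebesgue) - a) \<le> \<omega> \<delta>"
      using mt mc \<delta>(1) unfolding moments_concentrate_def moments_converge_def by blast+
    obtain k where k: "AE z in lborel. \<mu> \<delta> z = k z" "k \<in> borel_measurable borel" "integrable lborel k"
      "abs_moment lborel k \<le> ennreal M"
      "tail_moment lborel \<delta> k \<le> ennreal (\<omega> \<delta>)"
      "norm ((LBINT z. k z *\<^sub>R z) - a) \<le> \<omega> \<delta>"
      by (rule kernel_representative[OF \<mu>[OF \<delta>(1)] M(2)[OF \<delta>(1)] tail V]) (rule that)
    have "AE x in lborel. nonlocal_deriv (\<mu> \<delta>) u x - a \<bullet> g x = (LBINT z. (u' (x + z) - u' x) * k z) - a \<bullet> g' x"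
      using nonlocal_deriv_borel[OF u'(2,1) k(1,2)] g'(2) by eventually_elim simp
    then have "(\<integral>\<^sup>+x. ennreal (norm (nonlocal_deriv (\<mu> \<delta>) u x - a \<bullet> g x) powr r) \<partial>lebesgue) =
        lp_mass r (\<lambda>x. (LBINT z. (u' (x + z) - u' x) * k z) - a \<bullet> g' x)"
      by (rule nn_integral_lebesgue_cong_borel[of _ _ "\<lambda>_ y. ennreal (norm y powr r)"])
    also have "\<dots> \<le> ennreal (bound (\<omega> \<delta>))"
      unfolding bound_def
    proof (rule lp_mass_nonlocal_error_le[OF wg' u'(1) g'(1) r ufin N k(3,4) M(1) k(5) _ k(6)])
      show "lp_mass r (\<lambda>x. g' (x + z) - g' x) \<le> ennreal e" if "norm z < \<delta>" for z
        using that \<delta> d(2) by simp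
    qed (use \<omega>(3) \<delta> e in auto)
    also have "\<dots> \<le> ennreal T"
      using d'(2)[of \<delta>] \<delta> by (intro ennreal_leI) auto
    finally show "(\<integral>\<^sup>+x. ennreal (norm (nonlocal_deriv (\<mu> \<delta>) u x - a \<bullet> g x) powr enn2real p) \<partial>lebesgue)
        \<le> ennreal ((\<epsilon> / 2) powr enn2real p)"
      unfolding T_def r_def .
  qed (use p r \<epsilon> in \<open>auto simp: r_def\<close>)
  then show ?thesis
    using d(1) d'(1) by (intro exI[of _ "min d d'"]) auto
qed

text \<open>
  The case in which \<open>u\<close> has norm \<open>0\<close>, where the error estimate must hold with \<open>0\<close> on its
  right-hand side.
\<close>
lemma nonlocal_pairing_AE_zero:
  fixes k :: "'a::euclidean_space \<Rightarrow> real"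
  assumes k: "integrable lebesgue k" and u: "AE x in lebesgue. u x = 0"
  shows "(\<integral>x. nonlocal_deriv k u x * \<phi> x \<partial>lebesgue) + (\<integral>x. u x * f x \<partial>lebesgue) = 0"
proof -
  have km: "k \<in> borel_measurable lebesgue" using k by auto
  obtain k' where k': "k' \<in> borel_measurable borel" "AE x in lborel. k x = k' x"
    using borel_representative[OF km] by blast
  have u0: "AE x in lborel. u x = 0"
    using u by (simp add: AE_completion_iff)
  have "AE x in lborel. nonlocal_deriv k u x * \<phi> x = 0"
    using nonlocal_deriv_borel[OF u0 _ k'(2,1)] by (auto elim!: eventually_mono)
  moreover have "AE x in lborel. u x * f x = 0"
    using u0 by eventually_elim simp
  ultimately show ?thesis
    using lebesgue_integral_cong_borel(1)[of "\<lambda>x. nonlocal_deriv k u x * \<phi> x" "\<lambda>_. 0"]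
      lebesgue_integral_cong_borel(1)[of "\<lambda>x. u x * f x" "\<lambda>_. 0"] by simp
qed

theorem theorem2p4:
  fixes \<mu> :: "real \<Rightarrow> 'a::euclidean_space \<Rightarrow> real"
    and a :: 'a
    and \<omega> :: "real \<Rightarrow> real"
    and p p' :: ennreal
  assumes "\<And>\<delta>. \<delta> > 0 \<Longrightarrow> integrable lebesgue (\<mu> \<delta>)"
    and "norm a = 1"
    and "continuous_on {0..} \<omega>" and "\<omega> ` {0..} \<subseteq> {0..}"
    and "mono_on {0..} \<omega>" and "\<omega> 0 = 0"
    and "1 \<le> p" and "p < \<infinity>" and "hoelder_conjugate p p'"
  shows
    "(bounded_moments \<mu> \<and> moments_converge \<mu> a \<omega> \<and> moments_concentrate \<mu> \<omega> \<longrightarrow>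
       (\<forall>u \<in> Lp p.
          (\<forall>\<delta>>0. (AE x in lebesgue. nonlocal_deriv_exists (\<mu> \<delta>) u x) \<and>
                 nonlocal_deriv (\<mu> \<delta>) u \<in> Lp p) \<and>
          (\<forall>\<phi> \<in> W1p p'. \<forall>g \<in> Lp p'. weak_gradient \<phi> g \<longrightarrow>
             (\<forall>\<epsilon>>0. \<exists>\<delta>\<^sub>\<epsilon>>0. \<forall>\<delta>. 0 < \<delta> \<and> \<delta> < \<delta>\<^sub>\<epsilon> \<longrightarrow>
                ennreal \<bar>(\<integral>x. nonlocal_deriv (\<mu> \<delta>) u x * \<phi> x \<partial>lebesgue) +
                         (\<integral>x. u x * (a \<bullet> g x) \<partial>lebesgue)\<bar>
                  \<le> ennreal \<epsilon> * Lp_norm p u))))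
     \<and>
     (bounded_moments \<mu> \<and> moments_converge \<mu> a \<omega> \<and> moments_concentrate \<mu> \<omega> \<longrightarrow>
       (\<forall>u \<in> W1p p. \<forall>g \<in> Lp p. weak_gradient u g \<longrightarrow>
          (\<forall>\<epsilon>>0. \<exists>\<delta>\<^sub>\<epsilon>>0. \<forall>\<delta>. 0 < \<delta> \<and> \<delta> < \<delta>\<^sub>\<epsilon> \<longrightarrow>
             Lp_norm p (\<lambda>x. nonlocal_deriv (\<mu> \<delta>) u x - a \<bullet> g x) < ennreal \<epsilon>)))
     \<and>
     (bounded_moments \<mu> \<and> moments_converge \<mu> a \<omega> \<and> supported_in_balls \<mu> \<longrightarrow>
       (\<forall>u G \<alpha>. (\<forall>x. GDERIV u x :> G x) \<and> 0 < \<alpha> \<and> \<alpha> \<le> 1 \<and>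
          hoelder_on \<alpha> {0..} \<omega> \<and> hoelder_on \<alpha> UNIV G \<longrightarrow>
          (\<forall>x. (\<forall>\<delta>>0. nonlocal_deriv_exists (\<mu> \<delta>) u x) \<and>
               (\<exists>C. \<forall>\<delta>>0. \<bar>nonlocal_deriv (\<mu> \<delta>) u x - a \<bullet> G x\<bar> < C * \<delta> powr \<alpha>))))"
proof (intro conjI impI ballI allI)
  have \<omega>: "continuous_on {0..} \<omega>" "\<omega> 0 = 0" "\<And>\<delta>. \<delta> \<ge> 0 \<Longrightarrow> \<omega> \<delta> \<ge> 0"
    using assms(3,4,6) by auto
  {
    fix u :: "'a \<Rightarrow> real" assume "u \<in> Lp p"
    fix \<delta> :: real assume "\<delta> > 0"
    from nonlocal_deriv_Lp[OF assms(7,8) assms(1)[OF this] \<open>u \<in> Lp p\<close>]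
    show "AE x in lebesgue. nonlocal_deriv_exists (\<mu> \<delta>) u x" "nonlocal_deriv (\<mu> \<delta>) u \<in> Lp p"
      by auto
  }
  {
    fix u \<phi> :: "'a \<Rightarrow> real" and g :: "'a \<Rightarrow> 'a" and \<epsilon> :: real
    assume hyps: "bounded_moments \<mu> \<and> moments_converge \<mu> a \<omega> \<and> moments_concentrate \<mu> \<omega>"
      and u: "u \<in> Lp p" and \<phi>: "\<phi> \<in> W1p p'" and g: "g \<in> Lp p'" and wg: "weak_gradient \<phi> g" and \<epsilon>: "0 < \<epsilon>"
    show "\<exists>\<delta>\<^sub>\<epsilon>>0. \<forall>\<delta>. 0 < \<delta> \<and> \<delta> < \<delta>\<^sub>\<epsilon> \<longrightarrow>
        ennreal \<bar>(\<integral>x. nonlocal_deriv (\<mu> \<delta>) u x * \<phi> x \<partial>lebesgue) + (\<integral>x. u x * (a \<bullet> g x) \<partial>lebesgue)\<bar>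
        \<le> ennreal \<epsilon> * Lp_norm p u"
    proof (cases "AE x in lebesgue. u x = 0")
      case True
      show ?thesis
        using nonlocal_pairing_AE_zero[OF assms(1) True] by (intro exI[of _ 1]) simp
    next
      case False
      obtain c where c: "c > 0" "Lp_norm p u = ennreal c"
        using Lp_norm_pos[OF assms(8) u False] by blast
      note h = conjunct1[OF hyps] conjunct1[OF conjunct2[OF hyps]] conjunct2[OF conjunct2[OF hyps]]
      have "\<phi> \<in> Lp p'" using \<phi> by (simp add: W1p_def)
      have "\<epsilon> * c > 0" using \<epsilon> c by simp
      have "ennreal \<epsilon> * Lp_norm p u = ennreal (\<epsilon> * c)"
        using \<epsilon> c by (simp add: ennreal_mult)
      moreover obtain d where "d > 0" "\<forall>\<delta>. 0 < \<delta> \<and> \<delta> < d \<longrightarrow>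
          \<bar>(\<integral>x. nonlocal_deriv (\<mu> \<delta>) u x * \<phi> x \<partial>lebesgue) + (\<integral>x. u x * (a \<bullet> g x) \<partial>lebesgue)\<bar> \<le> \<epsilon> * c"
      proof -
        have "\<exists>d>0. \<forall>\<delta>. 0 < \<delta> \<and> \<delta> < d \<longrightarrow>
            \<bar>(\<integral>x. nonlocal_deriv (\<mu> \<delta>) u x * \<phi> x \<partial>lebesgue) + (\<integral>x. u x * (a \<bullet> g x) \<partial>lebesgue)\<bar> \<le> \<epsilon> * c"
          by (rule nonlocal_deriv_weak_convergence[OF assms(1) \<omega> assms(7,8,9) h(1,2,3) u
                \<open>\<phi> \<in> Lp p'\<close> g wg \<open>\<epsilon> * c > 0\<close>])
        then show ?thesis by (elim exE conjE) (rule that)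
      qed
      ultimately show ?thesis
        by (intro exI[of _ d]) (simp add: ennreal_leI)
    qed
  }
  {
    fix u :: "'a \<Rightarrow> real" and g :: "'a \<Rightarrow> 'a" and \<epsilon> :: real
    assume hyps: "bounded_moments \<mu> \<and> moments_converge \<mu> a \<omega> \<and> moments_concentrate \<mu> \<omega>"
      and u: "u \<in> W1p p" and g: "g \<in> Lp p" and wg: "weak_gradient u g" and \<epsilon>: "0 < \<epsilon>"
    note h = conjunct1[OF hyps] conjunct1[OF conjunct2[OF hyps]] conjunct2[OF conjunct2[OF hyps]]
    have "u \<in> Lp p" using u by (simp add: W1p_def)
    show "\<exists>\<delta>\<^sub>\<epsilon>>0. \<forall>\<delta>. 0 < \<delta> \<and> \<delta> < \<delta>\<^sub>\<epsilon> \<longrightarrow>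
        Lp_norm p (\<lambda>x. nonlocal_deriv (\<mu> \<delta>) u x - a \<bullet> g x) < ennreal \<epsilon>"
      by (rule nonlocal_deriv_Lp_convergence[OF assms(1) \<omega> assms(7,8) h(1,2,3) \<open>u \<in> Lp p\<close> g wg \<epsilon>])
  }
  fix u :: "'a \<Rightarrow> real" and G :: "'a \<Rightarrow> 'a" and \<alpha> :: real and x :: 'a
  assume h: "bounded_moments \<mu> \<and> moments_converge \<mu> a \<omega> \<and> supported_in_balls \<mu>"
    and uG: "(\<forall>x. GDERIV u x :> G x) \<and> 0 < \<alpha> \<and> \<alpha> \<le> 1 \<and> hoelder_on \<alpha> {0..} \<omega> \<and> hoelder_on \<alpha> UNIV G"
  obtain L where L: "\<And>x y. dist (G x) (G y) \<le> L * dist x y powr \<alpha>"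
    using uG unfolding hoelder_on_def by auto
  obtain K where K: "\<And>s t. s \<ge> 0 \<Longrightarrow> t \<ge> 0 \<Longrightarrow> dist (\<omega> s) (\<omega> t) \<le> K * dist s t powr \<alpha>"
    using uG unfolding hoelder_on_def by auto
  have L': "norm (G x - G y) \<le> \<bar>L\<bar> * norm (x - y) powr \<alpha>" for x y
  proof -
    have "L * norm (x - y) powr \<alpha> \<le> \<bar>L\<bar> * norm (x - y) powr \<alpha>"
      by (intro mult_right_mono) auto
    with L[of x y] show ?thesis by (simp add: dist_norm)
  qed
  obtain M where M: "M \<ge> 0" "\<And>\<delta>. \<delta> > 0 \<Longrightarrow> abs_moment lebesgue (\<mu> \<delta>) \<le> ennreal M"
    using bounded_momentsE h by blast
  have V: "norm ((\<integral>z. \<mu> \<delta> z *\<^sub>R z \<partial>lebesgue) - a) \<le> \<omega> \<delta>" if "\<delta> > 0" for \<delta>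
    using h that unfolding moments_converge_def by blast
  have supp: "ess_support (\<mu> \<delta>) \<subseteq> cball 0 \<delta>" if "\<delta> > 0" for \<delta>
    using h that unfolding supported_in_balls_def by auto
  have GD: "GDERIV u x :> G x" for x using uG by blast
  have \<alpha>: "\<alpha> > 0" using uG by blast
  note rate = nonlocal_deriv_hoelder_rate[OF GD \<alpha> L' abs_ge_zero assms(1) _ supp M(2) M(1) V]
  show "nonlocal_deriv_exists (\<mu> \<delta>) u x" if "\<delta> > 0" for \<delta>
    using that by (intro rate(1))
  \<comment> \<open>The summand \<open>1\<close> makes the inequality strict.\<close>
  have "\<bar>nonlocal_deriv (\<mu> \<delta>) u x - a \<bullet> G x\<bar> < (\<bar>L\<bar> * M + K * norm (G x) + 1) * \<delta> powr \<alpha>" if \<delta>: "\<delta> > 0" for \<delta>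
  proof -
    have "\<omega> \<delta> \<le> K * \<delta> powr \<alpha>"
      using K[of \<delta> 0] \<delta> assms(6) \<omega>(3)[of \<delta>] by (simp add: dist_real_def)
    then have "\<omega> \<delta> * norm (G x) \<le> K * \<delta> powr \<alpha> * norm (G x)"
      by (intro mult_right_mono) auto
    moreover have "\<bar>nonlocal_deriv (\<mu> \<delta>) u x - a \<bullet> G x\<bar> \<le> \<bar>L\<bar> * M * \<delta> powr \<alpha> + \<omega> \<delta> * norm (G x)"
      using \<delta> by (intro rate(2))
    moreover have "(\<bar>L\<bar> * M + K * norm (G x) + 1) * \<delta> powr \<alpha> =
        \<bar>L\<bar> * M * \<delta> powr \<alpha> + K * \<delta> powr \<alpha> * norm (G x) + \<delta> powr \<alpha>"
      by (simp add: algebra_simps)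
    moreover have "\<delta> powr \<alpha> > 0" using \<delta> by simp
    ultimately show ?thesis by linarith
  qed
  then show "\<exists>C. \<forall>\<delta>>0. \<bar>nonlocal_deriv (\<mu> \<delta>) u x - a \<bullet> G x\<bar> < C * \<delta> powr \<alpha>"
    by blast
qed

end
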